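(* Let $(M,g)$ be a closed connected pseudo-Riemannian manifold such that the cone $(\widehat M,\widehat g)$ over $(M,g)$ is decomposable. Then $\widehat g$ is a flat Riemannian (positive definite) metric, and $g$ is a Riemannian metric of constant curvature $1$.
   Context: Pseudo-Riemannian metrics are nondegenerate of arbitrary signature; Riemannian (positive definite) metrics are included. Closed means compact without boundary. The cone over $(M,g)$ is the manifold $\widehat M=\mathbb{R}_{>0}\times M$ with the metric $\widehat g=dr^2+r^2g$, where $r$ is the standard coordinate on $\mathbb{R}_{>0}$. A pseudo-Riemannian manifold is called decomposable if it possesses a non-trivial (i.e. neither zero nor the whole tangent bundle) distribution that is parallel with respect to the Levi-Civita connection and non-degenerate (i.e. the restriction of the metric to the distribution is nondegenerate). *)

theory Defs
  imports "HOL-Analysis.Analysis"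
begin

subsection \<open>Smooth maps between Euclidean spaces\<close>

(* For open S; iterated directional derivatives suffice since the domain is finite-dimensional. *)
fun Ck_on :: "nat \<Rightarrow> 'a::euclidean_space set \<Rightarrow> ('a \<Rightarrow> 'b::real_normed_vector) \<Rightarrow> bool" where
  "Ck_on 0 S f \<longleftrightarrow> continuous_on S f"
| "Ck_on (Suc k) S f \<longleftrightarrow>
     (\<forall>x\<in>S. f differentiable (at x)) \<and>
     (\<forall>v. Ck_on k S (\<lambda>x. frechet_derivative f (at x) v))"

definition smooth_on :: "'a::euclidean_space set \<Rightarrow> ('a \<Rightarrow> 'b::real_normed_vector) \<Rightarrow> bool" where
  "smooth_on S f \<longleftrightarrow> (\<forall>k. Ck_on k S f)"


subsection \<open>Smooth manifolds\<close>

(* A topological space with an atlas modelled on 'a and indexed by "charts".  Only the values of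
   "cmap i" on "cdom i" matter.  Charts map onto open sets, so there is no boundary.
   The class euclidean_space excludes dimension zero; a connected 0-manifold is a point, whose
   cone is one-dimensional and hence has no non-trivial distribution. *)
record ('m, 'i, 'a) atlas =
  mtop :: "'m topology"
  charts :: "'i set"
  cdom :: "'i \<Rightarrow> 'm set"
  cmap :: "'i \<Rightarrow> 'm \<Rightarrow> 'a"

definition cimage :: "('m, 'i, 'a) atlas \<Rightarrow> 'i \<Rightarrow> 'a set" where
  "cimage M i = cmap M i ` cdom M i"

definition overlap :: "('m, 'i, 'a) atlas \<Rightarrow> 'i \<Rightarrow> 'i \<Rightarrow> 'a set" where
  "overlap M i j = cmap M i ` (cdom M i \<inter> cdom M j)"

definition transition :: "('m, 'i, 'a) atlas \<Rightarrow> 'i \<Rightarrow> 'i \<Rightarrow> 'a \<Rightarrow> 'a" where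
  "transition M i j = cmap M j \<circ> inv_into (cdom M i) (cmap M i)"

definition smooth_manifold :: "('m, 'i, 'a::euclidean_space) atlas \<Rightarrow> bool" where
  "smooth_manifold M \<longleftrightarrow>
     Hausdorff_space (mtop M) \<and> second_countable (mtop M) \<and>
     topspace (mtop M) = (\<Union>i\<in>charts M. cdom M i) \<and>
     (\<forall>i\<in>charts M. openin (mtop M) (cdom M i) \<and> open (cimage M i) \<and>
        homeomorphic_map (subtopology (mtop M) (cdom M i)) (top_of_set (cimage M i)) (cmap M i)) \<and>
     (\<forall>i\<in>charts M. \<forall>j\<in>charts M. smooth_on (overlap M i j) (transition M i j))"

definition closed_connected :: "('m, 'i, 'a) atlas \<Rightarrow> bool" where
  "closed_connected M \<longleftrightarrow> compact_space (mtop M) \<and> connected_space (mtop M)"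


subsection \<open>Pseudo-Riemannian metrics\<close>

(* Tensor fields are given by their representations in the charts: "g i x v w" is the value at the
   point of chart i with coordinates x, on the tangent vectors whose components in chart i are v
   and w.  Representations in two charts are related by the differential of the transition map. *)
type_synonym ('i, 'a) metric = "'i \<Rightarrow> 'a \<Rightarrow> 'a \<Rightarrow> 'a \<Rightarrow> real"

definition pseudo_riemannian ::
    "('m, 'i, 'a::euclidean_space) atlas \<Rightarrow> ('i, 'a) metric \<Rightarrow> bool" where
  "pseudo_riemannian M g \<longleftrightarrow>
     smooth_manifold M \<and>
     (\<forall>i\<in>charts M. \<forall>v w. smooth_on (cimage M i) (\<lambda>x. g i x v w)) \<and>
     (\<forall>i\<in>charts M. \<forall>x\<in>cimage M i.
        bilinear (g i x) \<and> (\<forall>v w. g i x v w = g i x w v) \<and>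
        (\<forall>v. (\<forall>w. g i x v w = 0) \<longrightarrow> v = 0)) \<and>
     (\<forall>i\<in>charts M. \<forall>j\<in>charts M. \<forall>x\<in>overlap M i j. \<forall>v w.
        g i x v w = g j (transition M i j x)
          (frechet_derivative (transition M i j) (at x) v)
          (frechet_derivative (transition M i j) (at x) w))"

definition riemannian ::
    "('m, 'i, 'a::euclidean_space) atlas \<Rightarrow> ('i, 'a) metric \<Rightarrow> bool" where
  "riemannian M g \<longleftrightarrow>
     pseudo_riemannian M g \<and> (\<forall>i\<in>charts M. \<forall>x\<in>cimage M i. \<forall>v. v \<noteq> 0 \<longrightarrow> g i x v v > 0)"


subsection \<open>Levi-Civita connection and curvature in a chart\<close>

(* Here h is the representation of the metric in one chart and vector fields are functions
   'a => 'a.  A connection in a chart has the form nabla_X Y = dY(X) + \<Gamma>(X, Y) with \<Gamma> bilinear at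
   each point; it is torsion-free iff \<Gamma> is symmetric, and it is metric iff the last clause (the
   compatibility condition for fields with constant components) holds.  See levi_civita_ex1,
   nabla_torsion_free and nabla_metric below. *)
definition levi_civita_at ::
    "('a::euclidean_space \<Rightarrow> 'a \<Rightarrow> 'a \<Rightarrow> real) \<Rightarrow> 'a \<Rightarrow> ('a \<Rightarrow> 'a \<Rightarrow> 'a) \<Rightarrow> bool" where
  "levi_civita_at h x \<Gamma> \<longleftrightarrow>
     bilinear \<Gamma> \<and> (\<forall>u v. \<Gamma> u v = \<Gamma> v u) \<and>
     (\<forall>u v w. frechet_derivative (\<lambda>y. h y v w) (at x) u = h x (\<Gamma> u v) w + h x v (\<Gamma> u w))"

definition christoffel ::
    "('a::euclidean_space \<Rightarrow> 'a \<Rightarrow> 'a \<Rightarrow> real) \<Rightarrow> 'a \<Rightarrow> 'a \<Rightarrow> 'a \<Rightarrow> 'a" where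
  "christoffel h x = (THE \<Gamma>. levi_civita_at h x \<Gamma>)"

definition nabla ::
    "('a::euclidean_space \<Rightarrow> 'a \<Rightarrow> 'a \<Rightarrow> real) \<Rightarrow> ('a \<Rightarrow> 'a) \<Rightarrow> ('a \<Rightarrow> 'a) \<Rightarrow> 'a \<Rightarrow> 'a" where
  "nabla h X Y x = frechet_derivative Y (at x) (X x) + christoffel h x (X x) (Y x)"

definition lie_bracket ::
    "('a::euclidean_space \<Rightarrow> 'a) \<Rightarrow> ('a \<Rightarrow> 'a) \<Rightarrow> 'a \<Rightarrow> 'a" where
  "lie_bracket X Y x = frechet_derivative Y (at x) (X x) - frechet_derivative X (at x) (Y x)"

definition curvature ::
    "('a::euclidean_space \<Rightarrow> 'a \<Rightarrow> 'a \<Rightarrow> real) \<Rightarrow>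
     ('a \<Rightarrow> 'a) \<Rightarrow> ('a \<Rightarrow> 'a) \<Rightarrow> ('a \<Rightarrow> 'a) \<Rightarrow> 'a \<Rightarrow> 'a" where
  "curvature h X Y Z x =
     nabla h X (nabla h Y Z) x - nabla h Y (nabla h X Z) x - nabla h (lie_bracket X Y) Z x"

(* The curvature is tensorial, so tangent vectors may be extended by constant components. *)
definition curvature_at ::
    "('a::euclidean_space \<Rightarrow> 'a \<Rightarrow> 'a \<Rightarrow> real) \<Rightarrow> 'a \<Rightarrow> 'a \<Rightarrow> 'a \<Rightarrow> 'a \<Rightarrow> 'a" where
  "curvature_at h x u v w = curvature h (\<lambda>_. u) (\<lambda>_. v) (\<lambda>_. w) x"

definition sectional_curvature ::
    "('a::euclidean_space \<Rightarrow> 'a \<Rightarrow> 'a \<Rightarrow> real) \<Rightarrow> 'a \<Rightarrow> 'a \<Rightarrow> 'a \<Rightarrow> real" where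
  "sectional_curvature h x u v =
     h x (curvature_at h x u v v) u / (h x u u * h x v v - (h x u v)\<^sup>2)"

definition flat_metric ::
    "('m, 'i, 'a::euclidean_space) atlas \<Rightarrow> ('i, 'a) metric \<Rightarrow> bool" where
  "flat_metric M g \<longleftrightarrow>
     (\<forall>i\<in>charts M. \<forall>x\<in>cimage M i. \<forall>u v w. curvature_at (g i) x u v w = 0)"

(* The nonvanishing condition says that u and v span a nondegenerate tangent plane.  As usual, the
   condition is void in dimension one. *)
definition constant_curvature ::
    "('m, 'i, 'a::euclidean_space) atlas \<Rightarrow> ('i, 'a) metric \<Rightarrow> real \<Rightarrow> bool" where
  "constant_curvature M g c \<longleftrightarrow>
     (\<forall>i\<in>charts M. \<forall>x\<in>cimage M i. \<forall>u v.
        g i x u u * g i x v v - (g i x u v)\<^sup>2 \<noteq> 0 \<longrightarrow> sectional_curvature (g i) x u v = c)"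


subsection \<open>Distributions and decomposability\<close>

(* D i x is the fibre in components of chart i; a distribution is a smooth subbundle of some
   rank k, i.e. locally spanned by k pointwise linearly independent smooth vector fields. *)
definition distribution ::
    "('m, 'i, 'a::euclidean_space) atlas \<Rightarrow> ('i \<Rightarrow> 'a \<Rightarrow> 'a set) \<Rightarrow> bool" where
  "distribution M D \<longleftrightarrow>
     (\<forall>i\<in>charts M. \<forall>j\<in>charts M. \<forall>x\<in>overlap M i j.
        D j (transition M i j x) = frechet_derivative (transition M i j) (at x) ` D i x) \<and>
     (\<exists>k. \<forall>i\<in>charts M. \<forall>x\<in>cimage M i. \<exists>W E. open W \<and> x \<in> W \<and> W \<subseteq> cimage M i \<and>
        (\<forall>a<k. smooth_on W (E a)) \<and>
        (\<forall>y\<in>W. inj_on (\<lambda>a::nat. E a y) {..<k} \<and> independent ((\<lambda>a. E a y) ` {..<k}) \<and>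
           D i y = span ((\<lambda>a. E a y) ` {..<k})))"

definition parallel_distribution ::
    "('m, 'i, 'a::euclidean_space) atlas \<Rightarrow> ('i, 'a) metric \<Rightarrow> ('i \<Rightarrow> 'a \<Rightarrow> 'a set) \<Rightarrow> bool" where
  "parallel_distribution M g D \<longleftrightarrow>
     (\<forall>i\<in>charts M. \<forall>W X Y. open W \<longrightarrow> W \<subseteq> cimage M i \<longrightarrow> smooth_on W X \<longrightarrow> smooth_on W Y \<longrightarrow>
        (\<forall>x\<in>W. Y x \<in> D i x) \<longrightarrow> (\<forall>x\<in>W. nabla (g i) X Y x \<in> D i x))"

definition nondegenerate_distribution ::
    "('m, 'i, 'a::euclidean_space) atlas \<Rightarrow> ('i, 'a) metric \<Rightarrow> ('i \<Rightarrow> 'a \<Rightarrow> 'a set) \<Rightarrow> bool" where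
  "nondegenerate_distribution M g D \<longleftrightarrow>
     (\<forall>i\<in>charts M. \<forall>x\<in>cimage M i. \<forall>v\<in>D i x. (\<forall>w\<in>D i x. g i x v w = 0) \<longrightarrow> v = 0)"

definition nontrivial_distribution ::
    "('m, 'i, 'a::euclidean_space) atlas \<Rightarrow> ('i \<Rightarrow> 'a \<Rightarrow> 'a set) \<Rightarrow> bool" where
  "nontrivial_distribution M D \<longleftrightarrow>
     \<not> (\<forall>i\<in>charts M. \<forall>x\<in>cimage M i. D i x = {0}) \<and>
     \<not> (\<forall>i\<in>charts M. \<forall>x\<in>cimage M i. D i x = UNIV)"

definition decomposable ::
    "('m, 'i, 'a::euclidean_space) atlas \<Rightarrow> ('i, 'a) metric \<Rightarrow> bool" where
  "decomposable M g \<longleftrightarrow>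
     (\<exists>D. distribution M D \<and> nontrivial_distribution M D \<and>
          parallel_distribution M g D \<and> nondegenerate_distribution M g D)"


subsection \<open>The cone\<close>

definition metric_cone :: "('m, 'i, 'a::euclidean_space) atlas \<Rightarrow> (real \<times> 'm, 'i, real \<times> 'a) atlas" where
  "metric_cone M = \<lparr> mtop = prod_topology (top_of_set {0<..}) (mtop M),
              charts = charts M,
              cdom = (\<lambda>i. {0<..} \<times> cdom M i),
              cmap = (\<lambda>i (r, p). (r, cmap M i p)) \<rparr>"

definition cone_metric :: "('i, 'a) metric \<Rightarrow> ('i, real \<times> 'a) metric" where
  "cone_metric g = (\<lambda>i (r, x) (s, v) (t, w). s * t + r\<^sup>2 * g i x v w)"


subsection \<open>The Levi-Civita connection is well defined\<close>

lemma bilinear_nondegenerate_represent: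
  fixes h :: "'a::euclidean_space \<Rightarrow> 'a \<Rightarrow> real"
  assumes h: "bilinear h" and nd: "\<And>v. (\<And>w. h v w = 0) \<Longrightarrow> v = 0" and l: "linear l"
  shows "\<exists>z. \<forall>w. h z w = l w"
proof -
  define F where "F z = (\<Sum>b\<in>Basis. h z b *\<^sub>R b)" for z
  have lin: "linear (\<lambda>z. h z b)" "linear (h b)" for b
    using h by (auto simp: bilinear_def)
  have Fb: "F z \<bullet> b = h z b" if "b \<in> Basis" for z b
    unfolding F_def using that by (simp add: inner_sum_left inner_Basis if_distrib cong: if_cong)
  have linF: "linear F"
    unfolding F_def
    by (intro linear_compose_sum ballI linearI)
       (simp_all add: linear_add[OF lin(1)] linear_scale[OF lin(1)] scaleR_add_left)
  have eqB: "h z w = l' w" if "linear l'" "\<And>b. b \<in> Basis \<Longrightarrow> h z b = l' b" for z w l'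
    using linear_eq_stdbasis[OF lin(2) that(1)] that(2) by metis
  have "inj F"
  proof (subst linear_injective_0[OF linF], intro allI impI)
    fix z assume "F z = 0"
    then have "h z b = 0" if "b \<in> Basis" for b using Fb[OF that, of z] by simp
    then show "z = 0" using nd eqB[of "\<lambda>_. 0"] by (simp add: linear_zero)
  qed
  then obtain z where z: "F z = (\<Sum>b\<in>Basis. l b *\<^sub>R b)"
    using linear_injective_imp_surjective[OF linF] by (metis surjD)
  have "h z b = l b" if "b \<in> Basis" for b
  proof -
    have "h z b = F z \<bullet> b" using Fb[OF that] by simp
    also have "\<dots> = l b"
      unfolding z using that by (simp add: inner_sum_left inner_Basis if_distrib cong: if_cong)
    finally show ?thesis .
  qed
  then show ?thesis using eqB[OF l] by blast
qed

lemma levi_civita_ex1: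
  fixes h :: "'a::euclidean_space \<Rightarrow> 'a \<Rightarrow> 'a \<Rightarrow> real"
  assumes S: "open S" "x \<in> S"
    and bil: "\<And>y. y \<in> S \<Longrightarrow> bilinear (h y)"
    and sym: "\<And>y v w. y \<in> S \<Longrightarrow> h y v w = h y w v"
    and nd: "\<And>v. (\<And>w. h x v w = 0) \<Longrightarrow> v = 0"
    and diff: "\<And>v w. (\<lambda>y. h y v w) differentiable (at x)"
  shows "\<exists>!\<Gamma>. levi_civita_at h x \<Gamma>"
proof -
  define d where "d u v w = frechet_derivative (\<lambda>y. h y v w) (at x) u" for u v w
  have hd: "((\<lambda>y. h y v w) has_derivative (\<lambda>u. d u v w)) (at x)" for v w
    using diff frechet_derivative_works unfolding d_def by blast
  have du: "linear (\<lambda>u. d u v w)" for v w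
    using has_derivative_linear[OF hd] .
  have dsym: "d u v w = d u w v" for u v w
  proof -
    have "((\<lambda>y. h y w v) has_derivative (\<lambda>u. d u v w)) (at x)"
      by (rule has_derivative_transform_within_open[OF hd S]) (rule sym)
    from has_derivative_unique[OF this hd[of w v]] show ?thesis by metis
  qed
  have dv: "linear (\<lambda>v. d u v w)" for u w
  proof (rule linearI)
    fix v v'
    have "((\<lambda>y. h y (v + v') w) has_derivative (\<lambda>u. d u v w + d u v' w)) (at x)"
      by (rule has_derivative_transform_within_open[OF has_derivative_add[OF hd[of v w] hd[of v' w]] S])
         (simp add: bilinear_ladd[OF bil])
    from has_derivative_unique[OF this hd[of "v + v'" w]] show "d u (v + v') w = d u v w + d u v' w"
      by metis
  next
    fix c :: real and v
    have "((\<lambda>y. h y (c *\<^sub>R v) w) has_derivative (\<lambda>u. c * d u v w)) (at x)"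
      by (rule has_derivative_transform_within_open[OF has_derivative_mult_right[OF hd[of v w]] S])
         (simp add: bilinear_lmul[OF bil])
    from has_derivative_unique[OF this hd[of "c *\<^sub>R v" w]] show "d u (c *\<^sub>R v) w = c *\<^sub>R d u v w"
      by (metis real_scaleR_def)
  qed
  have dw: "linear (\<lambda>w. d u v w)" for u v
    using dv[of u v] by (subst dsym)
  note lins = linear_add[OF du] linear_add[OF dv] linear_add[OF dw]
    linear_scale[OF du] linear_scale[OF dv] linear_scale[OF dw]
  note bx = bil[OF S(2)]
  have cancel: "z = z'" if "\<And>w. h x z w = h x z' w" for z z'
    using nd[of "z - z'"] that by (simp add: bilinear_lsub[OF bx])
  define k where "k u v w = (d u v w + d v u w - d w u v) / 2" for u v w
  have "\<exists>z. \<forall>w. h x z w = k u v w" for u v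
  proof (rule bilinear_nondegenerate_represent[OF bx nd])
    show "linear (k u v)"
      unfolding k_def by (rule linearI) (simp_all add: lins algebra_simps add_divide_distrib diff_divide_distrib)
  qed
  then obtain G where G: "\<And>u v w. h x (G u v) w = k u v w"
    by metis
  have Gsym: "G u v = G v u" for u v
    by (rule cancel) (simp add: G k_def dsym[of _ u v])
  have Glin: "linear (G u)" for u
    by (rule linearI; rule cancel)
       (simp_all add: G bilinear_ladd[OF bx] bilinear_lmul[OF bx] k_def lins
          algebra_simps add_divide_distrib diff_divide_distrib)
  have "bilinear G"
    unfolding bilinear_def using Glin Gsym by (auto simp: Gsym[of _ v for v])
  moreover have "d u v w = h x (G u v) w + h x v (G u w)" for u v w
    unfolding sym[OF S(2), of v] G k_def
    by (simp add: dsym[of u w v] dsym[of v w u] dsym[of w v u] field_simps)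
  ultimately have ex: "levi_civita_at h x G"
    using Gsym unfolding levi_civita_at_def d_def by blast
  have uniq: "\<Gamma> u v = G u v" if L: "levi_civita_at h x \<Gamma>" for \<Gamma> u v
  proof (rule cancel)
    fix w
    have s: "\<Gamma> a b = \<Gamma> b a" for a b using L by (simp add: levi_civita_at_def)
    have m: "d a b c = h x (\<Gamma> a b) c + h x (\<Gamma> a c) b" for a b c
      using L sym[OF S(2)] by (simp add: levi_civita_at_def d_def)
    show "h x (\<Gamma> u v) w = h x (G u v) w"
      unfolding G k_def m by (simp add: s[of v u] s[of w u] s[of w v])
  qed
  show ?thesis
    using ex uniq by (intro ex1I[of _ G]) (auto intro!: ext)
qed

lemma nabla_torsion_free:
  assumes "levi_civita_at h x (christoffel h x)"
  shows "nabla h X Y x - nabla h Y X x = lie_bracket X Y x"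
proof -
  have "christoffel h x (X x) (Y x) = christoffel h x (Y x) (X x)"
    using assms unfolding levi_civita_at_def by blast
  then show ?thesis unfolding nabla_def lie_bracket_def by simp
qed

lemma bilinear_expand:
  fixes B :: "'a::euclidean_space \<Rightarrow> 'a \<Rightarrow> real"
  assumes "bilinear B"
  shows "B v w = (\<Sum>b\<in>Basis. \<Sum>c\<in>Basis. (v \<bullet> b) * (w \<bullet> c) * B b c)"
proof -
  have lin: "linear (\<lambda>v. B v w)" "linear (B v)" for v w
    using assms by (auto simp: bilinear_def)
  have "B v w = B (\<Sum>b\<in>Basis. (v \<bullet> b) *\<^sub>R b) (\<Sum>c\<in>Basis. (w \<bullet> c) *\<^sub>R c)"
    by (simp add: euclidean_representation)
  also have "\<dots> = (\<Sum>b\<in>Basis. (v \<bullet> b) * B b (\<Sum>c\<in>Basis. (w \<bullet> c) *\<^sub>R c))"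
    unfolding linear_sum[OF lin(1)] linear_scale[OF lin(1)] by simp
  also have "\<dots> = (\<Sum>b\<in>Basis. (v \<bullet> b) * (\<Sum>c\<in>Basis. (w \<bullet> c) * B b c))"
    unfolding linear_sum[OF lin(2)] linear_scale[OF lin(2)] by simp
  finally show ?thesis by (simp add: sum_distrib_left mult.assoc)
qed

lemma nabla_metric:
  fixes h :: "'a::euclidean_space \<Rightarrow> 'a \<Rightarrow> 'a \<Rightarrow> real"
  assumes S: "open S" "x \<in> S"
    and bil: "\<And>y. y \<in> S \<Longrightarrow> bilinear (h y)"
    and diff: "\<And>v w. (\<lambda>y. h y v w) differentiable (at x)"
    and lc: "levi_civita_at h x (christoffel h x)"
    and Y: "Y differentiable (at x)" and Z: "Z differentiable (at x)"
  shows "frechet_derivative (\<lambda>y. h y (Y y) (Z y)) (at x) (X x)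
       = h x (nabla h X Y x) (Z x) + h x (Y x) (nabla h X Z x)"
proof -
  define u where "u = X x"
  define \<Gamma> where "\<Gamma> = christoffel h x"
  define Y' where "Y' = frechet_derivative Y (at x)"
  define Z' where "Z' = frechet_derivative Z (at x)"
  define d where "d u v w = frechet_derivative (\<lambda>y. h y v w) (at x) u" for u v w
  note bx = bil[OF S(2)]
  have hY: "(Y has_derivative Y') (at x)" and hZ: "(Z has_derivative Z') (at x)"
    using Y Z frechet_derivative_works unfolding Y'_def Z'_def by blast+
  have hd: "((\<lambda>y. h y v w) has_derivative (\<lambda>u. d u v w)) (at x)" for v w
    using diff frechet_derivative_works unfolding d_def by blast
  have deq: "d u v w = h x (\<Gamma> u v) w + h x v (\<Gamma> u w)" for u v w
    using lc unfolding levi_civita_at_def d_def \<Gamma>_def by blast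
  have G: "bilinear \<Gamma>" using lc unfolding levi_civita_at_def \<Gamma>_def by blast
  have bd: "bilinear (d u)" for u
    unfolding bilinear_def deq
    by (auto intro!: linearI simp: bilinear_ladd[OF bx] bilinear_radd[OF bx] bilinear_lmul[OF bx]
        bilinear_rmul[OF bx] bilinear_radd[OF G] bilinear_rmul[OF G] algebra_simps)
  have "((\<lambda>y. \<Sum>b\<in>Basis. \<Sum>c\<in>Basis. (Y y \<bullet> b) * (Z y \<bullet> c) * h y b c) has_derivative
     (\<lambda>u. \<Sum>b\<in>Basis. \<Sum>c\<in>Basis. (Y' u \<bullet> b) * (Z x \<bullet> c) * h x b c
        + (Y x \<bullet> b) * (Z' u \<bullet> c) * h x b c + (Y x \<bullet> b) * (Z x \<bullet> c) * d u b c)) (at x)"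
    by (rule has_derivative_eq_rhs, (rule derivative_intros hY hZ hd)+)
       (auto simp: fun_eq_iff algebra_simps intro!: sum.cong)
  then have "((\<lambda>y. h y (Y y) (Z y)) has_derivative
      (\<lambda>u. h x (Y' u) (Z x) + h x (Y x) (Z' u) + d u (Y x) (Z x))) (at x)"
    unfolding bilinear_expand[OF bx, of "Y' _"] bilinear_expand[OF bx, of _ "Z' _"]
      bilinear_expand[OF bd, of _ "Y x"] sum.distrib
    by (rule has_derivative_transform_within_open[OF _ S]) (rule bilinear_expand[OF bil, symmetric])
  from frechet_derivative_at[OF this, symmetric]
  have "frechet_derivative (\<lambda>y. h y (Y y) (Z y)) (at x) u
      = h x (Y' u) (Z x) + h x (Y x) (Z' u) + d u (Y x) (Z x)"
    by simp
  then show ?thesis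
    unfolding nabla_def deq u_def Y'_def Z'_def \<Gamma>_def
    by (simp add: bilinear_ladd[OF bx] bilinear_radd[OF bx])
qed

end

theory Submission
  imports Defs
begin

text \<open>
  Write \<open>H\<close> for the metric of the cone and \<open>\<xi> = r \<partial>\<^sub>r\<close> for the radial field; it satisfies
  \<open>\<nabla>\<^sub>X \<xi> = X\<close>. Let \<open>P\<close> be the orthogonal projection onto the given distribution and \<open>Q = 1 - P\<close>.
  The projection is smooth, self-adjoint and parallel (\<open>parallel_endo_proj\<close>), so \<open>\<zeta> = P \<xi>\<close> satisfies
  \<open>\<nabla>\<^sub>X \<zeta> = P X\<close>. Let \<open>\<lambda>\<close> be the restriction of \<open>H(\<zeta>, \<xi>) = H(\<zeta>, \<zeta>)\<close> to the slice \<open>r = 1\<close>, a function on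
  \<open>M\<close>. The roles of \<open>P\<close> and \<open>Q\<close> are symmetric, and \<open>Q\<close> has the function \<open>1 - \<lambda>\<close>.

  Signature. For \<open>v\<close> tangent to \<open>M\<close> one has \<open>d\<lambda>(v) = 2 H(\<zeta>, v)\<close>. At a critical point \<open>\<zeta>\<close> is therefore a
  multiple of \<open>\<xi>\<close>, and \<open>P\<^sup>2 = P\<close> forces \<open>\<lambda> \<in> {0, 1}\<close> (\<open>critical_point\<close>). As \<open>M\<close> is compact, \<open>\<lambda>\<close> attains its
  extrema. It is not identically 0, for then \<open>\<zeta>\<close> would vanish on the slice, and with it its derivative
  \<open>P\<close>; nor is it identically 1. So its minimum is 0 and its maximum is 1. At the minimum the Hessian of \<open>\<lambda>\<close>
  is \<open>2 H(P \<cdot>, \<cdot>)\<close>, so \<open>H\<close> is positive on the image of \<open>P\<close> there, hence everywhere, since this is an open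
  and closed condition on the connected space \<open>M\<close>. The maximum gives the same for \<open>Q\<close>. Together, \<open>H\<close> and \<open>g\<close>
  are positive definite.

  Curvature. The curvature \<open>R\<close> of the cone annihilates \<open>\<xi>\<close> and \<open>\<zeta>\<close>, and contracting the second Bianchi
  identity with a field \<open>\<eta>\<close> such that \<open>\<nabla> \<eta> = A\<close> is parallel gives
  \<open>(\<nabla>\<^sub>\<eta> R)(u, v) = - R(A u, v) - R(u, A v)\<close> (\<open>nRiem_position_field\<close>). So the block
  \<open>T(u, v) = R(P u, P v)\<close> is parallel along \<open>Q \<xi>\<close> and satisfies \<open>\<nabla>\<^sub>\<xi> T = - 2 T\<close>. Along the vector
  \<open>Q \<xi> - (1 - \<lambda>) \<xi>\<close>, which is tangent to the slice, \<open>T\<close> has the logarithmic growth rate \<open>2 (1 - \<lambda>)\<close> and \<open>1 - \<lambda>\<close>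
  has the rate \<open>2 \<lambda>\<close>, so \<open>(1 - \<lambda>) T\<close> grows at the constant rate 2. At a maximum of
  \<open>(1 - \<lambda>) H(T(u, v) w, z)\<close> over all points of \<open>M\<close> and all unit vectors the derivative vanishes, and
  therefore so does the maximum (\<open>maximum_principle\<close>). Hence \<open>T = 0\<close> where \<open>\<lambda> \<noteq> 1\<close>, and these points are
  dense (\<open>T_zero_of_generic\<close>). The same holds for \<open>Q\<close>, and the mixed terms \<open>R(P u, Q v)\<close> vanish because \<open>R\<close>
  commutes with \<open>P\<close>. So the cone is flat, which by the formula for its curvature (\<open>cone_Riem\<close>) means that
  \<open>g\<close> has constant curvature 1.

  The maximum principle takes the place of the geodesics that lead to the vertex in Gallot's proof for
  complete Riemannian manifolds.
\<close>

section \<open>Calculus of smooth maps\<close>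

lemma Ck_on_cong:
  assumes "open S" "\<And>x. x \<in> S \<Longrightarrow> f x = g x" "Ck_on k S f"
  shows "Ck_on k S g"
  using assms(2,3)
proof (induction k arbitrary: f g)
  case 0
  then show ?case by (auto cong: continuous_on_cong)
next
  case (Suc k)
  have ev: "(f has_derivative F) (at x) \<longleftrightarrow> (g has_derivative F) (at x)" if "x \<in> S" for x F
    using Suc.prems(1) assms(1) that
    by (metis has_derivative_transform_within_open)
  have d: "frechet_derivative f (at x) = frechet_derivative g (at x)" if "x \<in> S" for x
    unfolding frechet_derivative_def using ev[OF that] by simp
  have "g differentiable (at x)" if "x \<in> S" for x
    using Suc.prems(2) that ev[OF that] unfolding Ck_on.simps differentiable_def by blast
  moreover have "Ck_on k S (\<lambda>x. frechet_derivative g (at x) v)" for v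
    by (rule Suc.IH[of "\<lambda>x. frechet_derivative f (at x) v"]) (use d Suc.prems(2) in auto)
  ultimately show ?case by auto
qed

lemma Ck_on_subset: "Ck_on k S f \<Longrightarrow> T \<subseteq> S \<Longrightarrow> Ck_on k T f"
  by (induction k arbitrary: f) (auto intro: continuous_on_subset)

lemma Ck_on_SucI:
  assumes S: "open S" and d: "\<And>x. x \<in> S \<Longrightarrow> (f has_derivative f' x) (at x)"
    and "\<And>v. Ck_on k S (\<lambda>x. f' x v)"
  shows "Ck_on (Suc k) S f"
proof -
  have e: "frechet_derivative f (at x) = f' x" if "x \<in> S" for x
    using frechet_derivative_at[OF d[OF that]] by simp
  have "Ck_on k S (\<lambda>x. frechet_derivative f (at x) v)" for v
    by (rule Ck_on_cong[OF S _ assms(3)[of v]]) (simp add: e)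
  then show ?thesis using d by (auto simp: differentiable_def)
qed

lemma Ck_on_SucD:
  assumes "Ck_on (Suc k) S f"
  shows "x \<in> S \<Longrightarrow> (f has_derivative frechet_derivative f (at x)) (at x)"
    and "Ck_on k S (\<lambda>x. frechet_derivative f (at x) v)"
  using assms frechet_derivative_works by auto

lemma Ck_on_Suc_imp: "Ck_on (Suc k) S f \<Longrightarrow> Ck_on k S f"
proof (induction k arbitrary: f)
  case 0
  then show ?case
    by (auto intro!: continuous_at_imp_continuous_on differentiable_imp_continuous_within)
qed auto

lemma Ck_on_const: "Ck_on k S (\<lambda>x. c)"
proof (induction k arbitrary: c)
  case (Suc k)
  have "frechet_derivative (\<lambda>x. c) (at x) = (\<lambda>_. 0)" for x :: 'a
    by (rule frechet_derivative_const)
  then show ?case using Suc by simp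
qed simp

lemma Ck_on_bounded_linear:
  assumes S: "open S" and L: "bounded_linear L"
  shows "Ck_on k S f \<Longrightarrow> Ck_on k S (\<lambda>x. L (f x))"
proof (induction k arbitrary: f)
  case 0
  then show ?case using bounded_linear.continuous_on[OF L] by auto
next
  case (Suc k)
  show ?case
    by (rule Ck_on_SucI[OF S bounded_linear.has_derivative[OF L Ck_on_SucD(1)[OF Suc.prems]]])
       (auto intro!: Suc.IH Ck_on_SucD(2)[OF Suc.prems])
qed

lemma Ck_on_add:
  assumes S: "open S"
  shows "Ck_on k S f \<Longrightarrow> Ck_on k S g \<Longrightarrow> Ck_on k S (\<lambda>x. f x + g x)"
proof (induction k arbitrary: f g)
  case 0
  then show ?case by (simp add: continuous_on_add)
next
  case (Suc k)
  show ?case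
    by (rule Ck_on_SucI[OF S has_derivative_add[OF Ck_on_SucD(1)[OF Suc.prems(1)] Ck_on_SucD(1)[OF Suc.prems(2)]]])
       (auto intro!: Suc.IH Ck_on_SucD(2)[OF Suc.prems(1)] Ck_on_SucD(2)[OF Suc.prems(2)])
qed

lemma Ck_on_sum:
  assumes S: "open S"
  shows "(\<And>i. i \<in> I \<Longrightarrow> Ck_on k S (f i)) \<Longrightarrow> Ck_on k S (\<lambda>x. \<Sum>i\<in>I. f i x)"
  by (induction I rule: infinite_finite_induct) (auto intro: Ck_on_const Ck_on_add[OF S])

lemma Ck_on_bilinear:
  assumes S: "open S" and B: "bounded_bilinear B"
  shows "Ck_on k S f \<Longrightarrow> Ck_on k S g \<Longrightarrow> Ck_on k S (\<lambda>x. B (f x) (g x))"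
proof (induction k arbitrary: f g)
  case 0
  then show ?case using bounded_bilinear.continuous_on[OF B] by auto
next
  case (Suc k)
  show ?case
    by (rule Ck_on_SucI[OF S bounded_bilinear.FDERIV[OF B Ck_on_SucD(1)[OF Suc.prems(1)] Ck_on_SucD(1)[OF Suc.prems(2)]]])
       (auto intro!: Ck_on_add[OF S] Suc.IH Ck_on_SucD(2)[OF Suc.prems(1)] Ck_on_SucD(2)[OF Suc.prems(2)]
          Ck_on_Suc_imp[OF Suc.prems(1)] Ck_on_Suc_imp[OF Suc.prems(2)])
qed

lemma Ck_on_compose_linear:
  assumes S: "open S" and L: "bounded_linear L"
  shows "Ck_on k S f \<Longrightarrow> Ck_on k (L -` S) (\<lambda>x. f (L x))"
proof (induction k arbitrary: f)
  case 0
  have "continuous_on (L -` S) L"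
    using L by (simp add: linear_continuous_on)
  then show ?case using 0 by (auto intro!: continuous_on_compose2[of S f])
next
  case (Suc k)
  have o: "open (L -` S)"
    using L S by (auto intro!: open_vimage linear_continuous_on)
  have "((\<lambda>x. f (L x)) has_derivative (\<lambda>v. frechet_derivative f (at (L x)) (L v))) (at x)" if "x \<in> L -` S" for x
    by (rule has_derivative_compose[OF bounded_linear_imp_has_derivative[OF L] Ck_on_SucD(1)[OF Suc.prems]]) (use that in auto)
  from Ck_on_SucI[OF o this] show ?case
    using Suc.IH[OF Ck_on_SucD(2)[OF Suc.prems]] by blast
qed

lemma Ck_on_local:
  assumes "\<And>x. x \<in> S \<Longrightarrow> \<exists>W. open W \<and> x \<in> W \<and> Ck_on k W f"
  shows "Ck_on k S f"
  using assms
proof (induction k arbitrary: f)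
  case 0
  show ?case
    unfolding Ck_on.simps
  proof (rule continuous_at_imp_continuous_on, rule ballI)
    fix x assume "x \<in> S"
    then obtain W where "open W" "x \<in> W" "continuous_on W f" using 0 by auto
    then show "isCont f x" using continuous_on_eq_continuous_at by blast
  qed
next
  case (Suc k)
  have "f differentiable (at x)" if "x \<in> S" for x
    using Suc.prems[OF that] by auto
  moreover have "Ck_on k S (\<lambda>x. frechet_derivative f (at x) v)" for v
  proof (rule Suc.IH)
    fix x assume "x \<in> S"
    from Suc.prems[OF this] obtain W where "open W" "x \<in> W" "Ck_on (Suc k) W f" by blast
    then show "\<exists>W. open W \<and> x \<in> W \<and> Ck_on k W (\<lambda>x. frechet_derivative f (at x) v)"
      using Ck_on_SucD(2) by blast
  qed
  ultimately show ?case by auto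
qed

lemma smooth_onD: "smooth_on S f \<Longrightarrow> x \<in> S \<Longrightarrow> (f has_derivative frechet_derivative f (at x)) (at x)"
  by (rule Ck_on_SucD(1)[of 0 S]) (simp_all add: smooth_on_def del: Ck_on.simps)

lemma smooth_on_derivative: "smooth_on S f \<Longrightarrow> smooth_on S (\<lambda>x. frechet_derivative f (at x) v)"
  unfolding smooth_on_def by (intro allI Ck_on_SucD(2)) blast

lemma smooth_on_continuous: "smooth_on S f \<Longrightarrow> continuous_on S f"
  unfolding smooth_on_def by (metis Ck_on.simps(1))

lemma smooth_on_differentiable: "smooth_on S f \<Longrightarrow> x \<in> S \<Longrightarrow> f differentiable (at x)"
  using smooth_onD unfolding differentiable_def by blast

lemma smooth_on_cong: "open S \<Longrightarrow> (\<And>x. x \<in> S \<Longrightarrow> f x = g x) \<Longrightarrow> smooth_on S f \<Longrightarrow> smooth_on S g"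
  unfolding smooth_on_def using Ck_on_cong[of S f g] by auto

lemma smooth_on_subset: "smooth_on S f \<Longrightarrow> T \<subseteq> S \<Longrightarrow> smooth_on T f"
  unfolding smooth_on_def by (intro allI, rule Ck_on_subset) auto

lemma smooth_on_const: "smooth_on S (\<lambda>x. c)"
  unfolding smooth_on_def by (intro allI, rule Ck_on_const)

lemma smooth_on_bounded_linear: "open S \<Longrightarrow> bounded_linear L \<Longrightarrow> smooth_on S f \<Longrightarrow> smooth_on S (\<lambda>x. L (f x))"
  unfolding smooth_on_def by (intro allI, rule Ck_on_bounded_linear) auto

lemma smooth_on_add: "open S \<Longrightarrow> smooth_on S f \<Longrightarrow> smooth_on S g \<Longrightarrow> smooth_on S (\<lambda>x. f x + g x)"
  unfolding smooth_on_def by (intro allI, rule Ck_on_add) auto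

lemma smooth_on_sum: "open S \<Longrightarrow> (\<And>i. i \<in> I \<Longrightarrow> smooth_on S (f i)) \<Longrightarrow> smooth_on S (\<lambda>x. \<Sum>i\<in>I. f i x)"
  unfolding smooth_on_def by (intro allI, rule Ck_on_sum) auto

lemma smooth_on_bilinear:
  "open S \<Longrightarrow> bounded_bilinear B \<Longrightarrow> smooth_on S f \<Longrightarrow> smooth_on S g \<Longrightarrow> smooth_on S (\<lambda>x. B (f x) (g x))"
  unfolding smooth_on_def by (intro allI, rule Ck_on_bilinear) auto

lemmas smooth_on_scaleR = smooth_on_bilinear[OF _ bounded_bilinear_scaleR]
lemmas smooth_on_mult = smooth_on_bilinear[OF _ bounded_bilinear_mult]

lemma smooth_on_minus: "open S \<Longrightarrow> smooth_on S f \<Longrightarrow> smooth_on S (\<lambda>x. - f x)"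
  by (rule smooth_on_bounded_linear[OF _ bounded_linear_minus[OF bounded_linear_ident]])

lemma smooth_on_diff: "open S \<Longrightarrow> smooth_on S f \<Longrightarrow> smooth_on S g \<Longrightarrow> smooth_on S (\<lambda>x. f x - g x)"
  using smooth_on_add[of S f "\<lambda>x. - g x"] smooth_on_minus[of S g] by simp

lemma smooth_on_Pair:
  fixes f :: "'a::euclidean_space \<Rightarrow> 'b::real_normed_vector" and g :: "'a \<Rightarrow> 'c::real_normed_vector"
  assumes "open S" "smooth_on S f" "smooth_on S g"
  shows "smooth_on S (\<lambda>x. (f x, g x))"
proof -
  have 1: "bounded_linear (\<lambda>a::'b. (a, 0::'c))" and 2: "bounded_linear (\<lambda>b::'c. (0::'b, b))"
    by (intro bounded_linear_Pair bounded_linear_ident bounded_linear_zero)+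
  have "smooth_on S (\<lambda>x. (f x, 0) + (0, g x))"
    by (intro smooth_on_add smooth_on_bounded_linear[OF _ 1] smooth_on_bounded_linear[OF _ 2] assms)
  then show ?thesis by simp
qed

lemma smooth_on_compose_snd:
  assumes "open S" "open T" "smooth_on S f"
  shows "smooth_on (T \<times> S) (\<lambda>x. f (snd x))"
  unfolding smooth_on_def
proof
  fix k
  have "Ck_on k (snd -` S) (\<lambda>x. f (snd x))"
    using assms(3) unfolding smooth_on_def by (blast intro: Ck_on_compose_linear[OF assms(1) bounded_linear_snd])
  then show "Ck_on k (T \<times> S) (\<lambda>x. f (snd x))"
    by (rule Ck_on_subset) auto
qed

lemma smooth_on_local:
  assumes "\<And>x. x \<in> S \<Longrightarrow> \<exists>W. open W \<and> x \<in> W \<and> smooth_on W f"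
  shows "smooth_on S f"
  unfolding smooth_on_def
proof
  fix k
  show "Ck_on k S f"
  proof (rule Ck_on_local)
    fix x assume "x \<in> S"
    from assms[OF this] obtain W where "open W" "x \<in> W" "smooth_on W f" by blast
    then show "\<exists>W. open W \<and> x \<in> W \<and> Ck_on k W f" unfolding smooth_on_def by blast
  qed
qed

lemma smooth_on_bounded_linear_id: "open S \<Longrightarrow> bounded_linear L \<Longrightarrow> smooth_on S L"
proof -
  assume S: "open S" and L: "bounded_linear L"
  have "smooth_on S (\<lambda>x. x)"
    unfolding smooth_on_def
  proof
    fix k show "Ck_on k S (\<lambda>x. x)"
    proof (cases k)
      case 0 then show ?thesis by simp
    next
      case (Suc n)
      show ?thesis unfolding Suc
        by (rule Ck_on_SucI[OF S has_derivative_ident]) (rule Ck_on_const)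
    qed
  qed
  from smooth_on_bounded_linear[OF S L this] show ?thesis by simp
qed

lemma linear_field_expand:
  fixes F :: "'a::euclidean_space \<Rightarrow> 'b::real_vector"
  assumes "linear F"
  shows "F v = (\<Sum>b\<in>Basis. (v \<bullet> b) *\<^sub>R F b)"
  using linear_sum[OF assms, of "\<lambda>b. (v \<bullet> b) *\<^sub>R b" Basis] linear_scale[OF assms]
  by (simp add: euclidean_representation)

text \<open>Tensor fields appear below as maps that are linear in a vector argument and smooth in the point as
  long as that argument is constant. Expanding in a basis makes it possible to let the argument vary with the
  point.\<close>

lemma Ck_on_linear_field:
  fixes F :: "'e::euclidean_space \<Rightarrow> 'a::euclidean_space \<Rightarrow> 'b::real_normed_vector"
  assumes S: "open S" and lin: "\<And>x. x \<in> S \<Longrightarrow> linear (F x)"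
    and F: "\<And>v. Ck_on k S (\<lambda>x. F x v)" and Y: "Ck_on k S Y"
  shows "Ck_on k S (\<lambda>x. F x (Y x))"
  by (rule Ck_on_cong[OF S, of "\<lambda>x. \<Sum>b\<in>Basis. (Y x \<bullet> b) *\<^sub>R F x b"])
     (auto intro!: linear_field_expand[symmetric] lin Ck_on_sum[OF S] F
        Ck_on_bilinear[OF S bounded_bilinear_scaleR] Ck_on_bounded_linear[OF S bounded_linear_inner_left Y])

lemma smooth_on_linear_field:
  fixes F :: "'e::euclidean_space \<Rightarrow> 'a::euclidean_space \<Rightarrow> 'b::real_normed_vector"
  assumes S: "open S" and lin: "\<And>x. x \<in> S \<Longrightarrow> linear (F x)"
    and F: "\<And>v. smooth_on S (\<lambda>x. F x v)" and Y: "smooth_on S Y"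
  shows "smooth_on S (\<lambda>x. F x (Y x))"
  unfolding smooth_on_def
proof
  fix k show "Ck_on k S (\<lambda>x. F x (Y x))"
    by (rule Ck_on_linear_field[OF S lin]) (use F Y in \<open>simp_all add: smooth_on_def\<close>)
qed

text \<open>The Leibniz rule for a tensor field applied to a vector field. It suffices that the tensor field is
  differentiable on constant arguments, because finitely many of them span.\<close>

lemma has_derivative_linear_field:
  fixes F :: "'e::euclidean_space \<Rightarrow> 'a::euclidean_space \<Rightarrow> 'b::real_normed_vector"
  assumes S: "open S" "x \<in> S" and lin: "\<And>y. y \<in> S \<Longrightarrow> linear (F y)"
    and F: "\<And>v. ((\<lambda>y. F y v) has_derivative (\<lambda>u. F' u v)) (at x)"
    and Y: "(Y has_derivative Y') (at x)"
  shows "((\<lambda>y. F y (Y y)) has_derivative (\<lambda>u. F' u (Y x) + F x (Y' u))) (at x)"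
proof -
  have 1: "((\<lambda>y. \<Sum>b\<in>Basis. (v \<bullet> b) *\<^sub>R F y b) has_derivative (\<lambda>u. \<Sum>b\<in>Basis. (v \<bullet> b) *\<^sub>R F' u b)) (at x)" for v
    by (rule derivative_eq_intros F refl)+ simp
  have "((\<lambda>y. F y v) has_derivative (\<lambda>u. \<Sum>b\<in>Basis. (v \<bullet> b) *\<^sub>R F' u b)) (at x)" for v
    by (rule has_derivative_transform_within_open[OF 1 S]) (rule linear_field_expand[symmetric], rule lin)
  from has_derivative_unique[OF F this] have F'e: "F' u v = (\<Sum>b\<in>Basis. (v \<bullet> b) *\<^sub>R F' u b)" for u v
    by metis
  have "((\<lambda>y. \<Sum>b\<in>Basis. (Y y \<bullet> b) *\<^sub>R F y b) has_derivative
         (\<lambda>u. \<Sum>b\<in>Basis. (Y x \<bullet> b) *\<^sub>R F' u b + (Y' u \<bullet> b) *\<^sub>R F x b)) (at x)"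
    by (rule derivative_eq_intros F Y refl)+ (simp add: algebra_simps)
  then have "((\<lambda>y. F y (Y y)) has_derivative
         (\<lambda>u. \<Sum>b\<in>Basis. (Y x \<bullet> b) *\<^sub>R F' u b + (Y' u \<bullet> b) *\<^sub>R F x b)) (at x)"
    by (rule has_derivative_transform_within_open[OF _ S]) (rule linear_field_expand[symmetric], rule lin)
  moreover have "(\<Sum>b\<in>Basis. (Y x \<bullet> b) *\<^sub>R F' u b + (Y' u \<bullet> b) *\<^sub>R F x b) = F' u (Y x) + F x (Y' u)" for u
    unfolding sum.distrib F'e[of u "Y x"] linear_field_expand[OF lin[OF S(2)], of "Y' u"] ..
  ultimately show ?thesis by simp
qed

lemma frechet_derivative_linear_field:
  fixes F :: "'e::euclidean_space \<Rightarrow> 'a::euclidean_space \<Rightarrow> 'b::real_normed_vector"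
  assumes S: "open S" "x \<in> S" and lin: "\<And>y. y \<in> S \<Longrightarrow> linear (F y)"
    and F: "\<And>v. ((\<lambda>y. F y v) has_derivative frechet_derivative (\<lambda>y. F y v) (at x)) (at x)"
  shows "linear (\<lambda>v. frechet_derivative (\<lambda>y. F y v) (at x) u)"
proof (rule linearI)
  fix v w and c :: real
  have "((\<lambda>y. F y (v + w)) has_derivative (\<lambda>u. frechet_derivative (\<lambda>y. F y v) (at x) u + frechet_derivative (\<lambda>y. F y w) (at x) u)) (at x)"
    by (rule has_derivative_transform_within_open[OF has_derivative_add[OF F F] S]) (simp add: linear_add[OF lin])
  from has_derivative_unique[OF F this]
  show "frechet_derivative (\<lambda>y. F y (v + w)) (at x) u = frechet_derivative (\<lambda>y. F y v) (at x) u + frechet_derivative (\<lambda>y. F y w) (at x) u"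
    by metis
  have "((\<lambda>y. F y (c *\<^sub>R v)) has_derivative (\<lambda>u. c *\<^sub>R frechet_derivative (\<lambda>y. F y v) (at x) u)) (at x)"
    by (rule has_derivative_transform_within_open[OF has_derivative_scaleR_right[OF F] S]) (simp add: linear_scale[OF lin])
  from has_derivative_unique[OF F this]
  show "frechet_derivative (\<lambda>y. F y (c *\<^sub>R v)) (at x) u = c *\<^sub>R frechet_derivative (\<lambda>y. F y v) (at x) u"
    by metis
qed

lemma continuous_on_linear_field:
  fixes F :: "'e::topological_space \<Rightarrow> 'a::euclidean_space \<Rightarrow> 'b::real_normed_vector"
  assumes lin: "\<And>y. y \<in> S \<Longrightarrow> linear (F y)"
    and F: "\<And>v. continuous_on S (\<lambda>y. F y v)"
  shows "continuous_on (S \<times> UNIV) (\<lambda>(y, v). F y v)"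
proof -
  have "continuous_on (S \<times> UNIV) (\<lambda>p. F (fst p) b)" for b
    by (rule continuous_on_compose2[OF F[of b]]) (auto intro: continuous_intros)
  then have "continuous_on (S \<times> UNIV) (\<lambda>p. \<Sum>b\<in>Basis. (snd p \<bullet> b) *\<^sub>R F (fst p) b)"
    by (intro continuous_intros)
  then show ?thesis
    by (rule continuous_on_eq) (auto simp: linear_field_expand[OF lin, symmetric])
qed

section \<open>Smooth dependence of the solution of a linear system\<close>

text \<open>Continuity of one factor is enough where the other one vanishes. This is what makes the solution of a
  linear system differentiable once it is known to be continuous.\<close>

lemma has_derivative_vanishing_factor:
  fixes a :: "'e::real_normed_vector \<Rightarrow> real" and F :: "'e \<Rightarrow> 'b::real_normed_vector"
  assumes a: "isCont a x" and F: "(F has_derivative F') (at x)" and "F x = 0"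
  shows "((\<lambda>y. a y *\<^sub>R F y) has_derivative (\<lambda>u. a x *\<^sub>R F' u)) (at x)"
proof -
  interpret F': bounded_linear F' using F by (rule has_derivative_bounded_linear)
  have aL: "((\<lambda>y. a y - a x) \<longlongrightarrow> 0) (at x)"
    using a by (simp add: isCont_def LIM_zero)
  have "((\<lambda>y. (a y - a x) *\<^sub>R F y) has_derivative (\<lambda>u. 0)) (at x)"
  proof -
    have lim: "((\<lambda>y. norm (F y - F x - F' (y - x)) / norm (y - x)) \<longlongrightarrow> 0) (at x)"
      using F unfolding has_derivative_iff_norm by simp
    obtain K where K: "norm (F' v) \<le> norm v * K" for v
      using F'.bounded by blast
    have q: "norm (F y) / norm (y - x) \<le> norm (F y - F x - F' (y - x)) / norm (y - x) + K" if "y \<noteq> x" for y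
    proof -
      have "norm (F y) \<le> norm (F y - F' (y - x)) + norm (F' (y - x))"
        using norm_triangle_sub by (simp add: add.commute)
      also have "\<dots> \<le> norm (F y - F' (y - x)) + norm (y - x) * K" using K by simp
      finally show ?thesis using that assms(3) by (simp add: field_simps)
    qed
    have l1: "((\<lambda>y. \<bar>a y - a x\<bar> * (norm (F y - F x - F' (y - x)) / norm (y - x) + K)) \<longlongrightarrow> 0 * (0 + K)) (at x)"
      by (intro tendsto_intros lim tendsto_rabs_zero aL)
    have "((\<lambda>y. norm ((a y - a x) *\<^sub>R F y) / norm (y - x)) \<longlongrightarrow> 0) (at x)"
    proof (rule tendsto_sandwich[OF _ _ tendsto_const])
      show "\<forall>\<^sub>F y in at x. 0 \<le> norm ((a y - a x) *\<^sub>R F y) / norm (y - x)" by simp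
      show "\<forall>\<^sub>F y in at x. norm ((a y - a x) *\<^sub>R F y) / norm (y - x) \<le> \<bar>a y - a x\<bar> * (norm (F y - F x - F' (y - x)) / norm (y - x) + K)"
        unfolding eventually_at_filter
        using q by (intro always_eventually) (auto simp: mult_left_mono simp flip: times_divide_eq_right)
    qed (use l1 in simp)
    then show ?thesis unfolding has_derivative_iff_norm using assms(3) by simp
  qed
  from has_derivative_add[OF this has_derivative_scaleR_right[OF F, of "a x"]]
  show ?thesis by (simp add: algebra_simps)
qed

text \<open>As \<open>L x\<close> is bounded below, so is \<open>L y\<close> for \<open>y\<close> near \<open>x\<close>; hence \<open>z y - z x\<close> is controlled by
  \<open>L y (z y - z x) = r y - r x - (L y - L x) (z x)\<close>, which tends to 0.\<close>

lemma solution_of_linear_system_isCont: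
  fixes L :: "'e::euclidean_space \<Rightarrow> 'a::euclidean_space \<Rightarrow> 'a"
  assumes S: "open S" "x \<in> S" and lin: "\<And>y. y \<in> S \<Longrightarrow> linear (L y)"
    and inj: "inj (L x)"
    and L: "\<And>v. isCont (\<lambda>y. L y v) x"
    and r: "isCont r x"
    and z: "\<And>y. y \<in> S \<Longrightarrow> L y (z y) = r y"
  shows "isCont z x"
proof -
  note lx = lin[OF S(2)]
  obtain M where M: "linear M" "M \<circ> L x = id"
    using linear_injective_left_inverse[OF lx inj] by blast
  then have Minv: "M (L x v) = v" for v by (metis comp_apply id_apply)
  have blM: "bounded_linear M" using M(1) linear_conv_bounded_linear by blast
  obtain K where K: "K > 0" "\<And>v. norm (M v) \<le> norm v * K"
    using bounded_linear.pos_bounded[OF blM] by blast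
  have Lc: "((\<lambda>y. L y v) \<longlongrightarrow> L x v) (at x)" for v
    using L by (simp add: isCont_def)
  have rc: "(r \<longlongrightarrow> r x) (at x)"
    using r by (simp add: isCont_def)
  have inS: "\<forall>\<^sub>F y in at x. y \<in> S"
    using S by (rule eventually_at_in_open')
  have diff: "L y v - L x v = (\<Sum>b\<in>Basis. (v \<bullet> b) *\<^sub>R (L y b - L x b))" if "y \<in> S" for y v
    unfolding linear_field_expand[OF lin[OF that], of v] linear_field_expand[OF lx, of v]
    by (simp add: sum_subtractf algebra_simps)
  define e where "e y = (\<Sum>b\<in>Basis. norm (L y b - L x b))" for y
  have e0: "(e \<longlongrightarrow> 0) (at x)"
  proof -
    have "(e \<longlongrightarrow> (\<Sum>b\<in>Basis. norm (L x b - L x b))) (at x)"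
      unfolding e_def[abs_def] by (intro tendsto_intros Lc)
    then show ?thesis by simp
  qed
  have de: "norm (L y v - L x v) \<le> norm v * e y" if "y \<in> S" for y v
  proof -
    have "norm (L y v - L x v) \<le> (\<Sum>b\<in>Basis. norm ((v \<bullet> b) *\<^sub>R (L y b - L x b)))"
      by (subst diff[OF that]) (rule norm_sum)
    also have "\<dots> \<le> (\<Sum>b\<in>Basis. norm v * norm (L y b - L x b))"
      by (intro sum_mono) (simp add: mult_right_mono Basis_le_norm)
    finally show ?thesis by (simp add: e_def sum_distrib_left)
  qed
  \<comment> \<open>from here on \<open>M\<close> maps \<open>L y d - L x d\<close> to a vector of norm at most half of that of \<open>d\<close>\<close>
  have "\<forall>\<^sub>F y in at x. e y < 1 / (2 * K)"
    using order_tendstoD(2)[OF e0] K(1) by simp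
  then have ev: "\<forall>\<^sub>F y in at x. norm (z y - z x) \<le> 2 * K * norm (r y - r x - (L y (z x) - L x (z x)))"
    using inS
  proof eventually_elim
    case (elim y)
    define d where "d = z y - z x"
    have Ld: "L y d = r y - r x - (L y (z x) - L x (z x))"
      unfolding d_def using linear_diff[OF lin[OF elim(2)]] z[OF elim(2)] z[OF S(2)] by simp
    have "norm d = norm (M (L x d))" by (simp add: Minv)
    also have "\<dots> \<le> norm (L x d) * K" by (rule K(2))
    also have "\<dots> \<le> (norm (L y d) + norm d * e y) * K"
      using de[OF elim(2), of d] norm_triangle_sub[of "L x d" "L y d"] K(1)
      by (intro mult_right_mono) (auto simp: norm_minus_commute)
    also have "\<dots> \<le> K * norm (L y d) + norm d * (e y * K)" by (simp add: algebra_simps)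
    also have "\<dots> \<le> K * norm (L y d) + norm d * (1/2)"
      using elim(1) K(1) by (intro add_left_mono mult_left_mono) (auto simp: field_simps)
    finally have "norm d \<le> 2 * K * norm (L y d)" by simp
    then show ?case unfolding Ld unfolding d_def .
  qed
  have "((\<lambda>y. 2 * K * norm (r y - r x - (L y (z x) - L x (z x)))) \<longlongrightarrow> 2 * K * norm (r x - r x - (L x (z x) - L x (z x)))) (at x)"
    by (intro tendsto_intros rc Lc)
  then have "((\<lambda>y. z y - z x) \<longlongrightarrow> 0) (at x)"
    using Lim_null_comparison[OF ev] by simp
  then show ?thesis unfolding isCont_def by (rule LIM_zero_cancel)
qed

text \<open>With \<open>N\<close> the inverse of \<open>L x\<close> one has \<open>z y = N (r y - (L y - L x) (z y))\<close>. The coordinates of \<open>z\<close> are continuous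
  and \<open>L y - L x\<close> vanishes at \<open>x\<close>, so the right-hand side is differentiable.\<close>

lemma solution_of_linear_system_differentiable:
  fixes L :: "'e::euclidean_space \<Rightarrow> 'a::euclidean_space \<Rightarrow> 'a"
  assumes S: "open S" "x \<in> S" and lin: "\<And>y. y \<in> S \<Longrightarrow> linear (L y)"
    and inj: "inj (L x)"
    and L: "\<And>v. ((\<lambda>y. L y v) has_derivative (\<lambda>u. L' u v)) (at x)"
    and r: "(r has_derivative r') (at x)"
    and z: "\<And>y. y \<in> S \<Longrightarrow> L y (z y) = r y"
  shows "\<exists>z'. (z has_derivative z') (at x) \<and> (\<forall>u. L x (z' u) = r' u - L' u (z x))"
proof -
  note lx = lin[OF S(2)]
  obtain M where M: "linear M" "M \<circ> L x = id"
    using linear_injective_left_inverse[OF lx inj] by blast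
  then have Minv: "M (L x v) = v" for v by (metis comp_apply id_apply)
  have blM: "bounded_linear M" using M(1) linear_conv_bounded_linear by blast
  have diff: "L y v - L x v = (\<Sum>b\<in>Basis. (v \<bullet> b) *\<^sub>R (L y b - L x b))" if "y \<in> S" for y v
    unfolding linear_field_expand[OF lin[OF that], of v] linear_field_expand[OF lx, of v]
    by (simp add: sum_subtractf algebra_simps)
  have zc: "isCont z x"
    by (rule solution_of_linear_system_isCont[where L = L and r = r and z = z, OF S lin inj _ _ z])
       (auto intro: has_derivative_continuous[OF L] has_derivative_continuous[OF r])
  define z' where "z' u = M (r' u - (\<Sum>b\<in>Basis. (z x \<bullet> b) *\<^sub>R L' u b))" for u
  have L'e: "L' u v = (\<Sum>b\<in>Basis. (v \<bullet> b) *\<^sub>R L' u b)" for u v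
  proof -
    have 1: "((\<lambda>y. \<Sum>b\<in>Basis. (v \<bullet> b) *\<^sub>R L y b) has_derivative (\<lambda>u. \<Sum>b\<in>Basis. (v \<bullet> b) *\<^sub>R L' u b)) (at x)"
      by (rule derivative_eq_intros L refl)+ simp
    have "((\<lambda>y. L y v) has_derivative (\<lambda>u. \<Sum>b\<in>Basis. (v \<bullet> b) *\<^sub>R L' u b)) (at x)"
      by (rule has_derivative_transform_within_open[OF 1 S]) (rule linear_field_expand[symmetric], rule lin)
    from has_derivative_unique[OF L this] show ?thesis by metis
  qed
  have 1: "((\<lambda>y. (z y \<bullet> b) *\<^sub>R (L y b - L x b)) has_derivative (\<lambda>u. (z x \<bullet> b) *\<^sub>R L' u b)) (at x)" for b
  proof (rule has_derivative_vanishing_factor)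
    show "isCont (\<lambda>y. z y \<bullet> b) x" using zc by (intro continuous_intros)
    show "((\<lambda>y. L y b - L x b) has_derivative (\<lambda>u. L' u b)) (at x)"
      using has_derivative_diff[OF L[of b] has_derivative_const[of "L x b"]] by simp
  qed simp
  have "((\<lambda>y. r y - (\<Sum>b\<in>Basis. (z y \<bullet> b) *\<^sub>R (L y b - L x b))) has_derivative
     (\<lambda>u. r' u - (\<Sum>b\<in>Basis. (z x \<bullet> b) *\<^sub>R L' u b))) (at x)"
    by (intro has_derivative_diff r has_derivative_sum 1)
  from bounded_linear.has_derivative[OF blM this]
  have "((\<lambda>y. M (r y - (\<Sum>b\<in>Basis. (z y \<bullet> b) *\<^sub>R (L y b - L x b)))) has_derivative z') (at x)"
    unfolding z'_def .
  then have "(z has_derivative z') (at x)"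
  proof (rule has_derivative_transform_within_open[OF _ S])
    fix y assume y: "y \<in> S"
    show "M (r y - (\<Sum>b\<in>Basis. (z y \<bullet> b) *\<^sub>R (L y b - L x b))) = z y"
      unfolding diff[OF y, symmetric] z[OF y, symmetric] by (simp add: Minv)
  qed
  moreover have "L x (z' u) = r' u - L' u (z x)" for u
  proof -
    have "L x \<circ> M = id" using linear_inverse_left[OF M(1) lx] M(2) by blast
    then have "L x (M v) = v" for v by (metis comp_apply id_apply)
    then show ?thesis unfolding z'_def L'e[of u "z x"] .
  qed
  ultimately show ?thesis by blast
qed

text \<open>By the formula for its derivative, the derivative of the solution solves a system with the same \<open>L\<close>,
  whose right-hand side involves \<open>z\<close> itself; so one order of regularity is gained at a time. This avoids
  determinants and Cramer's rule.\<close>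

lemma solution_of_linear_system_Ck:
  fixes L :: "'e::euclidean_space \<Rightarrow> 'a::euclidean_space \<Rightarrow> 'a"
  assumes S: "open S" and lin: "\<And>y. y \<in> S \<Longrightarrow> linear (L y)"
    and inj: "\<And>y. y \<in> S \<Longrightarrow> inj (L y)"
    and L: "\<And>v. smooth_on S (\<lambda>y. L y v)"
    and z: "\<And>y. y \<in> S \<Longrightarrow> L y (z y) = r y"
    and r: "Ck_on k S r"
  shows "Ck_on k S z"
  using z r
proof (induction k arbitrary: r z)
  case 0
  have "isCont z x" if "x \<in> S" for x
    by (rule solution_of_linear_system_isCont[where L = L and r = r and z = z, OF S that lin inj[OF that] _ _ 0(1)])
       (use 0(2) smooth_on_continuous[OF L] that in \<open>simp_all add: continuous_on_eq_continuous_at[OF S]\<close>)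
  then show ?case
    by (auto intro: continuous_at_imp_continuous_on)
next
  case (Suc k)
  have "\<forall>x\<in>S. \<exists>z'. (z has_derivative z') (at x) \<and> (\<forall>u. L x (z' u) = frechet_derivative r (at x) u - frechet_derivative (\<lambda>y. L y (z x)) (at x) u)"
  proof
    fix x assume x: "x \<in> S"
    show "\<exists>z'. (z has_derivative z') (at x) \<and> (\<forall>u. L x (z' u) = frechet_derivative r (at x) u - frechet_derivative (\<lambda>y. L y (z x)) (at x) u)"
      by (rule solution_of_linear_system_differentiable[where L = L and r = r and z = z,
            OF S x lin inj[OF x] smooth_onD[OF L x] Ck_on_SucD(1)[OF Suc.prems(2) x] Suc.prems(1)])
  qed
  then obtain z' where z': "\<And>x. x \<in> S \<Longrightarrow> (z has_derivative z' x) (at x)"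
     "\<And>x u. x \<in> S \<Longrightarrow> L x (z' x u) = frechet_derivative r (at x) u - frechet_derivative (\<lambda>y. L y (z x)) (at x) u"
    by metis
  have zk: "Ck_on k S z"
    by (rule Suc.IH[OF Suc.prems(1) Ck_on_Suc_imp[OF Suc.prems(2)]])
  have lin': "linear (\<lambda>v. frechet_derivative (\<lambda>y. L y v) (at x) u)" if x: "x \<in> S" for x u
    by (rule frechet_derivative_linear_field[OF S x lin smooth_onD[OF L x]])
  show ?case
  proof (rule Ck_on_SucI[OF S z'(1)])
    fix v
    have dL: "Ck_on k S (\<lambda>x. frechet_derivative (\<lambda>y. L y (z x)) (at x) v)"
      by (rule Ck_on_linear_field[OF S lin' _ zk]) (use smooth_on_derivative[OF L] in \<open>simp_all add: smooth_on_def\<close>)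
    have "Ck_on k S (\<lambda>x. frechet_derivative r (at x) v - frechet_derivative (\<lambda>y. L y (z x)) (at x) v)"
      using Ck_on_add[OF S Ck_on_SucD(2)[OF Suc.prems(2)] Ck_on_bounded_linear[OF S bounded_linear_minus[OF bounded_linear_ident]
         dL]] by simp
    from Suc.IH[OF z'(2) this] show "Ck_on k S (\<lambda>x. z' x v)" .
  qed
qed

lemma solution_of_linear_system_smooth:
  fixes L :: "'e::euclidean_space \<Rightarrow> 'a::euclidean_space \<Rightarrow> 'a"
  assumes "open S" "\<And>y. y \<in> S \<Longrightarrow> linear (L y)"
    "\<And>y. y \<in> S \<Longrightarrow> inj (L y)" "\<And>v. smooth_on S (\<lambda>y. L y v)"
    "\<And>y. y \<in> S \<Longrightarrow> L y (z y) = r y" "smooth_on S r"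
  shows "smooth_on S z"
  unfolding smooth_on_def
proof
  fix k
  show "Ck_on k S z"
    by (rule solution_of_linear_system_Ck[where L = L and r = r and z = z, OF assms(1-5)])
       (use assms(6) in \<open>simp_all add: smooth_on_def\<close>)
qed

section \<open>Symmetry of second derivatives\<close>

text \<open>The mean value theorem, first in the direction \<open>u\<close> and then in the direction \<open>v\<close>. The left-hand side
  is symmetric in \<open>u\<close> and \<open>v\<close>, which the right-hand side does not show.\<close>

lemma second_difference_mean_value:
  fixes f :: "'e::euclidean_space \<Rightarrow> real"
  assumes S: "ball x d \<subseteq> S" and f: "smooth_on S f" and t: "t > 0" "t * (norm u + norm v) < d"
  obtains p where "norm (p - x) \<le> t * (norm u + norm v)"
    "f (x + t *\<^sub>R u + t *\<^sub>R v) - f (x + t *\<^sub>R u) - f (x + t *\<^sub>R v) + f x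
       = t\<^sup>2 * frechet_derivative (\<lambda>y. frechet_derivative f (at y) u) (at p) v"
proof -
  define Df where "Df y = frechet_derivative f (at y)" for y
  have inS: "x + a *\<^sub>R u + b *\<^sub>R v \<in> S" and nrm: "norm (a *\<^sub>R u + b *\<^sub>R v) \<le> t * (norm u + norm v)"
    if "0 \<le> a" "a \<le> t" "0 \<le> b" "b \<le> t" for a b
  proof -
    have "norm (a *\<^sub>R u + b *\<^sub>R v) \<le> a * norm u + b * norm v"
      using norm_triangle_ineq[of "a *\<^sub>R u" "b *\<^sub>R v"] that by simp
    also have "\<dots> \<le> t * norm u + t * norm v"
      using that by (intro add_mono mult_right_mono) auto
    finally show n: "norm (a *\<^sub>R u + b *\<^sub>R v) \<le> t * (norm u + norm v)" by (simp add: algebra_simps)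
    have "dist x (x + a *\<^sub>R u + b *\<^sub>R v) = norm (a *\<^sub>R u + b *\<^sub>R v)"
      by (simp add: dist_norm norm_minus_commute flip: norm_minus_cancel[of "a *\<^sub>R u + b *\<^sub>R v"])
    then show "x + a *\<^sub>R u + b *\<^sub>R v \<in> S" using n t(2) S by auto
  qed
  have d1: "((\<lambda>s. f (x + s *\<^sub>R u + b *\<^sub>R v)) has_real_derivative Df (x + a *\<^sub>R u + b *\<^sub>R v) u) (at a)"
    if "0 \<le> a" "a \<le> t" "0 \<le> b" "b \<le> t" for a b
  proof -
    have l: "((\<lambda>s. x + s *\<^sub>R u + b *\<^sub>R v) has_derivative (\<lambda>s. s *\<^sub>R u)) (at a)"
      by (auto intro!: derivative_eq_intros)
    note D = smooth_onD[OF f inS[OF that]]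
    have "((\<lambda>s. f (x + s *\<^sub>R u + b *\<^sub>R v)) has_derivative (\<lambda>s. Df (x + a *\<^sub>R u + b *\<^sub>R v) (s *\<^sub>R u))) (at a)"
      unfolding Df_def by (rule has_derivative_compose[OF l D])
    moreover have "Df (x + a *\<^sub>R u + b *\<^sub>R v) (s *\<^sub>R u) = s * Df (x + a *\<^sub>R u + b *\<^sub>R v) u" for s
      unfolding Df_def using linear_scale[OF has_derivative_linear[OF D]] by simp
    ultimately show ?thesis by (simp add: has_field_derivative_def mult.commute[of _ "Df _ u"])
  qed
  define \<phi> where "\<phi> s = f (x + s *\<^sub>R u + t *\<^sub>R v) - f (x + s *\<^sub>R u)" for s
  have "(\<phi> has_real_derivative Df (x + s *\<^sub>R u + t *\<^sub>R v) u - Df (x + s *\<^sub>R u) u) (at s)" if "0 \<le> s" "s \<le> t" for s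
    unfolding \<phi>_def using DERIV_diff[OF d1[of s t] d1[of s 0]] that t by simp
  from MVT2[OF t(1), of \<phi>, OF this] obtain s0 where s0: "0 < s0" "s0 < t"
    "\<phi> t - \<phi> 0 = (t - 0) * (Df (x + s0 *\<^sub>R u + t *\<^sub>R v) u - Df (x + s0 *\<^sub>R u) u)" by blast
  define A where "A y = frechet_derivative (\<lambda>y. Df y u) (at y) v" for y
  have d2: "((\<lambda>s. Df (x + s0 *\<^sub>R u + s *\<^sub>R v) u) has_real_derivative A (x + s0 *\<^sub>R u + b *\<^sub>R v)) (at b)"
    if "0 \<le> b" "b \<le> t" for b
  proof -
    have l: "((\<lambda>s. x + s0 *\<^sub>R u + s *\<^sub>R v) has_derivative (\<lambda>s. s *\<^sub>R v)) (at b)"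
      by (auto intro!: derivative_eq_intros)
    have i: "x + s0 *\<^sub>R u + b *\<^sub>R v \<in> S" using inS s0 that by simp
    note D = smooth_onD[OF smooth_on_derivative[OF f, of u] i]
    have "((\<lambda>s. Df (x + s0 *\<^sub>R u + s *\<^sub>R v) u) has_derivative
        (\<lambda>s. frechet_derivative (\<lambda>y. Df y u) (at (x + s0 *\<^sub>R u + b *\<^sub>R v)) (s *\<^sub>R v))) (at b)"
      unfolding Df_def by (rule has_derivative_compose[OF l D])
    moreover have "frechet_derivative (\<lambda>y. Df y u) (at (x + s0 *\<^sub>R u + b *\<^sub>R v)) (s *\<^sub>R v) = s * A (x + s0 *\<^sub>R u + b *\<^sub>R v)" for s
      unfolding Df_def A_def using linear_scale[OF has_derivative_linear[OF D]] by simp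
    ultimately show ?thesis by (simp add: has_field_derivative_def mult.commute[of _ "A _"])
  qed
  from MVT2[OF t(1), of "\<lambda>s. Df (x + s0 *\<^sub>R u + s *\<^sub>R v) u", OF d2] obtain t0 where t0: "0 < t0" "t0 < t"
    "Df (x + s0 *\<^sub>R u + t *\<^sub>R v) u - Df (x + s0 *\<^sub>R u + 0 *\<^sub>R v) u = (t - 0) * A (x + s0 *\<^sub>R u + t0 *\<^sub>R v)" by blast
  show thesis
  proof (rule that)
    show "norm (x + s0 *\<^sub>R u + t0 *\<^sub>R v - x) \<le> t * (norm u + norm v)"
      using nrm[of s0 t0] s0 t0 by (simp add: algebra_simps)
    show "f (x + t *\<^sub>R u + t *\<^sub>R v) - f (x + t *\<^sub>R u) - f (x + t *\<^sub>R v) + f x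
       = t\<^sup>2 * frechet_derivative (\<lambda>y. frechet_derivative f (at y) u) (at (x + s0 *\<^sub>R u + t0 *\<^sub>R v)) v"
      using s0(3) t0(3) unfolding \<phi>_def A_def Df_def by (simp add: power2_eq_square)
  qed
qed

lemma second_derivative_symmetric_real:
  fixes f :: "'e::euclidean_space \<Rightarrow> real"
  assumes S: "open S" "x \<in> S" and f: "smooth_on S f"
  shows "frechet_derivative (\<lambda>y. frechet_derivative f (at y) v) (at x) u
       = frechet_derivative (\<lambda>y. frechet_derivative f (at y) u) (at x) v"
proof -
  define A where "A u v y = frechet_derivative (\<lambda>y. frechet_derivative f (at y) u) (at y) v" for u v y
  have Ac: "isCont (A u v) x" for u v
    using smooth_on_continuous[OF smooth_on_derivative[OF smooth_on_derivative[OF f]]] S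
    unfolding A_def by (simp add: continuous_on_eq_continuous_at)
  obtain d where d: "d > 0" "ball x d \<subseteq> S" using S openE by blast
  have "\<bar>A u v x - A v u x\<bar> \<le> e" if e: "e > 0" for e
  proof -
    obtain d1 where d1: "d1 > 0" "\<And>y. dist y x < d1 \<Longrightarrow> dist (A u v y) (A u v x) < e / 2"
      using Ac[of u v] e unfolding continuous_at_eps_delta by (metis half_gt_zero)
    obtain d2 where d2: "d2 > 0" "\<And>y. dist y x < d2 \<Longrightarrow> dist (A v u y) (A v u x) < e / 2"
      using Ac[of v u] e unfolding continuous_at_eps_delta by (metis half_gt_zero)
    \<comment> \<open>a step so small that both intermediate points lie in all three balls\<close>
    define m where "m = min d (min d1 d2)"
    define t where "t = m / (norm u + norm v + 1)"
    have m: "m > 0" "m \<le> d" "m \<le> d1" "m \<le> d2" unfolding m_def using d d1 d2 by auto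
    have t0: "t > 0" unfolding t_def using m by (simp add: add_nonneg_pos)
    have "t * (norm u + norm v + 1) = m" unfolding t_def
      using add_nonneg_pos[of "norm u + norm v" 1] by simp
    then have tm: "t * (norm u + norm v) < m" using t0 by (simp add: algebra_simps)
    obtain p where p: "norm (p - x) \<le> t * (norm u + norm v)"
      "f (x + t *\<^sub>R u + t *\<^sub>R v) - f (x + t *\<^sub>R u) - f (x + t *\<^sub>R v) + f x = t\<^sup>2 * A u v p"
      using second_difference_mean_value[OF d(2) f t0, of u v] tm m unfolding A_def by auto
    obtain q where q: "norm (q - x) \<le> t * (norm u + norm v)"
      "f (x + t *\<^sub>R v + t *\<^sub>R u) - f (x + t *\<^sub>R v) - f (x + t *\<^sub>R u) + f x = t\<^sup>2 * A v u q"
      using second_difference_mean_value[OF d(2) f t0, of v u] tm m unfolding A_def by (auto simp: add.commute)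
    have "t\<^sup>2 * A u v p = t\<^sup>2 * A v u q"
      unfolding p(2)[symmetric] q(2)[symmetric] by (simp add: algebra_simps)
    then have "A u v p = A v u q" using t0 by simp
    moreover have "dist (A u v p) (A u v x) < e / 2" using d1(2) p(1) tm m by (simp add: dist_norm)
    moreover have "dist (A v u q) (A v u x) < e / 2" using d2(2) q(1) tm m by (simp add: dist_norm)
    ultimately show ?thesis unfolding dist_real_def by linarith
  qed
  then have "\<bar>A u v x - A v u x\<bar> \<le> 0" by (rule field_le_epsilon[of _ 0, simplified])
  then show ?thesis unfolding A_def by simp
qed

lemma second_derivative_symmetric:
  fixes f :: "'e::euclidean_space \<Rightarrow> 'b::euclidean_space"
  assumes S: "open S" "x \<in> S" and f: "smooth_on S f"
  shows "frechet_derivative (\<lambda>y. frechet_derivative f (at y) v) (at x) u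
       = frechet_derivative (\<lambda>y. frechet_derivative f (at y) u) (at x) v"
proof -
  have comp: "frechet_derivative (\<lambda>y. k y \<bullet> c) (at y) u = frechet_derivative k (at y) u \<bullet> c"
    if "smooth_on S k" "y \<in> S" for k :: "'e \<Rightarrow> 'b" and c u y
    using frechet_derivative_at[OF bounded_linear.has_derivative[OF bounded_linear_inner_left smooth_onD[OF that]], of c]
    by (metis)
  have 2: "frechet_derivative (\<lambda>y. frechet_derivative (\<lambda>y. f y \<bullet> c) (at y) v) (at x) u
     = frechet_derivative (\<lambda>y. frechet_derivative f (at y) v) (at x) u \<bullet> c" for c u v
  proof -
    have "((\<lambda>y. frechet_derivative f (at y) v \<bullet> c) has_derivative
      (\<lambda>u. frechet_derivative (\<lambda>y. frechet_derivative f (at y) v) (at x) u \<bullet> c)) (at x)"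
      by (rule bounded_linear.has_derivative[OF bounded_linear_inner_left smooth_onD[OF smooth_on_derivative[OF f] S(2)]])
    then have "((\<lambda>y. frechet_derivative (\<lambda>y. f y \<bullet> c) (at y) v) has_derivative
      (\<lambda>u. frechet_derivative (\<lambda>y. frechet_derivative f (at y) v) (at x) u \<bullet> c)) (at x)"
      by (rule has_derivative_transform_within_open[OF _ S]) (simp add: comp[OF f])
    from frechet_derivative_at[OF this] show ?thesis by metis
  qed
  show ?thesis
  proof (rule euclidean_eqI)
    fix b :: 'b
    show "frechet_derivative (\<lambda>y. frechet_derivative f (at y) v) (at x) u \<bullet> b = frechet_derivative (\<lambda>y. frechet_derivative f (at y) u) (at x) v \<bullet> b"
      unfolding 2[symmetric]
      by (rule second_derivative_symmetric_real[OF S smooth_on_bounded_linear[OF S(1) bounded_linear_inner_left f]])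
  qed
qed

section \<open>The Levi-Civita connection and its curvature in a chart\<close>

locale metric_chart =
  fixes S :: "'a::euclidean_space set" and h :: "'a \<Rightarrow> 'a \<Rightarrow> 'a \<Rightarrow> real"
  assumes S: "open S"
    and smooth_h: "smooth_on S (\<lambda>x. h x v w)"
    and bil: "x \<in> S \<Longrightarrow> bilinear (h x)"
    and sym: "x \<in> S \<Longrightarrow> h x v w = h x w v"
    and nondeg: "x \<in> S \<Longrightarrow> (\<And>w. h x v w = 0) \<Longrightarrow> v = 0"
begin

abbreviation \<Gamma> where "\<Gamma> \<equiv> christoffel h"

definition dh where "dh x u v w = frechet_derivative (\<lambda>y. h y v w) (at x) u"
definition d\<Gamma> where "d\<Gamma> x e u v = frechet_derivative (\<lambda>y. \<Gamma> y u v) (at x) e"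
definition dd\<Gamma> where "dd\<Gamma> x e u v w = frechet_derivative (\<lambda>y. d\<Gamma> y u v w) (at x) e"
definition Riem where
  "Riem x u v w = d\<Gamma> x u v w - d\<Gamma> x v u w + \<Gamma> x u (\<Gamma> x v w) - \<Gamma> x v (\<Gamma> x u w)"
definition dRiem where "dRiem x e u v w = frechet_derivative (\<lambda>y. Riem y u v w) (at x) e"

text \<open>The covariant derivative of the curvature tensor in the direction \<open>e\<close>; the arguments are extended by
  constant components.\<close>

definition nRiem where
  "nRiem x e u v w = dRiem x e u v w + \<Gamma> x e (Riem x u v w)
     - Riem x (\<Gamma> x e u) v w - Riem x u (\<Gamma> x e v) w - Riem x u v (\<Gamma> x e w)"

lemma h_linear: "x \<in> S \<Longrightarrow> linear (h x v)" "x \<in> S \<Longrightarrow> linear (\<lambda>v. h x v w)"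
  by (drule bil, simp add: bilinear_def)+

lemmas h_simps = linear_add[OF h_linear(1)] linear_add[OF h_linear(2)]
  linear_diff[OF h_linear(1)] linear_diff[OF h_linear(2)]
  linear_neg[OF h_linear(1)] linear_neg[OF h_linear(2)]
  linear_0[OF h_linear(1)] linear_0[OF h_linear(2)]
  linear_scale[OF h_linear(1)] linear_scale[OF h_linear(2)]

lemma h_has_derivative: "x \<in> S \<Longrightarrow> ((\<lambda>y. h y v w) has_derivative (\<lambda>u. dh x u v w)) (at x)"
  using smooth_onD[OF smooth_h] unfolding dh_def .

lemma levi_civita: "x \<in> S \<Longrightarrow> levi_civita_at h x (\<Gamma> x)"
proof -
  assume x: "x \<in> S"
  have "\<exists>!\<Gamma>. levi_civita_at h x \<Gamma>"
    by (rule levi_civita_ex1[OF S x bil sym nondeg[OF x] smooth_on_differentiable[OF smooth_h x]])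
  then show ?thesis unfolding christoffel_def by (rule theI')
qed

lemma christoffel_eqI: "x \<in> S \<Longrightarrow> levi_civita_at h x G \<Longrightarrow> \<Gamma> x = G"
proof -
  assume x: "x \<in> S" and G: "levi_civita_at h x G"
  have "\<exists>!\<Gamma>. levi_civita_at h x \<Gamma>"
    by (rule levi_civita_ex1[OF S x bil sym nondeg[OF x] smooth_on_differentiable[OF smooth_h x]])
  then show ?thesis using G levi_civita[OF x] by blast
qed

lemma \<Gamma>_sym: "x \<in> S \<Longrightarrow> \<Gamma> x u v = \<Gamma> x v u"
  by (drule levi_civita, simp add: levi_civita_at_def)

lemma \<Gamma>_linear: "x \<in> S \<Longrightarrow> linear (\<Gamma> x u)" "x \<in> S \<Longrightarrow> linear (\<lambda>u. \<Gamma> x u v)"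
  by (drule levi_civita, simp add: levi_civita_at_def bilinear_def)+

lemmas \<Gamma>_simps = linear_add[OF \<Gamma>_linear(1)] linear_add[OF \<Gamma>_linear(2)]
  linear_diff[OF \<Gamma>_linear(1)] linear_diff[OF \<Gamma>_linear(2)]
  linear_neg[OF \<Gamma>_linear(1)] linear_neg[OF \<Gamma>_linear(2)]
  linear_0[OF \<Gamma>_linear(1)] linear_0[OF \<Gamma>_linear(2)]
  linear_scale[OF \<Gamma>_linear(1)] linear_scale[OF \<Gamma>_linear(2)]

lemma metric_compatible: "x \<in> S \<Longrightarrow> dh x u v w = h x (\<Gamma> x u v) w + h x v (\<Gamma> x u w)"
  by (drule levi_civita, simp add: levi_civita_at_def dh_def)

lemma koszul:
  assumes x: "x \<in> S"
  shows "h x (\<Gamma> x u v) w = (dh x u v w + dh x v u w - dh x w u v) / 2"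
  unfolding metric_compatible[OF x]
  using \<Gamma>_sym[OF x, of u v] \<Gamma>_sym[OF x, of u w] \<Gamma>_sym[OF x, of v w] sym[OF x, of _ u] sym[OF x, of _ v]
  by simp

text \<open>The Koszul formula is a linear system for \<open>\<Gamma> u v\<close> whose matrix is the metric.\<close>

lemma smooth_\<Gamma>: "smooth_on S (\<lambda>x. \<Gamma> x u v)"
proof -
  define L where "L x z = (\<Sum>b\<in>Basis. h x z b *\<^sub>R b)" for x z
  define r where "r x = (\<Sum>b\<in>Basis. ((1/2) * (dh x u v b + dh x v u b - dh x b u v)) *\<^sub>R b)" for x
  have Lb: "L x z \<bullet> b = h x z b" if "b \<in> Basis" for x z b
    unfolding L_def using that by (simp add: inner_sum_left inner_Basis if_distrib cong: if_cong)
  have linL: "linear (L x)" if "x \<in> S" for x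
    unfolding L_def
    by (intro linear_compose_sum ballI linearI) (simp_all add: h_simps[OF that] scaleR_add_left)
  show ?thesis
  proof (rule solution_of_linear_system_smooth[where L = L and r = r and z = "\<lambda>x. \<Gamma> x u v", OF S linL])
    fix y assume y: "y \<in> S"
    show "inj (L y)"
    proof (subst linear_injective_0[OF linL[OF y]], intro allI impI)
      fix z assume "L y z = 0"
      then have "h y z b = 0" if "b \<in> Basis" for b using Lb[OF that, of y z] by simp
      then show "z = 0" using nondeg[OF y] linear_eq_stdbasis[OF h_linear(1)[OF y] linear_zero] by metis
    qed
    show "L y (\<Gamma> y u v) = r y"
      unfolding L_def r_def koszul[OF y] by simp
  next
    fix v show "smooth_on S (\<lambda>y. L y v)"
      unfolding L_def by (intro smooth_on_sum smooth_on_scaleR smooth_h smooth_on_const S)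
  next
    show "smooth_on S r"
      unfolding r_def dh_def
      by (intro smooth_on_sum smooth_on_scaleR smooth_on_mult smooth_on_add smooth_on_diff smooth_on_const S smooth_on_derivative smooth_h)
  qed
qed

lemma smooth_d\<Gamma>: "smooth_on S (\<lambda>x. d\<Gamma> x e u v)"
  unfolding d\<Gamma>_def by (rule smooth_on_derivative[OF smooth_\<Gamma>])

lemma \<Gamma>_has_derivative: "x \<in> S \<Longrightarrow> ((\<lambda>y. \<Gamma> y u v) has_derivative (\<lambda>e. d\<Gamma> x e u v)) (at x)"
  using smooth_onD[OF smooth_\<Gamma>] unfolding d\<Gamma>_def .

lemma d\<Gamma>_has_derivative: "x \<in> S \<Longrightarrow> ((\<lambda>y. d\<Gamma> y u v w) has_derivative (\<lambda>e. dd\<Gamma> x e u v w)) (at x)"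
  using smooth_onD[OF smooth_d\<Gamma>] unfolding dd\<Gamma>_def .

lemma d\<Gamma>_linear: "x \<in> S \<Longrightarrow> linear (d\<Gamma> x e u)" "x \<in> S \<Longrightarrow> linear (\<lambda>u. d\<Gamma> x e u v)" "x \<in> S \<Longrightarrow> linear (\<lambda>e. d\<Gamma> x e u v)"
proof -
  assume x: "x \<in> S"
  show "linear (d\<Gamma> x e u)"
    unfolding d\<Gamma>_def using frechet_derivative_linear_field[OF S x \<Gamma>_linear(1) smooth_onD[OF smooth_\<Gamma> x]] .
  show "linear (\<lambda>u. d\<Gamma> x e u v)"
    unfolding d\<Gamma>_def using frechet_derivative_linear_field[OF S x \<Gamma>_linear(2) smooth_onD[OF smooth_\<Gamma> x]] .
  show "linear (\<lambda>e. d\<Gamma> x e u v)"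
    using has_derivative_linear[OF \<Gamma>_has_derivative[OF x]] .
qed

lemmas d\<Gamma>_simps = linear_add[OF d\<Gamma>_linear(1)] linear_add[OF d\<Gamma>_linear(2)] linear_add[OF d\<Gamma>_linear(3)]
  linear_diff[OF d\<Gamma>_linear(1)] linear_diff[OF d\<Gamma>_linear(2)] linear_diff[OF d\<Gamma>_linear(3)]
  linear_neg[OF d\<Gamma>_linear(1)] linear_neg[OF d\<Gamma>_linear(2)] linear_neg[OF d\<Gamma>_linear(3)]
  linear_0[OF d\<Gamma>_linear(1)] linear_0[OF d\<Gamma>_linear(2)] linear_0[OF d\<Gamma>_linear(3)]
  linear_scale[OF d\<Gamma>_linear(1)] linear_scale[OF d\<Gamma>_linear(2)] linear_scale[OF d\<Gamma>_linear(3)]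

lemma d\<Gamma>_sym: "x \<in> S \<Longrightarrow> d\<Gamma> x e u v = d\<Gamma> x e v u"
proof -
  assume x: "x \<in> S"
  have "((\<lambda>y. \<Gamma> y v u) has_derivative (\<lambda>e. d\<Gamma> x e u v)) (at x)"
    by (rule has_derivative_transform_within_open[OF \<Gamma>_has_derivative[OF x] S x]) (rule \<Gamma>_sym)
  from has_derivative_unique[OF this \<Gamma>_has_derivative[OF x]] show ?thesis by metis
qed

lemma dd\<Gamma>_sym: "x \<in> S \<Longrightarrow> dd\<Gamma> x e u v w = dd\<Gamma> x u e v w"
  unfolding dd\<Gamma>_def d\<Gamma>_def by (rule second_derivative_symmetric[OF S _ smooth_\<Gamma>])

lemma curvature_at_eq_Riem:
  assumes x: "x \<in> S"
  shows "curvature_at h x u v w = Riem x u v w"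
proof -
  have n: "nabla h (\<lambda>_. v) (\<lambda>_. w) = (\<lambda>y. \<Gamma> y v w)" for v w
    by (simp add: nabla_def fun_eq_iff)
  have l: "lie_bracket (\<lambda>_. u) (\<lambda>_. v) = (\<lambda>_. 0)"
    by (simp add: lie_bracket_def fun_eq_iff)
  show ?thesis
    unfolding curvature_at_def curvature_def n l
    by (simp add: nabla_def Riem_def d\<Gamma>_def \<Gamma>_simps[OF x])
qed

lemma Riem_linear: "x \<in> S \<Longrightarrow> linear (Riem x u v)" "x \<in> S \<Longrightarrow> linear (\<lambda>v. Riem x u v w)" "x \<in> S \<Longrightarrow> linear (\<lambda>u. Riem x u v w)"
proof -
  assume x: "x \<in> S"
  show "linear (Riem x u v)"
    by (rule linearI) (simp_all add: Riem_def \<Gamma>_simps[OF x] d\<Gamma>_simps[OF x] algebra_simps)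
  show "linear (\<lambda>v. Riem x u v w)"
    by (rule linearI) (simp_all add: Riem_def \<Gamma>_simps[OF x] d\<Gamma>_simps[OF x] algebra_simps)
  show "linear (\<lambda>u. Riem x u v w)"
    by (rule linearI) (simp_all add: Riem_def \<Gamma>_simps[OF x] d\<Gamma>_simps[OF x] algebra_simps)
qed

lemmas Riem_simps = linear_add[OF Riem_linear(1)] linear_add[OF Riem_linear(2)] linear_add[OF Riem_linear(3)]
  linear_diff[OF Riem_linear(1)] linear_diff[OF Riem_linear(2)] linear_diff[OF Riem_linear(3)]
  linear_neg[OF Riem_linear(1)] linear_neg[OF Riem_linear(2)] linear_neg[OF Riem_linear(3)]
  linear_0[OF Riem_linear(1)] linear_0[OF Riem_linear(2)] linear_0[OF Riem_linear(3)]
  linear_scale[OF Riem_linear(1)] linear_scale[OF Riem_linear(2)] linear_scale[OF Riem_linear(3)]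

lemma Riem_antisym: "Riem x u v w = - Riem x v u w"
  unfolding Riem_def by simp

lemma first_bianchi:
  assumes x: "x \<in> S"
  shows "Riem x u v w + Riem x v w u + Riem x w u v = 0"
  unfolding Riem_def d\<Gamma>_sym[OF x, of u w v] d\<Gamma>_sym[OF x, of v u w] d\<Gamma>_sym[OF x, of w v u]
    \<Gamma>_sym[OF x, of w v] \<Gamma>_sym[OF x, of v u] \<Gamma>_sym[OF x, of u w] by simp

lemma smooth_Riem: "smooth_on S (\<lambda>x. Riem x u v w)"
proof -
  have G: "smooth_on S (\<lambda>x. \<Gamma> x u (\<Gamma> x v w))" for u v w
    by (rule smooth_on_linear_field[OF S \<Gamma>_linear(1) smooth_\<Gamma> smooth_\<Gamma>])
  show ?thesis
    unfolding Riem_def by (intro smooth_on_add smooth_on_diff S smooth_d\<Gamma> G)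
qed

lemma has_derivative_\<Gamma>_field:
  assumes "x \<in> S" "(Y has_derivative Y') (at x)"
  shows "((\<lambda>y. \<Gamma> y u (Y y)) has_derivative (\<lambda>e. d\<Gamma> x e u (Y x) + \<Gamma> x u (Y' e))) (at x)"
  by (rule has_derivative_linear_field[OF S assms(1) \<Gamma>_linear(1) \<Gamma>_has_derivative[OF assms(1)] assms(2)])

lemma has_derivative_h_field:
  assumes x: "x \<in> S" and Y: "(Y has_derivative Y') (at x)"
  shows "((\<lambda>y. h y v (Y y)) has_derivative (\<lambda>e. dh x e v (Y x) + h x v (Y' e))) (at x)"
    and "((\<lambda>y. h y (Y y) v) has_derivative (\<lambda>e. dh x e (Y x) v + h x (Y' e) v)) (at x)"
proof -
  show "((\<lambda>y. h y v (Y y)) has_derivative (\<lambda>e. dh x e v (Y x) + h x v (Y' e))) (at x)"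
    by (rule has_derivative_linear_field[OF S x h_linear(1) h_has_derivative[OF x] Y])
  show "((\<lambda>y. h y (Y y) v) has_derivative (\<lambda>e. dh x e (Y x) v + h x (Y' e) v)) (at x)"
    by (rule has_derivative_linear_field[OF S x h_linear(2) h_has_derivative[OF x] Y])
qed

lemma Riem_has_derivative: "x \<in> S \<Longrightarrow> ((\<lambda>y. Riem y u v w) has_derivative (\<lambda>e. dRiem x e u v w)) (at x)"
  using smooth_onD[OF smooth_Riem] unfolding dRiem_def .

lemma dRiem_expand:
  assumes x: "x \<in> S"
  shows "dRiem x e u v w = dd\<Gamma> x e u v w - dd\<Gamma> x e v u w + (d\<Gamma> x e u (\<Gamma> x v w) + \<Gamma> x u (d\<Gamma> x e v w))
     - (d\<Gamma> x e v (\<Gamma> x u w) + \<Gamma> x v (d\<Gamma> x e u w))"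
proof -
  have "((\<lambda>y. Riem y u v w) has_derivative (\<lambda>e. dd\<Gamma> x e u v w - dd\<Gamma> x e v u w + (d\<Gamma> x e u (\<Gamma> x v w) + \<Gamma> x u (d\<Gamma> x e v w))
     - (d\<Gamma> x e v (\<Gamma> x u w) + \<Gamma> x v (d\<Gamma> x e u w)))) (at x)"
    unfolding Riem_def
    by (intro has_derivative_add has_derivative_diff d\<Gamma>_has_derivative[OF x]
        has_derivative_\<Gamma>_field[OF x \<Gamma>_has_derivative[OF x]])
  from has_derivative_unique[OF Riem_has_derivative[OF x] this] show ?thesis by metis
qed

text \<open>The terms with second derivatives of \<open>\<Gamma>\<close> cancel by their symmetry and the commutators by the Jacobi
  identity; the terms that differentiate the arguments cancel because \<open>\<Gamma>\<close> is symmetric.\<close>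

lemma second_bianchi:
  assumes x: "x \<in> S"
  shows "nRiem x e u v w + nRiem x u v e w + nRiem x v e u w = 0"
  unfolding nRiem_def dRiem_expand[OF x] Riem_def
  by (simp add: algebra_simps \<Gamma>_simps[OF x] d\<Gamma>_simps[OF x] dd\<Gamma>_sym[OF x, of u e] dd\<Gamma>_sym[OF x, of v e] dd\<Gamma>_sym[OF x, of v u]
     \<Gamma>_sym[OF x, of u e] \<Gamma>_sym[OF x, of v e] \<Gamma>_sym[OF x, of v u])

text \<open>The second derivatives of \<open>h w z\<close> commute. Expressing them through \<open>\<Gamma>\<close>, what is left of their difference
  is the sum of the two curvature terms.\<close>

lemma Riem_skew:
  assumes x: "x \<in> S"
  shows "h x (Riem x u v w) z = - h x w (Riem x u v z)"
proof -
  have 1: "((\<lambda>y. h y (\<Gamma> y v w) z + h y w (\<Gamma> y v z)) has_derivative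
     (\<lambda>u. (dh x u (\<Gamma> x v w) z + h x (d\<Gamma> x u v w) z) + (dh x u w (\<Gamma> x v z) + h x w (d\<Gamma> x u v z)))) (at x)" for v
    by (intro has_derivative_add has_derivative_h_field[OF x \<Gamma>_has_derivative[OF x]])
  have "((\<lambda>y. dh y v w z) has_derivative
     (\<lambda>u. (dh x u (\<Gamma> x v w) z + h x (d\<Gamma> x u v w) z) + (dh x u w (\<Gamma> x v z) + h x w (d\<Gamma> x u v z)))) (at x)" for v
    by (rule has_derivative_transform_within_open[OF 1 S x]) (simp add: metric_compatible)
  note 2 = frechet_derivative_at[OF this, symmetric]
  have "frechet_derivative (\<lambda>y. dh y v w z) (at x) u = frechet_derivative (\<lambda>y. dh y u w z) (at x) v"
    unfolding dh_def by (rule second_derivative_symmetric[OF S x smooth_h])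
  then show ?thesis
    unfolding 2 metric_compatible[OF x] Riem_def h_simps[OF x] by linarith
qed

text \<open>Four instances of the first Bianchi identity, combined by means of the two antisymmetries.\<close>

lemma Riem_pair_sym:
  assumes x: "x \<in> S"
  shows "h x (Riem x u v w) z = h x (Riem x w z u) v"
proof -
  define T where "T u v w z = h x (Riem x u v w) z" for u v w z
  have a: "T u v w z = - T v u w z" for u v w z
    unfolding T_def by (subst Riem_antisym) (simp add: h_simps[OF x])
  have b: "T u v w z = - T u v z w" for u v w z
    unfolding T_def using Riem_skew[OF x] sym[OF x] by metis
  have c: "T u v w z + T v w u z + T w u v z = 0" for u v w z
    unfolding T_def using first_bianchi[OF x, of u v w] by (simp flip: h_simps(2)[OF x] add: h_simps(8)[OF x])
  have "T u v w z = T w z u v"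
  proof -
    have "T v w z u = - T v w u z" "T w z v u = - T w z u v" "T u v z w = - T u v w z"
      by (rule b)+
    moreover have "T z v w u = - T v z w u" "T z u v w = - T u z v w" "T v z u w = - T v z w u"
      by (rule a a b)+
    moreover have "T z u w v = T u z v w" "T u w z v = T w u v z"
      using a[of z u w v] b[of u z w v] a[of u w z v] b[of w u z v] by simp_all
    ultimately show ?thesis
      using c[of u v w z] c[of v w z u] c[of w z u v] c[of z u v w] by linarith
  qed
  then show ?thesis unfolding T_def .
qed

end

section \<open>Parallel endomorphisms and position fields\<close>

context metric_chart
begin

text \<open>The last clause is \<open>\<nabla> A = 0\<close>, solved for the ordinary derivative of \<open>A\<close>.\<close>

definition parallel_endo :: "('a \<Rightarrow> 'a \<Rightarrow> 'a) \<Rightarrow> bool" where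
  "parallel_endo A \<longleftrightarrow> (\<forall>x\<in>S. linear (A x)) \<and> (\<forall>w. smooth_on S (\<lambda>x. A x w)) \<and>
     (\<forall>x\<in>S. \<forall>w. ((\<lambda>y. A y w) has_derivative (\<lambda>u. A x (\<Gamma> x u w) - \<Gamma> x u (A x w))) (at x))"

text \<open>The last clause is \<open>\<nabla> \<zeta> = A\<close>. For \<open>A = 1\<close> such a field is the radial field of a cone; for the projection \<open>A\<close>
  onto a parallel distribution it is the radial field of one factor of the local product decomposition.\<close>

definition position_field :: "('a \<Rightarrow> 'a \<Rightarrow> 'a) \<Rightarrow> ('a \<Rightarrow> 'a) \<Rightarrow> bool" where
  "position_field A \<zeta> \<longleftrightarrow> smooth_on S \<zeta> \<and>
     (\<forall>x\<in>S. (\<zeta> has_derivative (\<lambda>u. A x u - \<Gamma> x u (\<zeta> x))) (at x))"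

lemma parallel_endoD:
  assumes "parallel_endo A"
  shows "x \<in> S \<Longrightarrow> linear (A x)" and "smooth_on S (\<lambda>x. A x w)"
    and "x \<in> S \<Longrightarrow> ((\<lambda>y. A y w) has_derivative (\<lambda>u. A x (\<Gamma> x u w) - \<Gamma> x u (A x w))) (at x)"
  using assms by (simp_all add: parallel_endo_def)

lemma position_fieldD:
  assumes "position_field A \<zeta>"
  shows "smooth_on S \<zeta>" and "x \<in> S \<Longrightarrow> (\<zeta> has_derivative (\<lambda>u. A x u - \<Gamma> x u (\<zeta> x))) (at x)"
  using assms by (simp_all add: position_field_def)

lemma parallel_endo_id: "parallel_endo (\<lambda>x w. w)"
  unfolding parallel_endo_def by (simp add: linear_id[unfolded id_def] smooth_on_const)

lemma parallel_endo_complement: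
  assumes "parallel_endo A"
  shows "parallel_endo (\<lambda>x w. w - A x w)"
  unfolding parallel_endo_def
proof (intro conjI ballI allI)
  fix x w assume x: "x \<in> S"
  show "linear (\<lambda>w. w - A x w)"
    by (intro linear_compose_sub parallel_endoD(1)[OF assms x] linear_id[unfolded id_def])
  have "((\<lambda>y. w - A y w) has_derivative (\<lambda>u. 0 - (A x (\<Gamma> x u w) - \<Gamma> x u (A x w)))) (at x)"
    by (intro has_derivative_diff has_derivative_const parallel_endoD(3)[OF assms x])
  then show "((\<lambda>y. w - A y w) has_derivative (\<lambda>u. \<Gamma> x u w - A x (\<Gamma> x u w) - \<Gamma> x u (w - A x w))) (at x)"
    by (simp add: \<Gamma>_simps[OF x])
next
  show "smooth_on S (\<lambda>x. w - A x w)" for w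
    by (intro smooth_on_diff S smooth_on_const parallel_endoD(2)[OF assms])
qed

lemma has_derivative_parallel_endo_field:
  assumes A: "parallel_endo A" and x: "x \<in> S" and Y: "(Y has_derivative Y') (at x)"
  shows "((\<lambda>y. A y (Y y)) has_derivative
    (\<lambda>e. A x (\<Gamma> x e (Y x)) - \<Gamma> x e (A x (Y x)) + A x (Y' e))) (at x)"
  by (rule has_derivative_linear_field[OF S x parallel_endoD(1)[OF A] parallel_endoD(3)[OF A x] Y])

lemma smooth_parallel_endo_field:
  assumes A: "parallel_endo A" and Y: "smooth_on S Y"
  shows "smooth_on S (\<lambda>x. A x (Y x))"
  by (rule smooth_on_linear_field[OF S parallel_endoD(1)[OF A] parallel_endoD(2)[OF A] Y])

lemma position_field_image:
  assumes A: "parallel_endo A" and \<xi>: "position_field (\<lambda>x w. w) \<xi>"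
  shows "position_field A (\<lambda>x. A x (\<xi> x))"
  unfolding position_field_def
proof (intro conjI ballI)
  fix x assume x: "x \<in> S"
  show "((\<lambda>x. A x (\<xi> x)) has_derivative (\<lambda>u. A x u - \<Gamma> x u (A x (\<xi> x)))) (at x)"
    using has_derivative_parallel_endo_field[OF A x position_fieldD(2)[OF \<xi> x]]
    by (simp add: linear_diff[OF parallel_endoD(1)[OF A x]])
next
  show "smooth_on S (\<lambda>x. A x (\<xi> x))"
    by (rule smooth_parallel_endo_field[OF A position_fieldD(1)[OF \<xi>]])
qed

text \<open>The second derivatives of \<open>A\<close> commute; as \<open>\<nabla> A = 0\<close>, what is left of their difference is the commutator
  of \<open>A\<close> with the curvature.\<close>

lemma Riem_commutes_parallel_endo:
  assumes A: "parallel_endo A" and x: "x \<in> S"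
  shows "Riem x u v (A x w) = A x (Riem x u v w)"
proof -
  note lin = parallel_endoD(1)[OF A x]
  define B where "B v y = A y (\<Gamma> y v w) - \<Gamma> y v (A y w)" for v y
  have Dw: "frechet_derivative (\<lambda>y. A y w) (at y) v = B v y" if "y \<in> S" for y v
    unfolding B_def using frechet_derivative_at[OF parallel_endoD(3)[OF A that, of w]] by metis
  have "(B v has_derivative (\<lambda>u. (A x (\<Gamma> x u (\<Gamma> x v w)) - \<Gamma> x u (A x (\<Gamma> x v w)) + A x (d\<Gamma> x u v w))
      - (d\<Gamma> x u v (A x w) + \<Gamma> x v (A x (\<Gamma> x u w) - \<Gamma> x u (A x w))))) (at x)" for v
    unfolding B_def
    by (intro has_derivative_diff has_derivative_parallel_endo_field[OF A x \<Gamma>_has_derivative[OF x]]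
        has_derivative_\<Gamma>_field[OF x parallel_endoD(3)[OF A x]])
  then have "((\<lambda>y. frechet_derivative (\<lambda>y. A y w) (at y) v) has_derivative
     (\<lambda>u. (A x (\<Gamma> x u (\<Gamma> x v w)) - \<Gamma> x u (A x (\<Gamma> x v w)) + A x (d\<Gamma> x u v w))
      - (d\<Gamma> x u v (A x w) + \<Gamma> x v (A x (\<Gamma> x u w) - \<Gamma> x u (A x w))))) (at x)" for v
    by (rule has_derivative_transform_within_open[OF _ S x]) (simp add: Dw)
  note D2 = frechet_derivative_at[OF this, symmetric]
  from second_derivative_symmetric[OF S x parallel_endoD(2)[OF A, of w], of v u]
  have "A x (\<Gamma> x u (\<Gamma> x v w)) + A x (d\<Gamma> x u v w) - d\<Gamma> x u v (A x w) + \<Gamma> x v (\<Gamma> x u (A x w))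
      = A x (\<Gamma> x v (\<Gamma> x u w)) + A x (d\<Gamma> x v u w) - d\<Gamma> x v u (A x w) + \<Gamma> x u (\<Gamma> x v (A x w))"
    unfolding D2 by (simp add: \<Gamma>_simps[OF x] algebra_simps)
  then show ?thesis
    unfolding Riem_def linear_add[OF lin] linear_diff[OF lin] by (simp add: algebra_simps)
qed

text \<open>The curvature term \<open>R(u, v) \<zeta>\<close> is the antisymmetric part of \<open>\<nabla>\<nabla> \<zeta> = \<nabla> A = 0\<close>.\<close>

lemma Riem_position_field:
  assumes A: "parallel_endo A" and \<zeta>: "position_field A \<zeta>" and x: "x \<in> S"
  shows "Riem x u v (\<zeta> x) = 0"
proof -
  define B where "B v y = A y v - \<Gamma> y v (\<zeta> y)" for v y
  have Dw: "frechet_derivative \<zeta> (at y) v = B v y" if "y \<in> S" for y v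
    unfolding B_def using frechet_derivative_at[OF position_fieldD(2)[OF \<zeta> that]] by metis
  have "(B v has_derivative (\<lambda>u. (A x (\<Gamma> x u v) - \<Gamma> x u (A x v))
      - (d\<Gamma> x u v (\<zeta> x) + \<Gamma> x v (A x u - \<Gamma> x u (\<zeta> x))))) (at x)" for v
    unfolding B_def
    by (intro has_derivative_diff parallel_endoD(3)[OF A x] has_derivative_\<Gamma>_field[OF x position_fieldD(2)[OF \<zeta> x]])
  then have "((\<lambda>y. frechet_derivative \<zeta> (at y) v) has_derivative (\<lambda>u. (A x (\<Gamma> x u v) - \<Gamma> x u (A x v))
      - (d\<Gamma> x u v (\<zeta> x) + \<Gamma> x v (A x u - \<Gamma> x u (\<zeta> x))))) (at x)" for v
    by (rule has_derivative_transform_within_open[OF _ S x]) (simp add: Dw)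
  note D2 = frechet_derivative_at[OF this, symmetric]
  from second_derivative_symmetric[OF S x position_fieldD(1)[OF \<zeta>], of v u]
  have "\<Gamma> x v (\<Gamma> x u (\<zeta> x)) - d\<Gamma> x u v (\<zeta> x) = \<Gamma> x u (\<Gamma> x v (\<zeta> x)) - d\<Gamma> x v u (\<zeta> x)"
    unfolding D2 by (simp add: \<Gamma>_simps[OF x] \<Gamma>_sym[OF x, of u v] algebra_simps)
  then show ?thesis
    unfolding Riem_def by (simp add: algebra_simps)
qed

lemma Riem_position_field_slot:
  assumes A: "parallel_endo A" and \<zeta>: "position_field A \<zeta>" and x: "x \<in> S"
  shows "Riem x u (\<zeta> x) w = 0" "Riem x (\<zeta> x) u w = 0"
proof -
  show 1: "Riem x u (\<zeta> x) w = 0"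
  proof (rule nondeg[OF x])
    fix z
    have "h x (Riem x u (\<zeta> x) w) z = h x (Riem x w z u) (\<zeta> x)" by (rule Riem_pair_sym[OF x])
    also have "\<dots> = - h x u (Riem x w z (\<zeta> x))" by (rule Riem_skew[OF x])
    finally show "h x (Riem x u (\<zeta> x) w) z = 0"
      by (simp add: Riem_position_field[OF A \<zeta> x] h_simps[OF x])
  qed
  then show "Riem x (\<zeta> x) u w = 0" by (subst Riem_antisym) simp
qed

lemma has_derivative_Riem_field2:
  assumes x: "x \<in> S" and Y: "(Y has_derivative Y') (at x)"
  shows "((\<lambda>y. Riem y u (Y y) w) has_derivative (\<lambda>e. dRiem x e u (Y x) w + Riem x u (Y' e) w)) (at x)"
  by (rule has_derivative_linear_field[OF S x Riem_linear(2) Riem_has_derivative[OF x] Y])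

lemma nRiem_antisym: "x \<in> S \<Longrightarrow> nRiem x e u v w = - nRiem x e v u w"
proof -
  assume x: "x \<in> S"
  have 0: "((\<lambda>y. - Riem y v u w) has_derivative (\<lambda>e. - dRiem x e v u w)) (at x)"
    by (intro has_derivative_minus Riem_has_derivative[OF x])
  have "((\<lambda>y. Riem y u v w) has_derivative (\<lambda>e. - dRiem x e v u w)) (at x)"
    by (rule has_derivative_transform_within_open[OF 0 S x]) (rule Riem_antisym[symmetric])
  from has_derivative_unique[OF Riem_has_derivative[OF x] this] have 1: "dRiem x e u v w = - dRiem x e v u w"
    by metis
  show ?thesis
    unfolding nRiem_def 1 Riem_antisym[of x u v] Riem_antisym[of x "\<Gamma> x e u" v] Riem_antisym[of x u "\<Gamma> x e v"]
    by (simp add: \<Gamma>_simps[OF x])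
qed

text \<open>Differentiating the identity \<open>R(v, \<zeta>) = 0\<close> gives \<open>(\<nabla>\<^sub>e R)(v, \<zeta>) = - R(v, A e)\<close>. This turns two of the
  three terms of the second Bianchi identity for \<open>\<zeta>, u, v\<close> into curvature terms. Geometrically: the curvature
  of a cone is homogeneous along its radial field.\<close>

lemma nRiem_position_field:
  assumes A: "parallel_endo A" and \<zeta>: "position_field A \<zeta>" and x: "x \<in> S"
  shows "nRiem x (\<zeta> x) u v w = - Riem x (A x u) v w - Riem x u (A x v) w"
proof -
  have n: "nRiem x e u (\<zeta> x) w = - Riem x u (A x e) w" for e u
  proof -
    have 0: "((\<lambda>y. 0) has_derivative (\<lambda>e. 0)) (at x)" by simp
    have "((\<lambda>y. Riem y u (\<zeta> y) w) has_derivative (\<lambda>e. 0)) (at x)"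
      by (rule has_derivative_transform_within_open[OF 0 S x]) (simp add: Riem_position_field_slot[OF A \<zeta>])
    from has_derivative_unique[OF has_derivative_Riem_field2[OF x position_fieldD(2)[OF \<zeta> x]] this]
    have "dRiem x e u (\<zeta> x) w + Riem x u (A x e - \<Gamma> x e (\<zeta> x)) w = 0" by metis
    then show ?thesis unfolding nRiem_def
      by (simp add: Riem_simps[OF x] Riem_position_field_slot[OF A \<zeta> x] \<Gamma>_simps[OF x] algebra_simps)
  qed
  have "nRiem x (\<zeta> x) u v w = - nRiem x u v (\<zeta> x) w + nRiem x v u (\<zeta> x) w"
    using second_bianchi[OF x, of "\<zeta> x" u v w] nRiem_antisym[OF x, of v "\<zeta> x" u w]
    by (simp add: algebra_simps eq_neg_iff_add_eq_0)
  also have "\<dots> = Riem x v (A x u) w - Riem x u (A x v) w" unfolding n by simp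
  also have "Riem x v (A x u) w = - Riem x (A x u) v w" by (rule Riem_antisym)
  finally show ?thesis .
qed

lemma nRiem_linear1: "x \<in> S \<Longrightarrow> linear (\<lambda>e. nRiem x e u v w)"
proof -
  assume x: "x \<in> S"
  have d: "linear (\<lambda>e. dRiem x e u v w)"
    using has_derivative_linear[OF Riem_has_derivative[OF x]] .
  show ?thesis
    by (rule linearI) (simp_all add: nRiem_def linear_add[OF d] linear_scale[OF d] \<Gamma>_simps[OF x] Riem_simps[OF x] algebra_simps)
qed

text \<open>The hypotheses say that the three fields are parallel at \<open>x\<close>, so that only \<open>\<nabla> R\<close> contributes.\<close>

lemma has_derivative_Riem_parallel_fields:
  assumes x: "x \<in> S" and U: "(U has_derivative (\<lambda>e. - \<Gamma> x e (U x))) (at x)"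
    and V: "(V has_derivative (\<lambda>e. - \<Gamma> x e (V x))) (at x)"
    and W: "(W has_derivative (\<lambda>e. - \<Gamma> x e (W x))) (at x)"
  shows "((\<lambda>y. Riem y (U y) (V y) (W y)) has_derivative
     (\<lambda>e. nRiem x e (U x) (V x) (W x) - \<Gamma> x e (Riem x (U x) (V x) (W x)))) (at x)"
proof -
  have 1: "((\<lambda>y. Riem y (U y) v w) has_derivative (\<lambda>e. dRiem x e (U x) v w + Riem x (- \<Gamma> x e (U x)) v w)) (at x)" for v w
    by (rule has_derivative_linear_field[OF S x Riem_linear(3) Riem_has_derivative[OF x] U])
  have 2: "((\<lambda>y. Riem y (U y) (V y) w) has_derivative
      (\<lambda>e. (dRiem x e (U x) (V x) w + Riem x (- \<Gamma> x e (U x)) (V x) w) + Riem x (U x) (- \<Gamma> x e (V x)) w)) (at x)" for w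
    by (rule has_derivative_linear_field[OF S x Riem_linear(2) 1 V])
  have "((\<lambda>y. Riem y (U y) (V y) (W y)) has_derivative
      (\<lambda>e. ((dRiem x e (U x) (V x) (W x) + Riem x (- \<Gamma> x e (U x)) (V x) (W x)) + Riem x (U x) (- \<Gamma> x e (V x)) (W x))
        + Riem x (U x) (V x) (- \<Gamma> x e (W x)))) (at x)"
    by (rule has_derivative_linear_field[OF S x Riem_linear(1) 2 W])
  then show ?thesis
    by (simp add: nRiem_def Riem_simps[OF x])
qed

lemma has_derivative_h_fields:
  assumes x: "x \<in> S" and Y: "(Y has_derivative Y') (at x)" and Z: "(Z has_derivative Z') (at x)"
  shows "((\<lambda>y. h y (Y y) (Z y)) has_derivative
     (\<lambda>e. h x (Y' e + \<Gamma> x e (Y x)) (Z x) + h x (Y x) (Z' e + \<Gamma> x e (Z x)))) (at x)"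
proof -
  have "((\<lambda>y. h y (Y y) (Z y)) has_derivative
     (\<lambda>e. (dh x e (Y x) (Z x) + h x (Y' e) (Z x)) + h x (Y x) (Z' e))) (at x)"
    by (rule has_derivative_linear_field[OF S x h_linear(1) has_derivative_h_field(2)[OF x Y] Z])
  then show ?thesis
    by (simp add: metric_compatible[OF x] h_simps[OF x] algebra_simps)
qed

end

section \<open>Naturality under local isometries\<close>

locale chart_isometry = src: metric_chart S h + tgt: metric_chart S' h'
  for S :: "'a::euclidean_space set" and h and S' :: "'a set" and h' +
  fixes U :: "'a set" and \<tau> :: "'a \<Rightarrow> 'a"
  assumes U: "open U" "U \<subseteq> S" and \<tau>_into: "x \<in> U \<Longrightarrow> \<tau> x \<in> S'"
    and smooth_\<tau>: "smooth_on U \<tau>"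
    and isometry: "x \<in> U \<Longrightarrow> h x v w =
      h' (\<tau> x) (frechet_derivative \<tau> (at x) v) (frechet_derivative \<tau> (at x) w)"
begin

abbreviation d\<tau> where "d\<tau> x v \<equiv> frechet_derivative \<tau> (at x) v"

definition dd\<tau> where "dd\<tau> x u v = frechet_derivative (\<lambda>y. d\<tau> y v) (at x) u"
definition ddd\<tau> where "ddd\<tau> x u v w = frechet_derivative (\<lambda>y. dd\<tau> y v w) (at x) u"

lemma in_S: "x \<in> U \<Longrightarrow> x \<in> S" using U by auto

lemma \<tau>_has_derivative: "x \<in> U \<Longrightarrow> (\<tau> has_derivative (\<lambda>v. d\<tau> x v)) (at x)"
  by (rule smooth_onD[OF smooth_\<tau>])

lemma d\<tau>_linear: "x \<in> U \<Longrightarrow> linear (\<lambda>v. d\<tau> x v)"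
  using has_derivative_linear[OF \<tau>_has_derivative] .

lemma d\<tau>_has_derivative: "x \<in> U \<Longrightarrow> ((\<lambda>y. d\<tau> y v) has_derivative (\<lambda>u. dd\<tau> x u v)) (at x)"
  unfolding dd\<tau>_def by (rule smooth_onD[OF smooth_on_derivative[OF smooth_\<tau>]])

lemma dd\<tau>_has_derivative: "x \<in> U \<Longrightarrow> ((\<lambda>y. dd\<tau> y v w) has_derivative (\<lambda>u. ddd\<tau> x u v w)) (at x)"
  unfolding ddd\<tau>_def dd\<tau>_def by (rule smooth_onD[OF smooth_on_derivative[OF smooth_on_derivative[OF smooth_\<tau>]]])

lemma dd\<tau>_sym: "x \<in> U \<Longrightarrow> dd\<tau> x u v = dd\<tau> x v u"
  unfolding dd\<tau>_def by (rule second_derivative_symmetric[OF U(1) _ smooth_\<tau>])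

lemma ddd\<tau>_sym: "x \<in> U \<Longrightarrow> ddd\<tau> x u v w = ddd\<tau> x v u w"
  unfolding ddd\<tau>_def dd\<tau>_def by (rule second_derivative_symmetric[OF U(1) _ smooth_on_derivative[OF smooth_\<tau>]])

lemma dd\<tau>_linear: "x \<in> U \<Longrightarrow> linear (\<lambda>u. dd\<tau> x u v)" "x \<in> U \<Longrightarrow> linear (dd\<tau> x u)"
proof -
  assume x: "x \<in> U"
  show 1: "linear (\<lambda>u. dd\<tau> x u v)" for v using has_derivative_linear[OF d\<tau>_has_derivative[OF x]] .
  have "dd\<tau> x u = (\<lambda>v. dd\<tau> x v u)" using dd\<tau>_sym[OF x] by blast
  then show "linear (dd\<tau> x u)" using 1 by simp
qed

lemma d\<tau>_inj: "x \<in> U \<Longrightarrow> inj (\<lambda>v. d\<tau> x v)"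
proof (subst linear_injective_0[OF d\<tau>_linear], simp, intro allI impI)
  fix v assume x: "x \<in> U" and "d\<tau> x v = 0"
  then have "h x v w = 0" for w
    by (simp add: isometry tgt.h_simps[OF \<tau>_into[OF x]])
  then show "v = 0" by (rule src.nondeg[OF in_S[OF x]])
qed

lemma d\<tau>_surj: "x \<in> U \<Longrightarrow> \<exists>v. d\<tau> x v = w"
  using linear_injective_imp_surjective[OF d\<tau>_linear d\<tau>_inj] by (metis surjD)

text \<open>The connection of the target, pulled back by \<open>\<tau>\<close>, is torsion-free and metric, so it is the Levi-Civita
  connection of the source by uniqueness.\<close>

lemma christoffel_transform:
  assumes x: "x \<in> U"
  shows "d\<tau> x (src.\<Gamma> x u v) = tgt.\<Gamma> (\<tau> x) (d\<tau> x u) (d\<tau> x v) + dd\<tau> x u v"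
proof -
  note x' = \<tau>_into[OF x]
  note lin = d\<tau>_linear[OF x]
  define G where "G u v = tgt.\<Gamma> (\<tau> x) (d\<tau> x u) (d\<tau> x v) + dd\<tau> x u v" for u v
  obtain N where N: "\<And>w. d\<tau> x (N w) = w" using d\<tau>_surj[OF x] by metis
  have Neq: "N w = v" if "d\<tau> x v = w" for v w
    using injD[OF d\<tau>_inj[OF x], of "N w" v] N that by simp
  have Gadd: "G (a + b) v = G a v + G b v" "G u (a + b) = G u a + G u b" for a b u v
    unfolding G_def by (simp_all add: linear_add[OF lin] tgt.\<Gamma>_simps[OF x'] linear_add[OF dd\<tau>_linear(1)[OF x]] linear_add[OF dd\<tau>_linear(2)[OF x]])
  have Gscale: "G (c *\<^sub>R a) v = c *\<^sub>R G a v" "G u (c *\<^sub>R a) = c *\<^sub>R G u a" for a c u v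
    unfolding G_def by (simp_all add: linear_scale[OF lin] tgt.\<Gamma>_simps[OF x'] linear_scale[OF dd\<tau>_linear(1)[OF x]] linear_scale[OF dd\<tau>_linear(2)[OF x]] scaleR_add_right)
  have "levi_civita_at h x (\<lambda>u v. N (G u v))"
    unfolding levi_civita_at_def
  proof (intro conjI allI)
    show "bilinear (\<lambda>u v. N (G u v))"
      unfolding bilinear_def
      by (auto intro!: linearI Neq simp: Gadd Gscale linear_add[OF lin] linear_scale[OF lin] N)
    show "N (G u v) = N (G v u)" for u v
      unfolding G_def by (simp add: tgt.\<Gamma>_sym[OF x', of "d\<tau> x u"] dd\<tau>_sym[OF x, of u])
    fix u v w
    have 0: "((\<lambda>y. h' (\<tau> y) a b) has_derivative (\<lambda>u. tgt.dh (\<tau> x) (d\<tau> x u) a b)) (at x)" for a b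
      by (rule has_derivative_compose[OF \<tau>_has_derivative[OF x] tgt.h_has_derivative[OF x']])
    have 1: "((\<lambda>y. h' (\<tau> y) (d\<tau> y v) b) has_derivative
       (\<lambda>u. tgt.dh (\<tau> x) (d\<tau> x u) (d\<tau> x v) b + h' (\<tau> x) (dd\<tau> x u v) b)) (at x)" for b
      by (rule has_derivative_linear_field[OF U(1) x tgt.h_linear(2)[OF \<tau>_into] 0 d\<tau>_has_derivative[OF x]])
    have 2: "((\<lambda>y. h' (\<tau> y) (d\<tau> y v) (d\<tau> y w)) has_derivative
       (\<lambda>u. (tgt.dh (\<tau> x) (d\<tau> x u) (d\<tau> x v) (d\<tau> x w) + h' (\<tau> x) (dd\<tau> x u v) (d\<tau> x w)) + h' (\<tau> x) (d\<tau> x v) (dd\<tau> x u w))) (at x)"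
      by (rule has_derivative_linear_field[OF U(1) x tgt.h_linear(1)[OF \<tau>_into] 1 d\<tau>_has_derivative[OF x]])
    have "((\<lambda>y. h y v w) has_derivative
       (\<lambda>u. (tgt.dh (\<tau> x) (d\<tau> x u) (d\<tau> x v) (d\<tau> x w) + h' (\<tau> x) (dd\<tau> x u v) (d\<tau> x w)) + h' (\<tau> x) (d\<tau> x v) (dd\<tau> x u w))) (at x)"
      by (rule has_derivative_transform_within_open[OF 2 U(1) x]) (simp add: isometry)
    note D = frechet_derivative_at[OF this, symmetric]
    show "frechet_derivative (\<lambda>y. h y v w) (at x) u = h x (N (G u v)) w + h x v (N (G u w))"
      unfolding D isometry[OF x] N unfolding G_def tgt.metric_compatible[OF x']
      by (simp add: tgt.h_simps[OF x'])
  qed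
  from src.christoffel_eqI[OF in_S[OF x] this] show ?thesis
    by (simp add: N G_def)
qed

text \<open>Differentiate the transformation law of the Christoffel symbols and antisymmetrise; the third
  derivatives of \<open>\<tau>\<close> drop out.\<close>

lemma Riem_transform:
  assumes x: "x \<in> U"
  shows "d\<tau> x (src.Riem x u v w) = tgt.Riem (\<tau> x) (d\<tau> x u) (d\<tau> x v) (d\<tau> x w)"
proof -
  note x' = \<tau>_into[OF x]
  note lin = d\<tau>_linear[OF x]
  have eq: "dd\<tau> x u (src.\<Gamma> x v w) + d\<tau> x (src.d\<Gamma> x u v w) =
    tgt.d\<Gamma> (\<tau> x) (d\<tau> x u) (d\<tau> x v) (d\<tau> x w) + tgt.\<Gamma> (\<tau> x) (dd\<tau> x u v) (d\<tau> x w)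
      + tgt.\<Gamma> (\<tau> x) (d\<tau> x v) (dd\<tau> x u w) + ddd\<tau> x u v w" for u v
  proof -
    have L: "((\<lambda>y. d\<tau> y (src.\<Gamma> y v w)) has_derivative
       (\<lambda>u. dd\<tau> x u (src.\<Gamma> x v w) + d\<tau> x (src.d\<Gamma> x u v w))) (at x)"
      by (rule has_derivative_linear_field[OF U(1) x d\<tau>_linear d\<tau>_has_derivative[OF x] src.\<Gamma>_has_derivative[OF in_S[OF x]]])
    have 0: "((\<lambda>y. tgt.\<Gamma> (\<tau> y) a b) has_derivative (\<lambda>u. tgt.d\<Gamma> (\<tau> x) (d\<tau> x u) a b)) (at x)" for a b
      by (rule has_derivative_compose[OF \<tau>_has_derivative[OF x] tgt.\<Gamma>_has_derivative[OF x']])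
    have 1: "((\<lambda>y. tgt.\<Gamma> (\<tau> y) (d\<tau> y v) b) has_derivative
       (\<lambda>u. tgt.d\<Gamma> (\<tau> x) (d\<tau> x u) (d\<tau> x v) b + tgt.\<Gamma> (\<tau> x) (dd\<tau> x u v) b)) (at x)" for b
      by (rule has_derivative_linear_field[OF U(1) x tgt.\<Gamma>_linear(2)[OF \<tau>_into] 0 d\<tau>_has_derivative[OF x]])
    have 2: "((\<lambda>y. tgt.\<Gamma> (\<tau> y) (d\<tau> y v) (d\<tau> y w)) has_derivative
       (\<lambda>u. (tgt.d\<Gamma> (\<tau> x) (d\<tau> x u) (d\<tau> x v) (d\<tau> x w) + tgt.\<Gamma> (\<tau> x) (dd\<tau> x u v) (d\<tau> x w))
           + tgt.\<Gamma> (\<tau> x) (d\<tau> x v) (dd\<tau> x u w))) (at x)"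
      by (rule has_derivative_linear_field[OF U(1) x tgt.\<Gamma>_linear(1)[OF \<tau>_into] 1 d\<tau>_has_derivative[OF x]])
    have "((\<lambda>y. d\<tau> y (src.\<Gamma> y v w)) has_derivative (\<lambda>u. (tgt.d\<Gamma> (\<tau> x) (d\<tau> x u) (d\<tau> x v) (d\<tau> x w) + tgt.\<Gamma> (\<tau> x) (dd\<tau> x u v) (d\<tau> x w))
           + tgt.\<Gamma> (\<tau> x) (d\<tau> x v) (dd\<tau> x u w) + ddd\<tau> x u v w)) (at x)"
      by (rule has_derivative_transform_within_open[OF has_derivative_add[OF 2 dd\<tau>_has_derivative[OF x]] U(1) x])
         (simp add: christoffel_transform)
    from has_derivative_unique[OF L this] show ?thesis by metis
  qed
  have eq': "d\<tau> x (src.d\<Gamma> x u v w) =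
    tgt.d\<Gamma> (\<tau> x) (d\<tau> x u) (d\<tau> x v) (d\<tau> x w) + tgt.\<Gamma> (\<tau> x) (dd\<tau> x u v) (d\<tau> x w)
      + tgt.\<Gamma> (\<tau> x) (d\<tau> x v) (dd\<tau> x u w) + ddd\<tau> x u v w - dd\<tau> x u (src.\<Gamma> x v w)" for u v
    unfolding eq[symmetric] by simp
  show ?thesis
    unfolding src.Riem_def tgt.Riem_def linear_add[OF lin] linear_diff[OF lin] eq' christoffel_transform[OF x] tgt.\<Gamma>_simps[OF x']
    by (simp add: algebra_simps ddd\<tau>_sym[OF x, of u v w] dd\<tau>_sym[OF x, of u v])
qed

end

section \<open>The cone over a chart\<close>

definition cone_form :: "('a::euclidean_space \<Rightarrow> 'a \<Rightarrow> 'a \<Rightarrow> real) \<Rightarrow> real \<times> 'a \<Rightarrow> real \<times> 'a \<Rightarrow> real \<times> 'a \<Rightarrow> real" where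
  "cone_form g = (\<lambda>(r, x) (s, v) (t, w). s * t + r\<^sup>2 * g x v w)"

lemma cone_metric_eq_cone_form: "cone_metric g i = cone_form (g i)"
  unfolding cone_metric_def cone_form_def ..

lemma cone_form_apply: "cone_form g p a b = fst a * fst b + (fst p)\<^sup>2 * g (snd p) (snd a) (snd b)"
  unfolding cone_form_def by (simp add: case_prod_unfold)

locale cone_chart = base: metric_chart U g for U :: "'a::euclidean_space set" and g
begin

lemma metric_chart_cone: "metric_chart ({0<..} \<times> U) (cone_form g)"
proof
  show o: "open ({0::real<..} \<times> U)" by (intro open_Times open_greaterThan base.S)
  fix a b :: "real \<times> 'a"
  have f: "smooth_on ({0<..} \<times> U) (\<lambda>p. fst p :: real)"
    by (rule smooth_on_bounded_linear_id[OF o bounded_linear_fst])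
  show "smooth_on ({0<..} \<times> U) (\<lambda>p. cone_form g p a b)"
    unfolding cone_form_apply power2_eq_square
    by (intro smooth_on_add smooth_on_mult o f smooth_on_const smooth_on_compose_snd base.smooth_h base.S open_greaterThan)
next
  fix p :: "real \<times> 'a" assume p: "p \<in> {0<..} \<times> U"
  then have x: "snd p \<in> U" and r: "fst p > 0" by auto
  show "bilinear (cone_form g p)"
    unfolding bilinear_def cone_form_apply
    by (auto intro!: linearI simp: base.h_simps[OF x] algebra_simps)
  fix v w
  show "cone_form g p v w = cone_form g p w v"
    unfolding cone_form_apply by (simp add: base.sym[OF x, of "snd v"] mult.commute)
  assume 0: "\<And>w. cone_form g p v w = 0"
  have "fst v = 0" using 0[of "(1, 0)"] by (simp add: cone_form_apply base.h_simps[OF x])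
  moreover have "snd v = 0"
    by (rule base.nondeg[OF x]) (use 0[of "(0, _)"] r in \<open>simp add: cone_form_apply\<close>)
  ultimately show "v = 0" by (simp add: prod_eq_iff)
qed

sublocale cone: metric_chart "{0<..} \<times> U" "cone_form g"
  by (rule metric_chart_cone)

lemma cone_dh:
  assumes r: "r > 0" and x: "x \<in> U"
  shows "cone.dh (r, x) e a b = 2 * r * fst e * g x (snd a) (snd b) + r\<^sup>2 * base.dh x (snd e) (snd a) (snd b)"
proof -
  have G: "((\<lambda>p. g (snd p) (snd a) (snd b)) has_derivative (\<lambda>e. base.dh x (snd e) (snd a) (snd b))) (at (r, x))"
    by (rule has_derivative_compose[OF bounded_linear_imp_has_derivative[OF bounded_linear_snd]])
       (simp add: base.h_has_derivative[OF x])
  have F: "((\<lambda>p. (fst p)\<^sup>2) has_derivative (\<lambda>e. 2 * r * fst e)) (at (r, x))"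
    by (rule derivative_eq_intros refl)+ (simp add: fun_eq_iff)
  have "((\<lambda>p. cone_form g p a b) has_derivative
      (\<lambda>e. 0 + (r\<^sup>2 * base.dh x (snd e) (snd a) (snd b) + 2 * r * fst e * g x (snd a) (snd b)))) (at (r, x))"
    unfolding cone_form_apply
    using has_derivative_add[OF has_derivative_const has_derivative_mult[OF F G]] by simp
  from frechet_derivative_at[OF this, symmetric] show ?thesis
    unfolding cone.dh_def by simp
qed

lemma cone_christoffel:
  assumes r: "r > 0" and x: "x \<in> U"
  shows "cone.\<Gamma> (r, x) (s, v) (t, w) =
    (- r * g x v w, base.\<Gamma> x v w + (s / r) *\<^sub>R w + (t / r) *\<^sub>R v)"
proof -
  define G where "G a b = (- r * g x (snd a) (snd b),
     base.\<Gamma> x (snd a) (snd b) + (fst a / r) *\<^sub>R snd b + (fst b / r) *\<^sub>R snd a)" for a b :: "real \<times> 'a"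
  have "levi_civita_at (cone_form g) (r, x) G"
    unfolding levi_civita_at_def
  proof (intro conjI allI)
    show "bilinear G"
      unfolding bilinear_def G_def
      by (auto intro!: linearI simp: base.h_simps[OF x] base.\<Gamma>_simps[OF x] algebra_simps add_divide_distrib)
    show "G a b = G b a" for a b
      unfolding G_def by (simp add: base.sym[OF x, of "snd a"] base.\<Gamma>_sym[OF x, of "snd a"])
    show "frechet_derivative (\<lambda>y. cone_form g y a b) (at (r, x)) e
       = cone_form g (r, x) (G e a) b + cone_form g (r, x) a (G e b)" for e a b
      using cone_dh[OF r x, of e a b] r unfolding cone.dh_def
      by (simp add: cone_form_apply G_def base.h_simps[OF x] base.metric_compatible[OF x] base.sym[OF x, of "snd a" "snd e"]
          field_simps power2_eq_square)
  qed
  from cone.christoffel_eqI[OF _ this] have "cone.\<Gamma> (r, x) = G" using r x by simp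
  then show ?thesis by (simp add: G_def)
qed

text \<open>The radial field \<open>r \<partial>\<^sub>r\<close>.\<close>

definition euler :: "real \<times> 'a \<Rightarrow> real \<times> 'a" where "euler p = (fst p, 0)"

lemma position_field_euler: "cone.position_field (\<lambda>p a. a) euler"
  unfolding cone.position_field_def
proof (intro conjI ballI)
  have bl: "bounded_linear (euler :: real \<times> 'a \<Rightarrow> real \<times> 'a)"
    unfolding euler_def by (intro bounded_linear_Pair bounded_linear_fst bounded_linear_zero)
  show "smooth_on ({0<..} \<times> U) euler"
    by (rule smooth_on_bounded_linear_id[OF cone.S bl])
  fix p :: "real \<times> 'a" assume p: "p \<in> {0<..} \<times> U"
  obtain r x where p': "p = (r, x)" and r: "r > 0" and x: "x \<in> U" using p by auto
  have "cone.\<Gamma> p u (euler p) = u - euler u" for u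
    using r by (cases u) (simp add: p' cone_christoffel[OF r x] euler_def base.h_simps[OF x] base.\<Gamma>_simps[OF x])
  then show "(euler has_derivative (\<lambda>u. u - cone.\<Gamma> p u (euler p))) (at p)"
    using bounded_linear_imp_has_derivative[OF bl] by simp
qed

lemma cone_Riem_horizontal:
  assumes r: "r > 0" and x: "x \<in> U"
  shows "cone.Riem (r, x) (0, u) (0, v) (0, w) = (0, base.Riem x u v w - g x v w *\<^sub>R u + g x u w *\<^sub>R v)"
proof -
  have d: "cone.d\<Gamma> (r, x) (0, u) (0, v) (0, w) = (- r * base.dh x u v w, base.d\<Gamma> x u v w)" for u v w
  proof -
    have G: "((\<lambda>p. g (snd p) v w) has_derivative (\<lambda>e. base.dh x (snd e) v w)) (at (r, x))"
      and C: "((\<lambda>p. base.\<Gamma> (snd p) v w) has_derivative (\<lambda>e. base.d\<Gamma> x (snd e) v w)) (at (r, x))"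
      by (rule has_derivative_compose[OF bounded_linear_imp_has_derivative[OF bounded_linear_snd]];
          simp add: base.h_has_derivative[OF x] base.\<Gamma>_has_derivative[OF x])+
    have "((\<lambda>p. (- fst p * g (snd p) v w, base.\<Gamma> (snd p) v w)) has_derivative
        (\<lambda>e. (- r * base.dh x (snd e) v w + - fst e * g x v w, base.d\<Gamma> x (snd e) v w))) (at (r, x))"
      by (rule derivative_eq_intros G C refl)+ simp
    then have "((\<lambda>p. cone.\<Gamma> p (0, v) (0, w)) has_derivative
        (\<lambda>e. (- r * base.dh x (snd e) v w + - fst e * g x v w, base.d\<Gamma> x (snd e) v w))) (at (r, x))"
      by (rule has_derivative_transform_within_open[OF _ cone.S]) (use r x in \<open>auto simp: cone_christoffel\<close>)
    from frechet_derivative_at[OF this, symmetric] show ?thesis unfolding cone.d\<Gamma>_def by simp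
  qed
  show ?thesis
    unfolding cone.Riem_def d base.Riem_def cone_christoffel[OF r x]
    using r base.\<Gamma>_sym[OF x, of u v] base.sym[OF x, of v]
    by (simp add: base.metric_compatible[OF x] algebra_simps)
qed

text \<open>The radial field is annihilated in each of the three arguments, so only the components tangent to
  the base matter. The correction to the curvature of the base is the curvature tensor of a metric of constant
  curvature 1; and \<open>r\<close> does not occur on the right-hand side, so that it suffices to study the slice \<open>r = 1\<close>.\<close>

lemma cone_Riem:
  assumes r: "r > 0" and x: "x \<in> U"
  shows "cone.Riem (r, x) a b c =
    (0, base.Riem x (snd a) (snd b) (snd c) - g x (snd b) (snd c) *\<^sub>R snd a + g x (snd a) (snd c) *\<^sub>R snd b)"
proof -
  have p: "(r, x) \<in> {0<..} \<times> U" using r x by simp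
  have dec: "a = (fst a / r) *\<^sub>R euler (r, x) + (0, snd a)" for a
    using r by (simp add: euler_def prod_eq_iff)
  note z = cone.Riem_position_field_slot[OF cone.parallel_endo_id position_field_euler p]
    cone.Riem_position_field[OF cone.parallel_endo_id position_field_euler p]
  have "cone.Riem (r, x) a b c = cone.Riem (r, x) (0, snd a) (0, snd b) (0, snd c)"
    by (subst dec[of a], subst dec[of b], subst dec[of c]) (simp only: cone.Riem_simps[OF p] z, simp)
  then show ?thesis by (simp add: cone_Riem_horizontal[OF r x])
qed

end

section \<open>A parallel projection on the cone over a chart\<close>

lemma second_derivative_at_minimum_nonneg:
  fixes \<phi> \<psi> :: "real \<Rightarrow> real"
  assumes d: "d > 0" and \<phi>: "\<And>t. \<bar>t\<bar> < d \<Longrightarrow> (\<phi> has_real_derivative \<psi> t) (at t)"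
    and \<psi>: "(\<psi> has_real_derivative c) (at 0)" "\<psi> 0 = 0"
    and min: "\<And>t. \<bar>t\<bar> < d \<Longrightarrow> \<phi> 0 \<le> \<phi> t"
  shows "c \<ge> 0"
proof (rule ccontr)
  assume "\<not> c \<ge> 0"
  then obtain e where e: "e > 0" "\<And>t. 0 < t \<Longrightarrow> t < e \<Longrightarrow> \<psi> t < 0"
    using DERIV_neg_dec_right[OF \<psi>(1)] \<psi>(2) by auto
  define t where "t = min d e / 2"
  have t: "0 < t" "t < d" "t < e" using d e(1) by (auto simp: t_def)
  obtain s where s: "0 < s" "s < t" "\<phi> t - \<phi> 0 = (t - 0) * \<psi> s"
    using MVT2[OF t(1), of \<phi> \<psi>] \<phi> t by auto
  have "t * \<psi> s < 0" using e(2)[of s] s t by (simp add: mult_pos_neg)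
  then show False using s(3) min[of t] t by simp
qed

text \<open>The complement is the projection of a closed set along a compact factor.\<close>

lemma open_Collect_positive_on_sphere:
  fixes F :: "'a::euclidean_space \<Rightarrow> 'b::euclidean_space \<Rightarrow> real"
  assumes U: "open U" and F: "continuous_on (U \<times> UNIV) (\<lambda>(x, a). F x a)"
  shows "open {x \<in> U. \<forall>a\<in>sphere 0 1. F x a > 0}"
proof -
  have c: "continuous_on (sphere 0 1 \<times> U) (\<lambda>(a, x). F x a)"
  proof -
    have "continuous_on (sphere 0 1 \<times> U) (\<lambda>q. (snd q, fst q))"
      by (intro continuous_intros)
    from continuous_on_compose2[OF F this] show ?thesis by (force simp: case_prod_unfold)
  qed
  have "closedin (top_of_set (sphere 0 1 \<times> U)) (sphere 0 1 \<times> U \<inter> (\<lambda>(a, x). F x a) -` {..0})"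
    by (rule continuous_closedin_preimage[OF c closed_atMost])
  from closedin_compact_projection[OF compact_sphere this]
  have "closedin (top_of_set U) {x. \<exists>a. a \<in> sphere 0 1 \<and> (a, x) \<in> sphere 0 1 \<times> U \<inter> (\<lambda>(a, x). F x a) -` {..0}}" .
  then have "openin (top_of_set U) (U - {x. \<exists>a. a \<in> sphere 0 1 \<and> (a, x) \<in> sphere 0 1 \<times> U \<inter> (\<lambda>(a, x). F x a) -` {..0}})"
    by (simp add: closedin_def)
  moreover have "U - {x. \<exists>a. a \<in> sphere 0 1 \<and> (a, x) \<in> sphere 0 1 \<times> U \<inter> (\<lambda>(a, x). F x a) -` {..0}}
     = {x \<in> U. \<forall>a\<in>sphere 0 1. F x a > 0}"
    by (auto simp: not_le) (metis mem_sphere_0 not_le)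
  ultimately show ?thesis using U by (simp add: openin_open_eq)
qed

lemma semidefinite_null_vector:
  fixes b :: "'a::real_vector \<Rightarrow> 'a \<Rightarrow> real"
  assumes lin: "\<And>v. linear (b v)" "\<And>w. linear (\<lambda>v. b v w)" and sym: "\<And>v w. b v w = b w v"
    and nonneg: "\<And>v. b v v \<ge> 0" and null: "b v v = 0"
  shows "b v w = 0"
proof (rule ccontr)
  assume 0: "b v w \<noteq> 0"
  \<comment> \<open>at this \<open>t\<close> the form takes the value -1 on \<open>t v + w\<close>\<close>
  define t where "t = - (b w w + 1) / (2 * b v w)"
  have "b (t *\<^sub>R v + w) (t *\<^sub>R v + w) = 2 * t * b v w + b w w"
    using null sym[of w v]
    by (simp add: linear_add[OF lin(1)] linear_add[OF lin(2)] linear_scale[OF lin(1)] linear_scale[OF lin(2)])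
  also have "\<dots> = -1" using 0 unfolding t_def by (simp add: field_simps)
  finally show False using nonneg[of "t *\<^sub>R v + w"] by simp
qed

text \<open>An orthogonal splitting of the cone into two parallel subbundles, recorded by the projection onto one
  of them. By \<open>complement\<close> below, everything that is proved for \<open>P\<close> also holds for \<open>1 - P\<close>.\<close>

locale split_cone_chart = cone_chart U g for U :: "'a::euclidean_space set" and g +
  fixes P :: "real \<times> 'a \<Rightarrow> real \<times> 'a \<Rightarrow> real \<times> 'a"
  assumes parallel: "cone.parallel_endo P"
    and idem: "p \<in> {0<..} \<times> U \<Longrightarrow> P p (P p a) = P p a"
    and selfadj: "p \<in> {0<..} \<times> U \<Longrightarrow> cone_form g p (P p a) b = cone_form g p a (P p b)"
begin

abbreviation H where "H \<equiv> cone_form g"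

definition \<zeta> where "\<zeta> p = P p (euler p)"

text \<open>The squared length of the component of the radial unit vector in the image of \<open>P\<close>.\<close>

definition lam where "lam x = H (1, x) (\<zeta> (1, x)) (1, 0)"

lemma P_linear: "p \<in> {0<..} \<times> U \<Longrightarrow> linear (P p)"
  by (rule cone.parallel_endoD(1)[OF parallel])

lemmas P_simps = linear_add[OF P_linear] linear_diff[OF P_linear] linear_neg[OF P_linear]
  linear_0[OF P_linear] linear_scale[OF P_linear]

lemma complement: "split_cone_chart U g (\<lambda>p a. a - P p a)"
proof unfold_locales
  show "cone.parallel_endo (\<lambda>p a. a - P p a)"
    by (rule cone.parallel_endo_complement[OF parallel])
  show "a - P p a - P p (a - P p a) = a - P p a" if "p \<in> {0<..} \<times> U" for p a
    by (simp add: P_simps[OF that] idem[OF that])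
  show "H p (a - P p a) b = H p a (b - P p b)" if "p \<in> {0<..} \<times> U" for p a b
    by (simp add: cone.h_simps[OF that] selfadj[OF that])
qed

lemma slice: "x \<in> U \<Longrightarrow> (1 :: real, x) \<in> {0<..} \<times> U" by simp

lemma euler_slice: "euler (1, x) = (1, 0)" by (simp add: euler_def)

lemma \<zeta>_position: "cone.position_field P \<zeta>"
  unfolding \<zeta>_def by (rule cone.position_field_image[OF parallel position_field_euler])

lemma \<zeta>_has_derivative: "p \<in> {0<..} \<times> U \<Longrightarrow> (\<zeta> has_derivative (\<lambda>e. P p e - cone.\<Gamma> p e (\<zeta> p))) (at p)"
  by (rule cone.position_fieldD(2)[OF \<zeta>_position])

lemma P_\<zeta>: "p \<in> {0<..} \<times> U \<Longrightarrow> P p (\<zeta> p) = \<zeta> p"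
  unfolding \<zeta>_def by (rule idem)

lemma slice_has_derivative:
  "((\<lambda>x. (1, x)) has_derivative (\<lambda>v. (0, v))) (at (x :: 'a))"
  by (auto intro!: derivative_eq_intros)

lemma lam_eq: "lam x = H (1, x) (\<zeta> (1, x)) (euler (1, x))"
  unfolding lam_def euler_slice ..

lemma lam_eq_fst:
  assumes "x \<in> U"
  shows "lam x = fst (\<zeta> (1, x))"
  unfolding lam_def by (simp add: cone_form_apply base.h_simps[OF assms])

lemma norm_square_\<zeta>_has_derivative:
  assumes p: "p \<in> {0<..} \<times> U"
  shows "((\<lambda>p. H p (\<zeta> p) (euler p)) has_derivative (\<lambda>e. 2 * H p (\<zeta> p) e)) (at p)"
proof -
  have "H p (P p e) (euler p) = H p (\<zeta> p) e" for e
    using selfadj[OF p] cone.sym[OF p] unfolding \<zeta>_def by metis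
  then show ?thesis
    using cone.has_derivative_h_fields[OF p \<zeta>_has_derivative[OF p] cone.position_fieldD(2)[OF position_field_euler p]]
    by simp
qed

lemma lam_has_derivative:
  assumes x: "x \<in> U"
  shows "(lam has_derivative (\<lambda>v. 2 * H (1, x) (\<zeta> (1, x)) (0, v))) (at x)"
  using has_derivative_compose[OF slice_has_derivative norm_square_\<zeta>_has_derivative[OF slice[OF x]]]
  unfolding lam_eq[abs_def] .

lemma lam_complement: "x \<in> U \<Longrightarrow> split_cone_chart.lam g (\<lambda>p a. a - P p a) x = 1 - lam x"
  by (simp add: lam_eq_fst split_cone_chart.lam_eq_fst[OF complement] split_cone_chart.\<zeta>_def[OF complement] \<zeta>_def euler_slice)

text \<open>The tangent vectors \<open>(0, v)\<close> to the slice have the radial direction as their orthogonal complement, so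
  \<open>\<zeta>\<close> is radial. If \<open>\<zeta> = c \<xi>\<close>, then \<open>P \<zeta> = \<zeta>\<close> gives \<open>c\<^sup>2 = c\<close>.\<close>

lemma critical_point:
  assumes x: "x \<in> U" and crit: "\<And>v. H (1, x) (\<zeta> (1, x)) (0, v) = 0"
  shows "\<zeta> (1, x) = (lam x, 0)" "lam x = 0 \<or> lam x = 1"
proof -
  have "snd (\<zeta> (1, x)) = 0"
    by (rule base.nondeg[OF x]) (use crit in \<open>simp add: cone_form_apply\<close>)
  then show z: "\<zeta> (1, x) = (lam x, 0)"
    by (simp add: lam_eq_fst[OF x] prod_eq_iff)
  have "P (1, x) (lam x *\<^sub>R (1, 0)) = lam x *\<^sub>R (lam x, 0)"
    unfolding P_simps[OF slice[OF x]] using z unfolding \<zeta>_def euler_slice by simp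
  moreover have "P (1, x) (lam x, 0) = (lam x, 0)" using P_\<zeta>[OF slice[OF x]] z by simp
  ultimately have "lam x * lam x = lam x" by simp
  then show "lam x = 0 \<or> lam x = 1" by simp
qed

lemma minimum_critical:
  assumes x: "x \<in> U" and min: "\<And>y. y \<in> U \<Longrightarrow> lam x \<le> lam y"
  shows "H (1, x) (\<zeta> (1, x)) (0, v) = 0"
proof -
  have "(\<lambda>v. 2 * H (1, x) (\<zeta> (1, x)) (0, v)) = (\<lambda>v. 0)"
    by (rule differential_zero_maxmin[OF x base.S lam_has_derivative[OF x]]) (use min in blast)
  from fun_cong[OF this, of v] show ?thesis by simp
qed

lemma line_in_chart:
  assumes "x \<in> U"
  obtains d where "d > 0" "\<And>t. \<bar>t\<bar> < d \<Longrightarrow> x + t *\<^sub>R v \<in> U"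
proof -
  obtain e where e: "e > 0" "ball x e \<subseteq> U" using base.S assms openE by blast
  show thesis
  proof (rule that)
    show "e / (norm v + 1) > 0" using e by (simp add: add_nonneg_pos)
    fix t assume t: "\<bar>t\<bar> < e / (norm v + 1)"
    have "\<bar>t\<bar> * norm v \<le> \<bar>t\<bar> * (norm v + 1)" by (simp add: mult_left_mono)
    also have "\<dots> < e" using t by (simp add: pos_less_divide_eq add_nonneg_pos)
    finally show "x + t *\<^sub>R v \<in> U" using e by (auto simp: dist_norm subset_iff)
  qed
qed

lemma line_has_derivative: "((\<lambda>t. x + t *\<^sub>R v) has_derivative (\<lambda>t. t *\<^sub>R v)) (at (t::real))"
  by (auto intro!: derivative_eq_intros)

text \<open>As \<open>\<zeta>\<close> vanishes at the minimum, the second derivative of \<open>lam\<close> in the direction \<open>v\<close> is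
  \<open>2 H (\<nabla>\<^sub>v \<zeta>) v = 2 H (P v) v\<close>, without a contribution of the Christoffel symbols.\<close>

lemma minimum_zero_semidefinite:
  assumes x: "x \<in> U" and min: "\<And>y. y \<in> U \<Longrightarrow> lam x \<le> lam y" and lam0: "lam x = 0"
  shows "H (1, x) (P (1, x) a) a \<ge> 0"
proof -
  note p = slice[OF x]
  have \<zeta>0: "\<zeta> (1, x) = 0"
    using critical_point(1)[OF x minimum_critical[OF x min]] lam0 by (simp add: zero_prod_def)
  have V: "H (1, x) (P (1, x) (0, v)) (0, v) \<ge> 0" for v
  proof -
    obtain d where d: "d > 0" "\<And>t. \<bar>t\<bar> < d \<Longrightarrow> x + t *\<^sub>R v \<in> U"
      using line_in_chart[OF x, where v = v] by blast
    define \<psi> where "\<psi> t = 2 * H (1, x + t *\<^sub>R v) (\<zeta> (1, x + t *\<^sub>R v)) (0, v)" for t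
    have \<phi>: "((\<lambda>t. lam (x + t *\<^sub>R v)) has_real_derivative \<psi> t) (at t)" if "\<bar>t\<bar> < d" for t
    proof -
      note y = d(2)[OF that]
      have "((\<lambda>t. lam (x + t *\<^sub>R v)) has_derivative (\<lambda>s. 2 * H (1, x + t *\<^sub>R v) (\<zeta> (1, x + t *\<^sub>R v)) (0, s *\<^sub>R v))) (at t)"
        by (rule has_derivative_compose[OF line_has_derivative lam_has_derivative[OF y]])
      moreover have "2 * H (1, x + t *\<^sub>R v) (\<zeta> (1, x + t *\<^sub>R v)) (0, s *\<^sub>R v) = \<psi> t * s" for s
        using cone.h_simps(9)[OF slice[OF y], of _ s "(0, v)"] unfolding \<psi>_def by simp
      ultimately show ?thesis by (simp add: has_field_derivative_def)
    qed
    have "((\<lambda>p. H p (\<zeta> p) (0, v)) has_derivative (\<lambda>e. H (1, x) (P (1, x) e) (0, v))) (at (1, x))"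
      using cone.has_derivative_h_fields[OF p \<zeta>_has_derivative[OF p] has_derivative_const[of "(0, v)"]]
      by (simp add: \<zeta>0 cone.h_simps[OF p])
    then have D: "((\<lambda>p. 2 * H p (\<zeta> p) (0, v)) has_derivative (\<lambda>e. 2 * H (1, x) (P (1, x) e) (0, v))) (at (1, x + 0 *\<^sub>R v))"
      by (simp add: has_derivative_mult_right)
    have "((\<lambda>t. (1, x + t *\<^sub>R v)) has_derivative (\<lambda>t. (0, t *\<^sub>R v))) (at (0::real))"
      by (auto intro!: derivative_eq_intros)
    from has_derivative_compose[OF this D]
    have "(\<psi> has_derivative (\<lambda>s. 2 * H (1, x) (P (1, x) (0, s *\<^sub>R v)) (0, v))) (at 0)"
      unfolding \<psi>_def .
    moreover have "2 * H (1, x) (P (1, x) (0, s *\<^sub>R v)) (0, v) = 2 * H (1, x) (P (1, x) (0, v)) (0, v) * s" for s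
    proof -
      have "(0, s *\<^sub>R v) = s *\<^sub>R (0::real, v)" by simp
      then show ?thesis by (simp only: P_simps[OF p] cone.h_simps[OF p]) simp
    qed
    ultimately have "(\<psi> has_real_derivative 2 * H (1, x) (P (1, x) (0, v)) (0, v)) (at 0)"
      by (simp add: has_field_derivative_def)
    moreover have "\<psi> 0 = 0" by (simp add: \<psi>_def \<zeta>0 cone.h_simps[OF p])
    ultimately have "2 * H (1, x) (P (1, x) (0, v)) (0, v) \<ge> 0"
      using second_derivative_at_minimum_nonneg[OF d(1) \<phi>] min d(2) by simp
    then show ?thesis by simp
  qed
  obtain s v where a: "a = s *\<^sub>R (1, 0) + (0, v)" by (cases a) (auto intro: that)
  have P1: "P (1, x) (1, 0) = 0" using \<zeta>0 unfolding \<zeta>_def euler_slice .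
  then have Pa: "P (1, x) a = P (1, x) (0, v)" unfolding a P_simps[OF p] by simp
  have "H (1, x) (P (1, x) a) a = H (1, x) a (P (1, x) a)" by (rule selfadj[OF p])
  also have "\<dots> = H (1, x) (P (1, x) (0, v)) (0, v)"
    unfolding Pa unfolding a cone.h_simps[OF p] selfadj[OF p, of "(1, 0)", symmetric] P1
    using cone.sym[OF p] by (simp add: cone.h_simps[OF p])
  finally show ?thesis using V by simp
qed

text \<open>Differentiating \<open>\<zeta> = 0\<close> along the slice gives \<open>P (0, v) = 0\<close>, and \<open>\<zeta>\<close> itself is the value of \<open>P\<close> on the radial
  direction.\<close>

lemma \<zeta>_vanishes_locally:
  assumes V: "open V" "V \<subseteq> U" "x \<in> V" and z: "\<And>y. y \<in> V \<Longrightarrow> \<zeta> (1, y) = 0"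
  shows "P (1, x) a = 0"
proof -
  have x: "x \<in> U" using V by auto
  note p = slice[OF x]
  have "P (1, x) (0, v) = 0" for v
  proof -
    have 1: "((\<lambda>y. \<zeta> (1, y)) has_derivative (\<lambda>v. P (1, x) (0, v) - cone.\<Gamma> (1, x) (0, v) (\<zeta> (1, x)))) (at x)"
      by (rule has_derivative_compose[OF slice_has_derivative \<zeta>_has_derivative[OF p]])
    have "((\<lambda>y. \<zeta> (1, y)) has_derivative (\<lambda>v. 0)) (at x)"
      by (rule has_derivative_transform_within_open[OF _ V(1,3), of "\<lambda>y. 0"]) (simp_all add: z)
    from has_derivative_unique[OF 1 this] show ?thesis
      by (simp add: z[OF V(3)] cone.\<Gamma>_simps[OF p] fun_eq_iff)
  qed
  moreover have "P (1, x) (1, 0) = 0" using z[OF V(3)] unfolding \<zeta>_def euler_slice .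
  moreover have "a = fst a *\<^sub>R (1, 0) + (0, snd a)" by (simp add: prod_eq_iff)
  ultimately show ?thesis using P_simps[OF p] by (metis add.left_neutral scaleR_zero_right)
qed

lemma H_continuous:
  "continuous_on (({0<..} \<times> U) \<times> UNIV) (\<lambda>(p, v). H p v w)"
  by (rule continuous_on_linear_field[OF cone.h_linear(2) smooth_on_continuous[OF cone.smooth_h]])

lemma H_continuous2:
  "continuous_on ((({0<..} \<times> U) \<times> UNIV) \<times> UNIV) (\<lambda>(q, w). H (fst q) (snd q) w)"
  by (rule continuous_on_linear_field) (use cone.h_linear(1) H_continuous in \<open>auto simp: case_prod_unfold\<close>)

lemma P_continuous: "continuous_on (({0<..} \<times> U) \<times> UNIV) (\<lambda>(p, v). P p v)"
  by (rule continuous_on_linear_field[OF P_linear smooth_on_continuous[OF cone.parallel_endoD(2)[OF parallel]]])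

lemma continuous_on_H_compose:
  assumes "continuous_on A p" "continuous_on A v" "continuous_on A w" "\<And>z. z \<in> A \<Longrightarrow> p z \<in> {0<..} \<times> U"
  shows "continuous_on A (\<lambda>z. H (p z) (v z) (w z))"
proof -
  have "continuous_on A (\<lambda>z. ((p z, v z), w z))"
    by (intro continuous_on_Pair assms)
  moreover have "(\<lambda>z. ((p z, v z), w z)) ` A \<subseteq> (({0<..} \<times> U) \<times> UNIV) \<times> UNIV"
    by (rule image_subsetI) (use assms(4) in simp)
  ultimately show ?thesis using continuous_on_compose2[OF H_continuous2] by fastforce
qed

lemma continuous_on_P_compose:
  assumes "continuous_on A p" "continuous_on A v" "\<And>z. z \<in> A \<Longrightarrow> p z \<in> {0<..} \<times> U"
  shows "continuous_on A (\<lambda>z. P (p z) (v z))"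
proof -
  have "continuous_on A (\<lambda>z. (p z, v z))"
    by (intro continuous_on_Pair assms)
  moreover have "(\<lambda>z. (p z, v z)) ` A \<subseteq> ({0<..} \<times> U) \<times> UNIV"
    by (rule image_subsetI) (use assms(3) in simp)
  ultimately show ?thesis using continuous_on_compose2[OF P_continuous] by fastforce
qed

text \<open>Semidefiniteness is not an open condition in general. Here it is, because the form is nondegenerate on
  the image of \<open>P\<close>: it is equivalent to definiteness of the form \<open>B\<close> that is completed by the squared Euclidean
  norm of \<open>a - P a\<close>.\<close>

lemma open_semidefinite:
  "open {x \<in> U. \<forall>a. H (1, x) (P (1, x) a) a \<ge> 0}"
proof -
  define B where "B x a = H (1, x) (P (1, x) a) a + (norm (a - P (1, x) a))\<^sup>2" for x a
  have "continuous_on (U \<times> UNIV) (\<lambda>z. B (fst z) (snd z))"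
    unfolding B_def
    by (intro continuous_intros continuous_on_H_compose continuous_on_P_compose) auto
  then have "open {x \<in> U. \<forall>a\<in>sphere 0 1. B x a > 0}"
    using open_Collect_positive_on_sphere[OF base.S, of B] by (simp add: case_prod_unfold)
  moreover have "(\<forall>a. H (1, x) (P (1, x) a) a \<ge> 0) \<longleftrightarrow> (\<forall>a\<in>sphere 0 1. B x a > 0)" if x: "x \<in> U" for x
  proof
    note p = slice[OF x]
    assume nn: "\<forall>a. H (1, x) (P (1, x) a) a \<ge> 0"
    show "\<forall>a\<in>sphere 0 1. B x a > 0"
    proof
      fix a :: "real \<times> 'a" assume a: "a \<in> sphere 0 1"
      show "B x a > 0"
      proof (rule ccontr)
        assume "\<not> B x a > 0"
        moreover have "H (1, x) (P (1, x) a) a \<ge> 0" using nn by blast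
        ultimately have "(norm (a - P (1, x) a))\<^sup>2 \<le> 0" and n0: "H (1, x) (P (1, x) a) a = 0"
          unfolding B_def using zero_le_power2[of "norm (a - P (1, x) a)"] by linarith+
        then have Pa: "P (1, x) a = a" by simp
        have "H (1, x) (P (1, x) a) w = 0" for w
          by (rule semidefinite_null_vector[where b = "\<lambda>a b. H (1, x) (P (1, x) a) b", OF _ _ _ _ n0])
             (use nn selfadj[OF p] cone.sym[OF p] cone.h_linear[OF p] linear_compose[OF P_linear[OF p] cone.h_linear(2)[OF p]]
               in \<open>auto simp: comp_def\<close>)
        then have "P (1, x) a = 0" by (rule cone.nondeg[OF p])
        then show False using Pa a by simp
      qed
    qed
  next
    note p = slice[OF x]
    assume pos: "\<forall>a\<in>sphere 0 1. B x a > 0"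
    show "\<forall>a. H (1, x) (P (1, x) a) a \<ge> 0"
    proof
      fix a
      define b where "b = P (1, x) a"
      have Pb: "P (1, x) b = b" unfolding b_def by (rule idem[OF p])
      have eq: "H (1, x) (P (1, x) a) a = H (1, x) b b"
        unfolding b_def using selfadj[OF p] idem[OF p] cone.sym[OF p] by metis
      show "H (1, x) (P (1, x) a) a \<ge> 0"
      proof (cases "b = 0")
        case True then show ?thesis unfolding eq by (simp add: cone.h_simps[OF p])
      next
        case False
        then have "B x ((1 / norm b) *\<^sub>R b) > 0" using pos by simp
        then have "(1 / norm b) * ((1 / norm b) * H (1, x) b b) > 0"
          unfolding B_def by (simp add: P_simps[OF p] Pb cone.h_simps[OF p])
        then show ?thesis unfolding eq using False
          by (metis less_eq_real_def mult_nonneg_nonpos not_le_imp_less zero_le_divide_1_iff norm_ge_zero order.asym)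
      qed
    qed
  qed
  ultimately show ?thesis by (simp cong: conj_cong)
qed

lemma open_not_semidefinite:
  "open {x \<in> U. \<not> (\<forall>a. H (1, x) (P (1, x) a) a \<ge> 0)}"
proof -
  have "open {x \<in> U. H (1, x) (P (1, x) a) a < 0}" for a
  proof -
    have "continuous_on U (\<lambda>x. H (1, x) (P (1, x) a) a)"
      by (intro continuous_on_H_compose continuous_on_P_compose continuous_intros) auto
    from continuous_open_preimage[OF this base.S, of "{..<0}"] show ?thesis
      by (simp add: vimage_def Int_def)
  qed
  then have "open (\<Union>a. {x \<in> U. H (1, x) (P (1, x) a) a < 0})" by blast
  moreover have "(\<Union>a. {x \<in> U. H (1, x) (P (1, x) a) a < 0}) = {x \<in> U. \<not> (\<forall>a. H (1, x) (P (1, x) a) a \<ge> 0)}"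
    by (auto simp: not_le)
  ultimately show ?thesis by simp
qed

end

section \<open>A maximum principle for the curvature of a split cone\<close>

context metric_chart
begin

lemma continuous_on_Riem_compose:
  assumes "continuous_on A p" "continuous_on A u" "continuous_on A v" "continuous_on A w" "\<And>z. z \<in> A \<Longrightarrow> p z \<in> S"
  shows "continuous_on A (\<lambda>z. Riem (p z) (u z) (v z) (w z))"
proof -
  have 1: "continuous_on (S \<times> UNIV) (\<lambda>(p, u). Riem p u v w)" for v w
    by (rule continuous_on_linear_field[OF Riem_linear(3) smooth_on_continuous[OF smooth_Riem]])
  have 2: "continuous_on ((S \<times> UNIV) \<times> UNIV) (\<lambda>(q, v). Riem (fst q) (snd q) v w)" for w
    by (rule continuous_on_linear_field) (use 1 Riem_linear(2) in \<open>auto simp: case_prod_unfold\<close>)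
  have 3: "continuous_on (((S \<times> UNIV) \<times> UNIV) \<times> UNIV) (\<lambda>(q, w). Riem (fst (fst q)) (snd (fst q)) (snd q) w)"
    by (rule continuous_on_linear_field) (use 2 Riem_linear(1) in \<open>auto simp: case_prod_unfold\<close>)
  have "continuous_on A (\<lambda>z. (((p z, u z), v z), w z))"
    by (intro continuous_on_Pair assms)
  moreover have "(\<lambda>z. (((p z, u z), v z), w z)) ` A \<subseteq> ((S \<times> UNIV) \<times> UNIV) \<times> UNIV"
    by (rule image_subsetI) (use assms(5) in simp)
  ultimately show ?thesis using continuous_on_compose2[OF 3] by fastforce
qed

end

context split_cone_chart
begin

definition T where "T x u v w z = H (1, x) (cone.Riem (1, x) (P (1, x) u) (P (1, x) v) w) z"

lemma continuous_on_T_compose: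
  assumes "continuous_on A x" "continuous_on A u" "continuous_on A v" "continuous_on A w" "continuous_on A z"
    "\<And>q. q \<in> A \<Longrightarrow> x q \<in> U"
  shows "continuous_on A (\<lambda>q. T (x q) (u q) (v q) (w q) (z q))"
  unfolding T_def
  by (intro continuous_on_H_compose continuous_on_P_compose cone.continuous_on_Riem_compose continuous_on_Pair continuous_on_const assms)
     (use assms(6) in simp_all)

text \<open>The direction of differentiation is \<open>Q \<xi> - (1 - lam) \<xi>\<close> with \<open>Q = 1 - P\<close>. It is tangent to the slice. By
  \<open>nRiem_position_field\<close> the block is parallel along \<open>Q \<xi>\<close>, as \<open>Q P = 0\<close>, and is multiplied by -2 along \<open>\<xi>\<close>.\<close>

lemma nRiem_tangential:
  assumes x: "x \<in> U"
  shows "cone.nRiem (1, x) (0, - snd (\<zeta> (1, x))) (P (1, x) u) (P (1, x) v) w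
       = (2 * (1 - lam x)) *\<^sub>R cone.Riem (1, x) (P (1, x) u) (P (1, x) v) w"
proof -
  note p = slice[OF x]
  interpret comp: split_cone_chart U g "\<lambda>p a. a - P p a" by (rule complement)
  have c\<zeta>: "comp.\<zeta> p = euler p - \<zeta> p" for p
    unfolding comp.\<zeta>_def \<zeta>_def ..
  have X: "(0, - snd (\<zeta> (1, x))) = comp.\<zeta> (1, x) - (1 - lam x) *\<^sub>R euler (1, x)"
    unfolding c\<zeta> by (simp add: euler_slice lam_eq_fst[OF x] prod_eq_iff)
  have twice: "- R - R = (- 2) *\<^sub>R R" for R :: "real \<times> 'a"
    using scaleR_2[of R] by simp
  show ?thesis
    unfolding X linear_diff[OF cone.nRiem_linear1[OF p]] linear_scale[OF cone.nRiem_linear1[OF p]]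
      cone.nRiem_position_field[OF comp.parallel comp.\<zeta>_position p]
      cone.nRiem_position_field[OF cone.parallel_endo_id position_field_euler p] idem[OF p] twice
    by (simp add: cone.Riem_simps[OF p])
qed

text \<open>At a maximum the derivative in the direction of \<open>nRiem_tangential\<close> vanishes, while it equals \<open>2 K\<close>: the
  curvature block contributes \<open>2 (1 - lam) K\<close> and the factor \<open>1 - lam\<close> contributes \<open>2 lam K\<close>. The bound is assumed for
  vectors of arbitrary length, since the extensions of \<open>u\<close>, \<open>v\<close>, \<open>w\<close>, \<open>z\<close> have unit length to first order only.\<close>

lemma maximum_principle:
  assumes x: "x \<in> U"
    and unit: "H (1, x) u u = 1" "H (1, x) v v = 1" "H (1, x) w w = 1" "H (1, x) z z = 1"
    and K: "(1 - lam x) * T x u v w z = K"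
    and max: "\<And>y u v w z. y \<in> U \<Longrightarrow> (1 - lam y) * T y u v w z
       \<le> K * sqrt (H (1, y) u u * H (1, y) v v * H (1, y) w w * H (1, y) z z)"
  shows "K = 0"
proof -
  note p = slice[OF x]
  \<comment> \<open>extensions of constant vectors that are parallel at \<open>(1, x)\<close>\<close>
  define par where "par a q = a - cone.\<Gamma> (1, x) (q - (1, x)) a" for a q
  have par0: "par a (1, x) = a" for a
    unfolding par_def by (simp add: cone.\<Gamma>_simps[OF p])
  have parD: "(par a has_derivative (\<lambda>e. - cone.\<Gamma> (1, x) e (par a (1, x)))) (at (1, x))" for a
  proof -
    have bl: "bounded_linear (\<lambda>e. cone.\<Gamma> (1, x) e a)"
      using cone.\<Gamma>_linear(2)[OF p] linear_conv_bounded_linear by blast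
    have "((\<lambda>q. q - (1, x)) has_derivative (\<lambda>e. e - 0)) (at (1, x))"
      by (intro has_derivative_diff has_derivative_ident has_derivative_const)
    from has_derivative_diff[OF has_derivative_const bounded_linear.has_derivative[OF bl this], of a]
    show ?thesis unfolding par0 unfolding par_def[abs_def] by simp
  qed
  have n1: "((\<lambda>q. H q (par a q) (par a q)) has_derivative (\<lambda>e. 0)) (at (1, x))" for a
    using cone.has_derivative_h_fields[OF p parD[of a] parD[of a]] by (simp add: cone.h_simps[OF p])
  define N where "N q = H q (par u q) (par u q) * H q (par v q) (par v q) * H q (par w q) (par w q) * H q (par z q) (par z q)" for q
  have N0: "N (1, x) = 1" unfolding N_def par0 unit by simp
  have ND: "(N has_derivative (\<lambda>e. 0)) (at (1, x))"
    unfolding N_def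
    by (rule has_derivative_eq_rhs, (rule has_derivative_mult n1)+) simp
  have "0 < N (1, x)" unfolding N0 by simp
  from DERIV_compose_FDERIV[where f = sqrt and g = N, OF DERIV_real_sqrt[OF this] ND]
  have sN: "((\<lambda>q. sqrt (N q)) has_derivative (\<lambda>e. 0)) (at (1, x))" by simp
  have PD: "((\<lambda>q. P q (par a q)) has_derivative (\<lambda>e. - cone.\<Gamma> (1, x) e (P (1, x) (par a (1, x))))) (at (1, x))" for a
    using has_derivative_eq_rhs[OF cone.has_derivative_parallel_endo_field[OF parallel p parD[of a]]]
    by (simp add: P_simps[OF p] fun_eq_iff)
  define TT where "TT q = H q (cone.Riem q (P q (par u q)) (P q (par v q)) (par w q)) (par z q)" for q
  have TT0: "TT (1, x) = T x u v w z" unfolding TT_def T_def par0 ..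
  have TTD: "(TT has_derivative (\<lambda>e. H (1, x) (cone.nRiem (1, x) e (P (1, x) u) (P (1, x) v) w) z)) (at (1, x))"
    using cone.has_derivative_h_fields[OF p cone.has_derivative_Riem_parallel_fields[OF p PD[of u] PD[of v] parD[of w]] parD[of z]]
    unfolding TT_def par0 by (simp add: cone.h_simps[OF p])
  define F where "F q = H q (\<zeta> q) (euler q)" for q
  have F0: "F (1, y) = lam y" for y unfolding F_def lam_eq ..
  have FD: "(F has_derivative (\<lambda>e. 2 * H (1, x) (\<zeta> (1, x)) e)) (at (1, x))"
    unfolding F_def by (rule norm_square_\<zeta>_has_derivative[OF p])
  define \<Phi> where "\<Phi> q = K * sqrt (N q) - (1 - F q) * TT q" for q
  define X where "X = (0 :: real, - snd (\<zeta> (1, x)))"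
  have \<Phi>D: "(\<Phi> has_derivative (\<lambda>e. 2 * H (1, x) (\<zeta> (1, x)) e * T x u v w z
      - (1 - lam x) * H (1, x) (cone.nRiem (1, x) e (P (1, x) u) (P (1, x) v) w) z)) (at (1, x))"
    unfolding \<Phi>_def
    by (rule has_derivative_eq_rhs, (rule has_derivative_diff has_derivative_mult has_derivative_const sN FD TTD)+)
       (simp add: TT0 F0 fun_eq_iff)
  define c where "c = 2 * H (1, x) (\<zeta> (1, x)) X * T x u v w z
      - (1 - lam x) * H (1, x) (cone.nRiem (1, x) X (P (1, x) u) (P (1, x) v) w) z"
  have \<Phi>D': "((\<lambda>t. \<Phi> (1, x + t *\<^sub>R (- snd (\<zeta> (1, x))))) has_real_derivative c) (at 0)"
  proof -
    have l: "((\<lambda>t. (1, x + t *\<^sub>R (- snd (\<zeta> (1, x))))) has_derivative (\<lambda>t. t *\<^sub>R X)) (at (0::real))"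
      unfolding X_def by (auto intro!: derivative_eq_intros)
    have D: "(\<Phi> has_derivative (\<lambda>e. 2 * H (1, x) (\<zeta> (1, x)) e * T x u v w z
      - (1 - lam x) * H (1, x) (cone.nRiem (1, x) e (P (1, x) u) (P (1, x) v) w) z)) (at (1, x + 0 *\<^sub>R (- snd (\<zeta> (1, x)))))"
      using \<Phi>D by simp
    have "((\<lambda>t. \<Phi> (1, x + t *\<^sub>R (- snd (\<zeta> (1, x))))) has_derivative (\<lambda>t. c * t)) (at 0)"
      by (rule has_derivative_eq_rhs[OF has_derivative_compose[OF l D]])
         (simp add: c_def fun_eq_iff cone.h_simps[OF p] linear_scale[OF cone.nRiem_linear1[OF p]] algebra_simps)
    then show ?thesis by (simp add: has_field_derivative_def)
  qed
  obtain d where d: "d > 0" "\<And>t. \<bar>t\<bar> < d \<Longrightarrow> x + t *\<^sub>R (- snd (\<zeta> (1, x))) \<in> U"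
    using line_in_chart[OF x, where v = "- snd (\<zeta> (1, x))"] by blast
  have \<Phi>0: "\<Phi> (1, x) = 0" unfolding \<Phi>_def N0 F0 TT0 K by simp
  have "\<Phi> (1, y) \<ge> 0" if "y \<in> U" for y
    using max[OF that, of "par u (1, y)" "par v (1, y)" "par w (1, y)" "par z (1, y)"]
    unfolding \<Phi>_def N_def TT_def F0 T_def by simp
  then have "c = 0"
    using DERIV_local_min[OF \<Phi>D' d(1)] d(2) \<Phi>0 by simp
  moreover have "H (1, x) (\<zeta> (1, x)) X = - (1 - lam x) * lam x"
  proof -
    have X: "X = (euler (1, x) - \<zeta> (1, x)) - (1 - lam x) *\<^sub>R euler (1, x)"
      unfolding X_def by (simp add: euler_slice lam_eq_fst[OF x] prod_eq_iff)
    have "H (1, x) (\<zeta> (1, x)) (\<zeta> (1, x)) = H (1, x) (\<zeta> (1, x)) (euler (1, x))"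
      using selfadj[OF p] P_\<zeta>[OF p] unfolding \<zeta>_def by metis
    then show ?thesis unfolding X cone.h_simps[OF p] lam_eq[symmetric] by (simp add: algebra_simps)
  qed
  moreover have "H (1, x) (cone.nRiem (1, x) X (P (1, x) u) (P (1, x) v) w) z = 2 * (1 - lam x) * T x u v w z"
    unfolding X_def nRiem_tangential[OF x] cone.h_simps[OF p] T_def by simp
  ultimately have "(1 - lam x) * T x u v w z * (2 * lam x + 2 * (1 - lam x)) = 0"
    unfolding c_def by (simp add: algebra_simps)
  then show ?thesis unfolding K by simp
qed

text \<open>The points with \<open>lam = 1\<close> have no interior: for a definite metric, \<open>lam = 1\<close> means that \<open>\<xi> - P \<xi> = 0\<close>, and
  if this holds on an open set, then \<open>P = 1\<close> there by \<open>\<zeta>_vanishes_locally\<close> for \<open>1 - P\<close>.\<close>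

lemma T_zero_of_generic:
  assumes pos: "\<And>y a. y \<in> U \<Longrightarrow> a \<noteq> 0 \<Longrightarrow> H (1, y) a a > 0"
    and generic: "\<And>y u v w z. y \<in> U \<Longrightarrow> lam y \<noteq> 1 \<Longrightarrow> T y u v w z = 0"
    and x: "x \<in> U" and nontriv: "P (1, x) a \<noteq> a"
  shows "T x u v w z = 0"
proof (rule ccontr)
  assume nz: "T x u v w z \<noteq> 0"
  interpret comp: split_cone_chart U g "\<lambda>p a. a - P p a" by (rule complement)
  define V where "V = {y \<in> U. T y u v w z \<noteq> 0}"
  have "continuous_on U (\<lambda>y. T y u v w z)"
    by (intro continuous_on_T_compose continuous_intros) auto
  from continuous_open_preimage[OF this base.S, of "- {0}"] have V: "open V"
    by (simp add: V_def vimage_def Int_def open_Compl)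
  have "comp.\<zeta> (1, y) = 0" if y: "y \<in> V" for y
  proof (rule ccontr)
    assume nz: "comp.\<zeta> (1, y) \<noteq> 0"
    have yU: "y \<in> U" using y by (simp add: V_def)
    have "lam y = 1" using generic[OF yU, of u v w z] y by (auto simp: V_def)
    then have "H (1, y) (comp.\<zeta> (1, y)) (euler (1, y)) = 0"
      using lam_complement[OF yU] unfolding comp.lam_eq by simp
    moreover have "H (1, y) (comp.\<zeta> (1, y)) (comp.\<zeta> (1, y)) = H (1, y) (comp.\<zeta> (1, y)) (euler (1, y))"
      using comp.selfadj[OF slice[OF yU], of "comp.\<zeta> (1, y)" "euler (1, y)"] comp.P_\<zeta>[OF slice[OF yU]]
      unfolding comp.\<zeta>_def by simp
    ultimately show False using pos[OF yU nz] by simp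
  qed
  from comp.\<zeta>_vanishes_locally[OF V _ _ this, of x a] nontriv x nz show False
    by (auto simp: V_def)
qed

text \<open>The mixed blocks vanish for every parallel splitting: by pair symmetry
  \<open>H (R(P u, v - P v) w) z = H (R(w, z) P u) (v - P v)\<close>, and \<open>R(w, z)\<close> preserves the image of \<open>P\<close>.\<close>

lemma Riem_zero_of_blocks:
  assumes x: "x \<in> U"
    and TP: "\<And>u v w z. T x u v w z = 0"
    and TQ: "\<And>u v w z. split_cone_chart.T g (\<lambda>p a. a - P p a) x u v w z = 0"
  shows "cone.Riem (1, x) u v w = 0"
proof -
  note p = slice[OF x]
  interpret comp: split_cone_chart U g "\<lambda>p a. a - P p a" by (rule complement)
  have PP: "cone.Riem (1, x) (P (1, x) u) (P (1, x) v) w = 0" for u v w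
    by (rule cone.nondeg[OF p]) (use TP in \<open>simp add: T_def\<close>)
  have QQ: "cone.Riem (1, x) (u - P (1, x) u) (v - P (1, x) v) w = 0" for u v w
    by (rule cone.nondeg[OF p]) (use TQ in \<open>simp add: comp.T_def\<close>)
  have PQ: "cone.Riem (1, x) (P (1, x) u) (v - P (1, x) v) w = 0" for u v w
  proof (rule cone.nondeg[OF p])
    fix z
    have "H (1, x) (cone.Riem (1, x) (P (1, x) u) (v - P (1, x) v) w) z
        = H (1, x) (cone.Riem (1, x) w z (P (1, x) u)) (v - P (1, x) v)"
      by (rule cone.Riem_pair_sym[OF p])
    also have "\<dots> = H (1, x) (P (1, x) (cone.Riem (1, x) w z u)) (v - P (1, x) v)"
      by (simp add: cone.Riem_commutes_parallel_endo[OF parallel p])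
    also have "\<dots> = 0"
      by (simp add: selfadj[OF p] P_simps[OF p] idem[OF p] cone.h_simps[OF p])
    finally show "H (1, x) (cone.Riem (1, x) (P (1, x) u) (v - P (1, x) v) w) z = 0" .
  qed
  have QP: "cone.Riem (1, x) (u - P (1, x) u) (P (1, x) v) w = 0" for u v w
    by (subst cone.Riem_antisym) (simp add: PQ)
  have "cone.Riem (1, x) u v w = cone.Riem (1, x) (P (1, x) u + (u - P (1, x) u)) (P (1, x) v + (v - P (1, x) v)) w"
    by simp
  also have "\<dots> = 0"
    unfolding cone.Riem_simps(2,3)[OF p] PP PQ QP QQ by simp
  finally show ?thesis .
qed

end

section \<open>From a nondegenerate parallel distribution to a parallel projection\<close>

definition orth_proj :: "('a::real_vector \<Rightarrow> 'a \<Rightarrow> real) \<Rightarrow> 'a set \<Rightarrow> 'a \<Rightarrow> 'a" where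
  "orth_proj B V w = (THE p. p \<in> V \<and> (\<forall>d\<in>V. B (w - p) d = 0))"

lemma orth_proj_eqI:
  assumes lin: "\<And>d. linear (\<lambda>v. B v d)" and V: "subspace V"
    and nd: "\<And>v. v \<in> V \<Longrightarrow> (\<And>d. d \<in> V \<Longrightarrow> B v d = 0) \<Longrightarrow> v = 0"
    and p: "p \<in> V" "\<And>d. d \<in> V \<Longrightarrow> B (w - p) d = 0"
  shows "orth_proj B V w = p"
  unfolding orth_proj_def
proof (rule the_equality)
  show "p \<in> V \<and> (\<forall>d\<in>V. B (w - p) d = 0)" using p by blast
  fix q assume q: "q \<in> V \<and> (\<forall>d\<in>V. B (w - q) d = 0)"
  have "q - p = 0"
  proof (rule nd)
    show "q - p \<in> V" using q p V by (simp add: subspace_diff)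
    fix d assume "d \<in> V"
    then have "B (w - p) d - B (w - q) d = 0" using p q by simp
    then show "B (q - p) d = 0" by (simp add: linear_diff[OF lin])
  qed
  then show "q = p" by simp
qed

lemma span_finite_indexed:
  fixes f :: "nat \<Rightarrow> 'a::real_vector"
  assumes "d \<in> span (f ` {..<k})"
  obtains c where "d = (\<Sum>a<k. c a *\<^sub>R f a)"
  using assms
proof (induction d arbitrary: thesis rule: span_induct_alt)
  case base
  show ?case by (rule base[of "\<lambda>_. 0"]) simp
next
  case (step c x y)
  from step(1) obtain a where a: "a < k" "x = f a" by auto
  obtain c' where c': "y = (\<Sum>a<k. c' a *\<^sub>R f a)" using step(2) by blast
  have "c *\<^sub>R x + y = (\<Sum>b<k. ((if b = a then c else 0) + c' b) *\<^sub>R f b)"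
    using a unfolding c' scaleR_add_left sum.distrib by (simp add: if_distrib[of "\<lambda>c. c *\<^sub>R _"] cong: if_cong)
  then show ?case by (rule step(3))
qed

lemma independent_indexedD:
  fixes f :: "nat \<Rightarrow> 'a::real_vector"
  assumes inj: "inj_on f {..<k}" and ind: "independent (f ` {..<k})"
    and 0: "(\<Sum>a<k. c a *\<^sub>R f a) = 0" and b: "b < k"
  shows "c b = 0"
proof -
  define u where "u v = c (inv_into {..<k} f v)" for v
  have u: "u (f a) = c a" if "a < k" for a
    unfolding u_def using that inj by (simp add: inv_into_f_f)
  have "(\<Sum>v\<in>f ` {..<k}. u v *\<^sub>R v) = (\<Sum>a<k. u (f a) *\<^sub>R f a)"
    by (simp add: sum.reindex[OF inj])
  also have "\<dots> = 0" using 0 u by simp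
  finally have "u (f b) = 0"
    using independentD[OF ind finite_imageI[OF finite_lessThan] subset_refl] b by blast
  then show ?thesis using u b by simp
qed

context metric_chart
begin

text \<open>The coefficients of the projection in the frame solve a linear system whose matrix is the Gram matrix
  of the frame, and this matrix is invertible since the metric is nondegenerate on the span.\<close>

lemma smooth_orthogonal_projection:
  fixes k :: nat and E :: "nat \<Rightarrow> 'a \<Rightarrow> 'a"
  assumes W: "open W" "W \<subseteq> S" "x0 \<in> W" and E: "\<And>a. a < k \<Longrightarrow> smooth_on W (E a)"
    and frame: "\<And>y. y \<in> W \<Longrightarrow> inj_on (\<lambda>a. E a y) {..<k}" "\<And>y. y \<in> W \<Longrightarrow> independent ((\<lambda>a. E a y) ` {..<k})"
    and nd: "\<And>y. y \<in> W \<Longrightarrow> \<forall>v\<in>span ((\<lambda>a. E a y) ` {..<k}).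
       (\<forall>d\<in>span ((\<lambda>a. E a y) ` {..<k}). h y v d = 0) \<longrightarrow> v = 0"
  shows "\<exists>p. smooth_on W p \<and> (\<forall>y\<in>W. p y \<in> span ((\<lambda>a. E a y) ` {..<k}) \<and>
    (\<forall>d\<in>span ((\<lambda>a. E a y) ` {..<k}). h y (w - p y) d = 0))"
proof -
  have "card ((\<lambda>a. E a x0) ` {..<k}) = k"
    using card_image[OF frame(1)[OF W(3)]] by simp
  then have "k \<le> DIM('a)" using independent_bound[OF frame(2)[OF W(3)]] by simp
  then obtain e :: "nat \<Rightarrow> 'a" where e: "e ` {..<k} \<subseteq> Basis" "inj_on e {..<k}"
    using card_le_inj[of "{..<k}" "Basis :: 'a set"] by auto
  have eB: "e a \<in> Basis" if "a < k" for a using e(1) that by auto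
  have ee: "e a \<bullet> e b = (if a = b then 1 else 0)" if "a < k" "b < k" for a b
    using that eB e(2) by (auto simp: inner_Basis inj_on_def)
  \<comment> \<open>to obtain an endomorphism of the whole space, the indices are embedded into the standard basis by \<open>e\<close>, and the Gram matrix is completed by the identity on the remaining basis vectors\<close>
  define G where "G y a b = h y (E b y) (E a y)" for y a b
  define C where "C = Basis - e ` {..<k}"
  define L where "L y v = (\<Sum>a<k. (\<Sum>b<k. (v \<bullet> e b) * G y a b) *\<^sub>R e a) + (\<Sum>c\<in>C. (v \<bullet> c) *\<^sub>R c)" for y v
  define r where "r y = (\<Sum>a<k. h y w (E a y) *\<^sub>R e a)" for y
  have SW: "y \<in> W \<Longrightarrow> y \<in> S" for y using W by auto
  have finC: "finite C" unfolding C_def by simp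
  have Ce: "c \<bullet> e a = 0" if "c \<in> C" "a < k" for c a
    using that eB[of a] by (auto simp: C_def inner_Basis)
  have inner_e: "L y v \<bullet> e a = (\<Sum>b<k. (v \<bullet> e b) * G y a b)" if "a < k" for y v a
    unfolding L_def using that
    by (simp add: inner_sum_left inner_add_left ee Ce if_distrib[of "\<lambda>x. _ * x"] cong: if_cong)
  have inner_c: "L y v \<bullet> c = v \<bullet> c" if "c \<in> C" for y v c
  proof -
    have "(\<Sum>d\<in>C. (v \<bullet> d) * (d \<bullet> c)) = (\<Sum>d\<in>C. if d = c then v \<bullet> c else 0)"
      using that by (intro sum.cong) (auto simp: C_def inner_Basis)
    then show ?thesis
      unfolding L_def using that Ce[OF that] finC
      by (simp add: inner_sum_left inner_add_left inner_commute[of "e _" c])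
  qed
  have inner_r: "r y \<bullet> e a = h y w (E a y)" if "a < k" for y a
    unfolding r_def using that
    by (simp add: inner_sum_left ee if_distrib[of "\<lambda>x. _ * x"] cong: if_cong)
  have linL: "linear (L y)" for y
    unfolding L_def
    by (rule linearI) (simp_all add: inner_add_left algebra_simps sum.distrib scaleR_sum_right sum_distrib_left)
  have injL: "inj (L y)" if y: "y \<in> W" for y
  proof (subst linear_injective_0[OF linL], intro allI impI)
    fix v assume v: "L y v = 0"
    define d where "d = (\<Sum>b<k. (v \<bullet> e b) *\<^sub>R E b y)"
    have hE: "h y d (E a y) = 0" if "a < k" for a
    proof -
      have "h y d (E a y) = (\<Sum>b<k. (v \<bullet> e b) * G y a b)"
        unfolding d_def G_def linear_sum[OF h_linear(2)[OF SW[OF y]]] h_simps[OF SW[OF y]] by simp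
      also have "\<dots> = 0" using inner_e[OF that, of y v] v by simp
      finally show ?thesis .
    qed
    have "d = 0"
    proof (rule nd[OF y, rule_format])
      show "d \<in> span ((\<lambda>a. E a y) ` {..<k})"
        unfolding d_def by (intro span_sum span_scale span_base) auto
      fix d' assume "d' \<in> span ((\<lambda>a. E a y) ` {..<k})"
      then obtain c where c: "d' = (\<Sum>a<k. c a *\<^sub>R E a y)" by (rule span_finite_indexed)
      show "h y d d' = 0"
        unfolding c linear_sum[OF h_linear(1)[OF SW[OF y]]] h_simps[OF SW[OF y]] by (simp add: hE)
    qed
    then have "(\<Sum>b<k. (v \<bullet> e b) *\<^sub>R E b y) = 0" unfolding d_def .
    then have ve: "v \<bullet> e b = 0" if "b < k" for b
      using independent_indexedD[OF frame(1)[OF y] frame(2)[OF y], of "\<lambda>b. v \<bullet> e b"] that by simp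
    show "v = 0"
    proof (rule euclidean_eqI)
      fix b :: 'a assume "b \<in> Basis"
      then show "v \<bullet> b = 0 \<bullet> b"
        using ve inner_c[of b y v] v by (cases "b \<in> e ` {..<k}") (auto simp: C_def)
    qed
  qed
  have "\<exists>z. L y z = r y" if "y \<in> W" for y
    using linear_injective_imp_surjective[OF linL injL[OF that]] by (metis surjD)
  then obtain z where z: "\<And>y. y \<in> W \<Longrightarrow> L y (z y) = r y" by metis
  have hlf: "smooth_on W (\<lambda>y. h y (X y) (E a y))" if "smooth_on W X" "a < k" for X a
  proof -
    have h: "smooth_on W (\<lambda>y. h y u v)" for u v
      by (rule smooth_on_subset[OF smooth_h W(2)])
    have 1: "smooth_on W (\<lambda>y. h y u (E a y))" for u
      by (rule smooth_on_linear_field[OF W(1) h_linear(1)[OF SW] h E[OF that(2)]])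
    show ?thesis
      by (rule smooth_on_linear_field[OF W(1) h_linear(2)[OF SW] 1 that(1)])
  qed
  have zs: "smooth_on W z"
  proof (rule solution_of_linear_system_smooth[where L = L and r = r, OF W(1) linL injL _ z])
    show "smooth_on W (\<lambda>y. L y v)" for v
      unfolding L_def G_def
      by (intro smooth_on_add smooth_on_sum smooth_on_scaleR smooth_on_mult smooth_on_const W(1) hlf E) auto
    show "smooth_on W r"
      unfolding r_def
      by (intro smooth_on_sum smooth_on_scaleR smooth_on_const W(1) hlf) auto
  qed
  define p where "p y = (\<Sum>b<k. (z y \<bullet> e b) *\<^sub>R E b y)" for y
  show ?thesis
  proof (intro exI[of _ p] conjI ballI)
    show "smooth_on W p"
      unfolding p_def
      by (intro smooth_on_sum smooth_on_scaleR W(1) smooth_on_bounded_linear[OF W(1) bounded_linear_inner_left zs] E) auto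
  next
    fix y assume y: "y \<in> W"
    show "p y \<in> span ((\<lambda>a. E a y) ` {..<k})"
      unfolding p_def by (intro span_sum span_scale span_base) auto
  next
    fix y d assume y: "y \<in> W" and "d \<in> span ((\<lambda>a. E a y) ` {..<k})"
    then obtain c where c: "d = (\<Sum>a<k. c a *\<^sub>R E a y)" using span_finite_indexed by metis
    have "h y (w - p y) (E a y) = 0" if "a < k" for a
    proof -
      have "h y (p y) (E a y) = (\<Sum>b<k. (z y \<bullet> e b) * G y a b)"
        unfolding p_def G_def linear_sum[OF h_linear(2)[OF SW[OF y]]] h_simps[OF SW[OF y]] by simp
      also have "\<dots> = h y w (E a y)"
        using inner_e[OF that, of y "z y"] inner_r[OF that, of y] z[OF y] by simp
      finally show ?thesis by (simp add: h_simps[OF SW[OF y]])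
    qed
    then show "h y (w - p y) d = 0"
      unfolding c linear_sum[OF h_linear(1)[OF SW[OF y]]] by (simp add: h_simps(9)[OF SW[OF y]])
  qed
qed

end

locale parallel_subbundle = metric_chart S h for S :: "'a::euclidean_space set" and h +
  fixes D :: "'a \<Rightarrow> 'a set" and k :: nat
  assumes frames: "x \<in> S \<Longrightarrow> \<exists>W E. open W \<and> x \<in> W \<and> W \<subseteq> S \<and> (\<forall>a<k. smooth_on W (E a)) \<and>
        (\<forall>y\<in>W. inj_on (\<lambda>a::nat. E a y) {..<k} \<and> independent ((\<lambda>a. E a y) ` {..<k}) \<and>
           D y = span ((\<lambda>a. E a y) ` {..<k}))"
    and D_nondeg: "x \<in> S \<Longrightarrow> v \<in> D x \<Longrightarrow> (\<And>w. w \<in> D x \<Longrightarrow> h x v w = 0) \<Longrightarrow> v = 0"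
    and D_parallel: "open W \<Longrightarrow> W \<subseteq> S \<Longrightarrow> smooth_on W X \<Longrightarrow> smooth_on W Y \<Longrightarrow>
        (\<And>x. x \<in> W \<Longrightarrow> Y x \<in> D x) \<Longrightarrow> x \<in> W \<Longrightarrow> nabla h X Y x \<in> D x"
begin

definition proj where "proj x w = orth_proj (h x) (D x) w"

lemma D_subspace: "x \<in> S \<Longrightarrow> subspace (D x)"
  using frames[of x] by (metis subspace_span)

lemma proj_eqI: "x \<in> S \<Longrightarrow> p \<in> D x \<Longrightarrow> (\<And>d. d \<in> D x \<Longrightarrow> h x (w - p) d = 0) \<Longrightarrow> proj x w = p"
  unfolding proj_def by (rule orth_proj_eqI[OF h_linear(2) D_subspace D_nondeg])

lemma local_proj:
  assumes "x \<in> S"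
  obtains W E where "open W" "x \<in> W" "W \<subseteq> S" "\<And>a. a < k \<Longrightarrow> smooth_on W (E a)"
    "\<And>y. y \<in> W \<Longrightarrow> D y = span ((\<lambda>a. E a y) ` {..<k})"
    "\<And>w. smooth_on W (\<lambda>y. proj y w)" "\<And>y w. y \<in> W \<Longrightarrow> proj y w \<in> D y"
    "\<And>y w d. y \<in> W \<Longrightarrow> d \<in> D y \<Longrightarrow> h y (w - proj y w) d = 0"
proof -
  obtain W E where W: "open W" "x \<in> W" "W \<subseteq> S" and E: "\<And>a. a < k \<Longrightarrow> smooth_on W (E a)"
    and fr: "\<And>y. y \<in> W \<Longrightarrow> inj_on (\<lambda>a::nat. E a y) {..<k}" "\<And>y. y \<in> W \<Longrightarrow> independent ((\<lambda>a. E a y) ` {..<k})"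
    and D: "\<And>y. y \<in> W \<Longrightarrow> D y = span ((\<lambda>a. E a y) ` {..<k})"
    using frames[OF assms] by metis
  have nd: "\<forall>v\<in>span ((\<lambda>a. E a y) ` {..<k}). (\<forall>d\<in>span ((\<lambda>a. E a y) ` {..<k}). h y v d = 0) \<longrightarrow> v = 0"
    if "y \<in> W" for y
    using D_nondeg[of y] that D W(3) by blast
  have *: "smooth_on W (\<lambda>y. proj y w) \<and> (\<forall>y\<in>W. proj y w \<in> D y \<and> (\<forall>d\<in>D y. h y (w - proj y w) d = 0))" for w
  proof -
    obtain p where p: "smooth_on W p" "\<forall>y\<in>W. p y \<in> span ((\<lambda>a. E a y) ` {..<k}) \<and>
        (\<forall>d\<in>span ((\<lambda>a. E a y) ` {..<k}). h y (w - p y) d = 0)"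
      using smooth_orthogonal_projection[where E = E and k = k and w = w, OF W(1,3,2) E fr nd] by blast
    have eq: "proj y w = p y" if "y \<in> W" for y
      by (rule proj_eqI) (use that W(3) p(2) D in auto)
    have "smooth_on W (\<lambda>y. proj y w)"
      by (rule smooth_on_cong[OF W(1) _ p(1)]) (simp add: eq)
    then show ?thesis using eq p(2) D by simp
  qed
  show thesis
    by (rule that[OF W E D]) (use * in auto)
qed

lemma proj_in: "x \<in> S \<Longrightarrow> proj x w \<in> D x"
  using local_proj[of x] by metis

lemma proj_orth: "x \<in> S \<Longrightarrow> d \<in> D x \<Longrightarrow> h x (w - proj x w) d = 0"
  using local_proj[of x] by metis

lemma proj_fixes: "x \<in> S \<Longrightarrow> d \<in> D x \<Longrightarrow> proj x d = d"
  by (rule proj_eqI) (simp_all add: h_simps)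

lemma proj_idem: "x \<in> S \<Longrightarrow> proj x (proj x w) = proj x w"
  by (simp add: proj_fixes proj_in)

lemma proj_linear:
  assumes x: "x \<in> S"
  shows "linear (proj x)"
proof (rule linearI)
  show "proj x (v + w) = proj x v + proj x w" for v w
  proof (rule proj_eqI[OF x])
    show "proj x v + proj x w \<in> D x" by (intro subspace_add D_subspace proj_in x)
    fix d assume d: "d \<in> D x"
    have "h x (v - proj x v) d + h x (w - proj x w) d = 0" using proj_orth[OF x d] by simp
    then show "h x (v + w - (proj x v + proj x w)) d = 0" by (simp add: h_simps[OF x])
  qed
  show "proj x (c *\<^sub>R v) = c *\<^sub>R proj x v" for c v
  proof (rule proj_eqI[OF x])
    show "c *\<^sub>R proj x v \<in> D x" by (intro subspace_scale D_subspace proj_in x)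
    fix d assume d: "d \<in> D x"
    have "c * h x (v - proj x v) d = 0" using proj_orth[OF x d] by simp
    then show "h x (c *\<^sub>R v - c *\<^sub>R proj x v) d = 0" by (simp add: h_simps[OF x] algebra_simps)
  qed
qed

lemma proj_selfadj:
  assumes x: "x \<in> S"
  shows "h x (proj x v) w = h x v (proj x w)"
proof -
  have "h x (v - proj x v) (proj x w) = 0" "h x (w - proj x w) (proj x v) = 0"
    by (simp_all add: proj_orth[OF x proj_in[OF x]])
  then show ?thesis using sym[OF x] by (simp add: h_simps[OF x])
qed

lemma proj_smooth: "smooth_on S (\<lambda>x. proj x w)"
proof (rule smooth_on_local)
  fix x assume "x \<in> S"
  then show "\<exists>W. open W \<and> x \<in> W \<and> smooth_on W (\<lambda>x. proj x w)"
    using local_proj[of x] by metis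
qed

text \<open>The derivative \<open>\<nabla>\<^sub>u (P w)\<close> lies in \<open>D\<close> because \<open>D\<close> is parallel, and \<open>\<nabla>\<^sub>u (w - P w)\<close> is orthogonal to \<open>D\<close> because \<open>D\<close>
  and the metric are. So \<open>\<nabla>\<^sub>u (P w)\<close> is the projection of \<open>\<nabla>\<^sub>u w\<close>, which is \<open>\<Gamma> u w\<close> for constant \<open>w\<close>.\<close>

lemma parallel_endo_proj: "parallel_endo proj"
  unfolding parallel_endo_def
proof (intro conjI ballI allI proj_linear proj_smooth)
  fix x w assume x: "x \<in> S"
  obtain W E where W: "open W" "x \<in> W" "W \<subseteq> S" and E: "\<And>a. a < k \<Longrightarrow> smooth_on W (E a)"
    and D: "\<And>y. y \<in> W \<Longrightarrow> D y = span ((\<lambda>a. E a y) ` {..<k})"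
    using local_proj[OF x] by metis
  define p where "p u = frechet_derivative (\<lambda>y. proj y w) (at x) u + \<Gamma> x u (proj x w)" for u
  have pd: "((\<lambda>y. proj y w) has_derivative (\<lambda>u. p u - \<Gamma> x u (proj x w))) (at x)"
    unfolding p_def using smooth_onD[OF proj_smooth x] by simp
  have "proj x (\<Gamma> x u w) = p u" for u
  proof (rule proj_eqI[OF x])
    have "nabla h (\<lambda>_. u) (\<lambda>y. proj y w) x \<in> D x"
      by (rule D_parallel[OF W(1,3) smooth_on_const smooth_on_subset[OF proj_smooth W(3)] proj_in W(2)])
         (use W(3) in auto)
    then show "p u \<in> D x" unfolding nabla_def p_def .
    fix d assume "d \<in> D x"
    then obtain c where c: "d = (\<Sum>a<k. c a *\<^sub>R E a x)" using D[OF W(2)] span_finite_indexed by metis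
    define Y where "Y y = (\<Sum>a<k. c a *\<^sub>R E a y)" for y
    have Ys: "smooth_on W Y" unfolding Y_def by (intro smooth_on_sum smooth_on_scaleR smooth_on_const W(1) E) auto
    have YD: "Y y \<in> D y" if "y \<in> W" for y
      unfolding Y_def D[OF that] by (intro span_sum span_scale span_base) auto
    have "nabla h (\<lambda>_. u) Y x \<in> D x"
      by (rule D_parallel[OF W(1,3) smooth_on_const Ys YD W(2)])
    then have n: "frechet_derivative Y (at x) u + \<Gamma> x u (Y x) \<in> D x" unfolding nabla_def .
    have wd: "((\<lambda>y. w - proj y w) has_derivative (\<lambda>u. - (p u - \<Gamma> x u (proj x w)))) (at x)"
      using has_derivative_diff[OF has_derivative_const pd, of w] by simp
    note d1 = has_derivative_h_fields[OF x wd smooth_onD[OF Ys W(2)]]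
    have d2: "((\<lambda>y. h y (w - proj y w) (Y y)) has_derivative (\<lambda>u. 0)) (at x)"
      by (rule has_derivative_transform_within_open[OF _ W(1,2), of "\<lambda>_. 0"])
         (use W(3) YD proj_orth in auto)
    have "h x (- (p u - \<Gamma> x u (proj x w)) + \<Gamma> x u (w - proj x w)) (Y x)
       + h x (w - proj x w) (frechet_derivative Y (at x) u + \<Gamma> x u (Y x)) = 0"
      using has_derivative_unique[OF d1 d2] by metis
    then show "h x (\<Gamma> x u w - p u) d = 0"
      unfolding proj_orth[OF x n] c Y_def[symmetric] by (simp add: \<Gamma>_simps[OF x] algebra_simps)
  qed
  then show "((\<lambda>y. proj y w) has_derivative (\<lambda>u. proj x (\<Gamma> x u w) - \<Gamma> x u (proj x w))) (at x)"
    using pd by simp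
qed

end

section \<open>Charts and transition maps of a manifold\<close>

lemma second_countable_euclidean: "second_countable (euclidean :: 'a::second_countable_topology topology)"
proof -
  obtain B :: "'a set set" where B: "countable B" "topological_basis B" using ex_countable_basis by blast
  show ?thesis
    unfolding second_countable_def
  proof (intro exI conjI ballI allI impI)
    show "countable B" by (rule B)
    show "openin euclidean V" if "V \<in> B" for V
      using topological_basis_open[OF B(2) that] by simp
    fix U and x :: 'a assume "openin euclidean U \<and> x \<in> U"
    then have U: "open U" "x \<in> U" by simp_all
    obtain V where "V \<in> B" "x \<in> V" "V \<subseteq> U" by (rule topological_basisE[OF B(2) U])
    then show "\<exists>V\<in>B. x \<in> V \<and> V \<subseteq> U" by blast
  qed
qed

lemma second_countable_prod_topology:
  assumes "second_countable X" "second_countable Y"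
  shows "second_countable (prod_topology X Y)"
proof -
  obtain A where A: "countable A" "\<And>V. V \<in> A \<Longrightarrow> openin X V"
    "\<And>U x. openin X U \<Longrightarrow> x \<in> U \<Longrightarrow> \<exists>V\<in>A. x \<in> V \<and> V \<subseteq> U"
    using assms(1) unfolding second_countable_def by meson
  obtain B where B: "countable B" "\<And>V. V \<in> B \<Longrightarrow> openin Y V"
    "\<And>U x. openin Y U \<Longrightarrow> x \<in> U \<Longrightarrow> \<exists>V\<in>B. x \<in> V \<and> V \<subseteq> U"
    using assms(2) unfolding second_countable_def by meson
  show ?thesis
    unfolding second_countable_def
  proof (intro exI conjI ballI allI impI)
    show "countable ((\<lambda>(V, W). V \<times> W) ` (A \<times> B))" using A(1) B(1) by blast
    show "openin (prod_topology X Y) V" if "V \<in> (\<lambda>(V, W). V \<times> W) ` (A \<times> B)" for V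
      using that A(2) B(2) by (auto simp: openin_prod_Times_iff)
    fix U z assume U: "openin (prod_topology X Y) U \<and> z \<in> U"
    obtain x y where z: "z = (x, y)" by (cases z)
    obtain V W where VW: "openin X V" "openin Y W" "x \<in> V" "y \<in> W" "V \<times> W \<subseteq> U"
      using U unfolding z openin_prod_topology_alt by blast
    obtain V' where V': "V' \<in> A" "x \<in> V'" "V' \<subseteq> V" using A(3)[OF VW(1,3)] by blast
    obtain W' where W': "W' \<in> B" "y \<in> W'" "W' \<subseteq> W" using B(3)[OF VW(2,4)] by blast
    have "V' \<times> W' \<in> (\<lambda>(V, W). V \<times> W) ` (A \<times> B)" using V' W' by auto
    moreover have "z \<in> V' \<times> W'" "V' \<times> W' \<subseteq> U" using z V' W' VW by auto
    ultimately show "\<exists>V\<in>(\<lambda>(V, W). V \<times> W) ` (A \<times> B). z \<in> V \<and> V \<subseteq> U" by blast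
  qed
qed

lemma smooth_manifoldD:
  assumes "smooth_manifold M"
  shows "Hausdorff_space (mtop M)" "second_countable (mtop M)"
    "topspace (mtop M) = (\<Union>i\<in>charts M. cdom M i)"
    "i \<in> charts M \<Longrightarrow> openin (mtop M) (cdom M i)"
    "i \<in> charts M \<Longrightarrow> open (cimage M i)"
    "i \<in> charts M \<Longrightarrow> homeomorphic_map (subtopology (mtop M) (cdom M i)) (top_of_set (cimage M i)) (cmap M i)"
    "i \<in> charts M \<Longrightarrow> j \<in> charts M \<Longrightarrow> smooth_on (overlap M i j) (transition M i j)"
  using assms by (simp_all add: smooth_manifold_def)

lemma cdom_subset: "smooth_manifold M \<Longrightarrow> i \<in> charts M \<Longrightarrow> cdom M i \<subseteq> topspace (mtop M)"
  using openin_subset[OF smooth_manifoldD(4)] .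

lemma inj_on_cmap:
  assumes "smooth_manifold M" "i \<in> charts M"
  shows "inj_on (cmap M i) (cdom M i)"
proof -
  have "topspace (subtopology (mtop M) (cdom M i)) = cdom M i"
    using cdom_subset[OF assms] by (auto simp: topspace_subtopology)
  then show ?thesis
    using homeomorphic_imp_injective_map[OF smooth_manifoldD(6)[OF assms]] by simp
qed

lemma transition_cmap:
  assumes "smooth_manifold M" "i \<in> charts M" "p \<in> cdom M i"
  shows "transition M i j (cmap M i p) = cmap M j p"
  unfolding transition_def using inv_into_f_f[OF inj_on_cmap[OF assms(1,2)] assms(3)] by simp

lemma overlap_subset: "overlap M i j \<subseteq> cimage M i"
  unfolding overlap_def cimage_def by blast

lemma open_overlap:
  assumes M: "smooth_manifold M" and i: "i \<in> charts M" and j: "j \<in> charts M"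
  shows "open (overlap M i j)"
proof -
  have "openin (subtopology (mtop M) (cdom M i)) (cdom M i \<inter> cdom M j)"
    by (metis smooth_manifoldD(4)[OF M j] openin_subtopology_Int inf_commute)
  then have "openin (top_of_set (cimage M i)) (overlap M i j)"
    unfolding overlap_def
    using homeomorphic_imp_open_map[OF smooth_manifoldD(6)[OF M i]] unfolding open_map_def by blast
  then show ?thesis using openin_open_eq[OF smooth_manifoldD(5)[OF M i]] by simp
qed

lemma transition_into:
  assumes "smooth_manifold M" "i \<in> charts M" "x \<in> overlap M i j"
  shows "transition M i j x \<in> cimage M j"
  using assms transition_cmap[OF assms(1,2)] unfolding overlap_def cimage_def by auto

lemma open_chart_preimage:
  assumes M: "smooth_manifold M" and i: "i \<in> charts M" and B: "open B"
  shows "openin (mtop M) {p \<in> cdom M i. cmap M i p \<in> B}"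
proof -
  have top: "topspace (subtopology (mtop M) (cdom M i)) = cdom M i"
    using cdom_subset[OF M i] by (auto simp: topspace_subtopology)
  have c: "continuous_map (subtopology (mtop M) (cdom M i)) (top_of_set (cimage M i)) (cmap M i)"
    using homeomorphic_imp_continuous_map[OF smooth_manifoldD(6)[OF M i]] .
  have "openin (subtopology (mtop M) (cdom M i)) {p \<in> cdom M i. cmap M i p \<in> cimage M i \<inter> B}"
    using openin_continuous_map_preimage[OF c openin_open_Int[OF B]] unfolding top .
  moreover have "{p \<in> cdom M i. cmap M i p \<in> cimage M i \<inter> B} = {p \<in> cdom M i. cmap M i p \<in> B}"
    by (auto simp: cimage_def)
  ultimately show ?thesis
    using openin_open_subtopology[OF smooth_manifoldD(4)[OF M i]] by simp
qed

text \<open>Compactness in terms of coordinates: every point of every chart can be moved by a transition map into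
  one of finitely many compact sets.\<close>

lemma finite_compact_chart_cover:
  assumes M: "smooth_manifold M" and comp: "compact_space (mtop M)"
  obtains F where "finite F" "\<And>k K. (k, K) \<in> F \<Longrightarrow> k \<in> charts M \<and> compact K \<and> K \<subseteq> cimage M k"
    "\<And>i x. i \<in> charts M \<Longrightarrow> x \<in> cimage M i \<Longrightarrow> \<exists>(k, K)\<in>F. x \<in> overlap M i k \<and> transition M i k x \<in> K"
proof -
  have "\<forall>p\<in>topspace (mtop M). \<exists>i d. i \<in> charts M \<and> p \<in> cdom M i \<and> d > 0 \<and> cball (cmap M i p) d \<subseteq> cimage M i"
  proof
    fix p assume "p \<in> topspace (mtop M)"
    then obtain i where i: "i \<in> charts M" "p \<in> cdom M i" using smooth_manifoldD(3)[OF M] by auto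
    then have "cmap M i p \<in> cimage M i" by (auto simp: cimage_def)
    then show "\<exists>i d. i \<in> charts M \<and> p \<in> cdom M i \<and> d > 0 \<and> cball (cmap M i p) d \<subseteq> cimage M i"
      using open_contains_cball smooth_manifoldD(5)[OF M i(1)] i by blast
  qed
  then obtain c d where c: "\<And>p. p \<in> topspace (mtop M) \<Longrightarrow> c p \<in> charts M \<and> p \<in> cdom M (c p) \<and> d p > 0 \<and>
      cball (cmap M (c p) p) (d p) \<subseteq> cimage M (c p)"
    by metis
  define O' where "O' p = {q \<in> cdom M (c p). cmap M (c p) q \<in> ball (cmap M (c p) p) (d p)}" for p
  have op: "openin (mtop M) (O' p)" if "p \<in> topspace (mtop M)" for p
    unfolding O'_def using c[OF that] by (intro open_chart_preimage[OF M]) auto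
  have "\<exists>\<F>. finite \<F> \<and> \<F> \<subseteq> O' ` topspace (mtop M) \<and> topspace (mtop M) \<subseteq> \<Union> \<F>"
    using comp[unfolded compact_space_alt, rule_format, of "O' ` topspace (mtop M)"] op c by (force simp: O'_def)
  then obtain A where A: "finite A" "A \<subseteq> topspace (mtop M)" "topspace (mtop M) \<subseteq> \<Union> (O' ` A)"
    by (metis finite_subset_image)
  show thesis
  proof (rule that)
    show "finite ((\<lambda>p. (c p, cball (cmap M (c p) p) (d p))) ` A)" using A(1) by simp
    show "k \<in> charts M \<and> compact K \<and> K \<subseteq> cimage M k" if "(k, K) \<in> (\<lambda>p. (c p, cball (cmap M (c p) p) (d p))) ` A" for k K
      using that c A(2) by auto
    fix i x assume i: "i \<in> charts M" and x: "x \<in> cimage M i"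
    then obtain q where q: "q \<in> cdom M i" "x = cmap M i q" by (auto simp: cimage_def)
    then have "q \<in> topspace (mtop M)" using cdom_subset[OF M i] by auto
    then obtain p where p: "p \<in> A" "q \<in> O' p" using A(3) by auto
    have "x \<in> overlap M i (c p)" using p(2) q by (auto simp: overlap_def O'_def)
    moreover have "transition M i (c p) x \<in> cball (cmap M (c p) p) (d p)"
      using p(2) transition_cmap[OF M i q(1)] q(2) by (auto simp: O'_def)
    ultimately show "\<exists>(k, K)\<in>(\<lambda>p. (c p, cball (cmap M (c p) p) (d p))) ` A. x \<in> overlap M i k \<and> transition M i k x \<in> K"
      using p(1) by blast
  qed
qed

text \<open>Connectedness in terms of coordinates, for a property that is invariant under transition maps.\<close>

lemma connected_chart_induct:
  assumes M: "smooth_manifold M" and conn: "connected_space (mtop M)"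
    and inv: "\<And>i j x. i \<in> charts M \<Longrightarrow> j \<in> charts M \<Longrightarrow> x \<in> overlap M i j \<Longrightarrow> Q i x \<longleftrightarrow> Q j (transition M i j x)"
    and op: "\<And>i. i \<in> charts M \<Longrightarrow> open {x \<in> cimage M i. Q i x}" "\<And>i. i \<in> charts M \<Longrightarrow> open {x \<in> cimage M i. \<not> Q i x}"
    and base: "i0 \<in> charts M" "x0 \<in> cimage M i0" "Q i0 x0"
    and i: "i \<in> charts M" "x \<in> cimage M i"
  shows "Q i x"
proof (rule ccontr)
  assume no: "\<not> Q i x"
  define A where "A = (\<Union>i\<in>charts M. {p \<in> cdom M i. cmap M i p \<in> {x \<in> cimage M i. Q i x}})"
  define B where "B = (\<Union>i\<in>charts M. {p \<in> cdom M i. cmap M i p \<in> {x \<in> cimage M i. \<not> Q i x}})"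
  have "openin (mtop M) A" "openin (mtop M) B"
    unfolding A_def B_def by (intro openin_Union; use open_chart_preimage[OF M] op in blast)+
  moreover have "topspace (mtop M) \<subseteq> A \<union> B"
    using smooth_manifoldD(3)[OF M] by (auto simp: A_def B_def cimage_def)
  moreover have "A \<inter> B = {}"
  proof -
    have False if "p \<in> A" "p \<in> B" for p
    proof -
      obtain i where i: "i \<in> charts M" "p \<in> cdom M i" "Q i (cmap M i p)" using \<open>p \<in> A\<close> by (auto simp: A_def)
      obtain j where j: "j \<in> charts M" "p \<in> cdom M j" "\<not> Q j (cmap M j p)" using \<open>p \<in> B\<close> by (auto simp: B_def)
      have "cmap M i p \<in> overlap M i j" using i j by (auto simp: overlap_def)
      from inv[OF i(1) j(1) this] show False
        using transition_cmap[OF M i(1,2)] i(3) j(3) by simp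
    qed
    then show ?thesis by blast
  qed
  moreover have "A \<noteq> {}" using base by (auto simp: A_def cimage_def)
  moreover have "B \<noteq> {}" using i no by (auto simp: B_def cimage_def)
  ultimately show False using conn unfolding connected_space_def by blast
qed

section \<open>The cone as a pseudo-Riemannian manifold\<close>

lemma metric_cone_simps [simp]:
  "charts (metric_cone M) = charts M"
  "mtop (metric_cone M) = prod_topology (top_of_set {0<..}) (mtop M)"
  "cdom (metric_cone M) i = {0<..} \<times> cdom M i"
  "cmap (metric_cone M) i = (\<lambda>(r, p). (r, cmap M i p))"
  unfolding metric_cone_def by simp_all

lemma cimage_cone: "cimage (metric_cone M) i = {0<..} \<times> cimage M i"
  unfolding cimage_def by (auto simp: image_iff)

lemma overlap_cone: "overlap (metric_cone M) i j = {0<..} \<times> overlap M i j"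
  unfolding overlap_def by (auto simp: image_iff)

lemma transition_cone:
  assumes M: "smooth_manifold M" and i: "i \<in> charts M" and x: "x \<in> cimage M i" and r: "r > 0"
  shows "transition (metric_cone M) i j (r, x) = (r, transition M i j x)"
proof -
  obtain p where p: "p \<in> cdom M i" "x = cmap M i p" using x by (auto simp: cimage_def)
  have "inj_on (cmap (metric_cone M) i) (cdom (metric_cone M) i)"
    using inj_on_cmap[OF M i] by (auto simp: inj_on_def)
  from inv_into_f_f[OF this, of "(r, p)"]
  have "inv_into (cdom (metric_cone M) i) (cmap (metric_cone M) i) (r, x) = (r, p)"
    using p r by simp
  then show ?thesis
    unfolding transition_def using inv_into_f_f[OF inj_on_cmap[OF M i] p(1)] p(2) by simp
qed

lemma smooth_manifold_cone:
  assumes M: "smooth_manifold M"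
  shows "smooth_manifold (metric_cone M)"
  unfolding smooth_manifold_def
proof (intro conjI ballI)
  show "Hausdorff_space (mtop (metric_cone M))"
    using smooth_manifoldD(1)[OF M] by (simp add: Hausdorff_space_prod_topology Hausdorff_space_subtopology Hausdorff_space_euclidean)
  show "second_countable (mtop (metric_cone M))"
    using smooth_manifoldD(2)[OF M]
    by (simp add: second_countable_prod_topology second_countable_subtopology second_countable_euclidean)
  show "topspace (mtop (metric_cone M)) = (\<Union>i\<in>charts (metric_cone M). cdom (metric_cone M) i)"
    using smooth_manifoldD(3)[OF M] by auto
  fix i assume "i \<in> charts (metric_cone M)"
  then have i: "i \<in> charts M" by simp
  show "openin (mtop (metric_cone M)) (cdom (metric_cone M) i)"
    using smooth_manifoldD(4)[OF M i] by (simp add: openin_prod_Times_iff)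
  show "open (cimage (metric_cone M) i)"
    unfolding cimage_cone by (intro open_Times open_greaterThan smooth_manifoldD(5)[OF M i])
  obtain k where k: "homeomorphic_maps (subtopology (mtop M) (cdom M i)) (top_of_set (cimage M i)) (cmap M i) k"
    using smooth_manifoldD(6)[OF M i] homeomorphic_map_maps by blast
  have "homeomorphic_maps (prod_topology (top_of_set {0::real<..}) (subtopology (mtop M) (cdom M i)))
     (prod_topology (top_of_set {0<..}) (top_of_set (cimage M i))) (\<lambda>(r, p). (id r, cmap M i p)) (\<lambda>(r, x). (id r, k x))"
    using k by (simp only: homeomorphic_maps_prod homeomorphic_maps_id) simp
  then show "homeomorphic_map (subtopology (mtop (metric_cone M)) (cdom (metric_cone M) i))
      (top_of_set (cimage (metric_cone M) i)) (cmap (metric_cone M) i)"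
    unfolding homeomorphic_map_maps cimage_cone
    by (auto simp: subtopology_Times subtopology_subtopology)
next
  fix i j assume "i \<in> charts (metric_cone M)" "j \<in> charts (metric_cone M)"
  then have i: "i \<in> charts M" and j: "j \<in> charts M" by simp_all
  have o: "open ({0::real<..} \<times> overlap M i j)" by (intro open_Times open_greaterThan open_overlap[OF M i j])
  have "smooth_on ({0<..} \<times> overlap M i j) (\<lambda>p. (fst p :: real, transition M i j (snd p)))"
    by (intro smooth_on_Pair o smooth_on_bounded_linear_id bounded_linear_fst smooth_on_compose_snd
        open_overlap[OF M i j] open_greaterThan smooth_manifoldD(7)[OF M i j])
  then show "smooth_on (overlap (metric_cone M) i j) (transition (metric_cone M) i j)"
    unfolding overlap_cone
    by (rule smooth_on_cong[OF o, rotated]) (use transition_cone[OF M i] overlap_subset in fastforce)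
qed

lemma transition_has_derivative:
  assumes "smooth_manifold M" "i \<in> charts M" "j \<in> charts M" "x \<in> overlap M i j"
  shows "(transition M i j has_derivative frechet_derivative (transition M i j) (at x)) (at x)"
  by (rule smooth_onD[OF smooth_manifoldD(7)[OF assms(1-3)] assms(4)])

lemma frechet_derivative_transition_cone:
  assumes M: "smooth_manifold M" and i: "i \<in> charts M" and j: "j \<in> charts M" and x: "x \<in> overlap M i j" and r: "r > 0"
  shows "frechet_derivative (transition (metric_cone M) i j) (at (r, x)) a =
    (fst a, frechet_derivative (transition M i j) (at x) (snd a))"
proof -
  have o: "open ({0::real<..} \<times> overlap M i j)" by (intro open_Times open_greaterThan open_overlap[OF M i j])
  have 1: "((\<lambda>p. transition M i j (snd p)) has_derivative (\<lambda>a. frechet_derivative (transition M i j) (at x) (snd a))) (at (r, x))"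
    by (rule has_derivative_compose[OF bounded_linear_imp_has_derivative[OF bounded_linear_snd]])
       (use transition_has_derivative[OF M i j x] in simp)
  have "((\<lambda>p. (fst p, transition M i j (snd p))) has_derivative
      (\<lambda>a. (fst a, frechet_derivative (transition M i j) (at x) (snd a)))) (at (r, x))"
    by (intro has_derivative_Pair bounded_linear_imp_has_derivative bounded_linear_fst 1)
  then have "(transition (metric_cone M) i j has_derivative
      (\<lambda>a. (fst a, frechet_derivative (transition M i j) (at x) (snd a)))) (at (r, x))"
    by (rule has_derivative_transform_within_open[OF _ o])
       (use x r transition_cone[OF M i] overlap_subset in fastforce)+
  from frechet_derivative_at[OF this] show ?thesis by metis
qed

lemma pseudo_riemannianD:
  assumes "pseudo_riemannian M g"
  shows "smooth_manifold M"
    "i \<in> charts M \<Longrightarrow> metric_chart (cimage M i) (g i)"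
    "i \<in> charts M \<Longrightarrow> j \<in> charts M \<Longrightarrow> x \<in> overlap M i j \<Longrightarrow> g i x v w = g j (transition M i j x)
          (frechet_derivative (transition M i j) (at x) v)
          (frechet_derivative (transition M i j) (at x) w)"
proof -
  show M: "smooth_manifold M" using assms unfolding pseudo_riemannian_def by blast
  show "metric_chart (cimage M i) (g i)" if i: "i \<in> charts M"
  proof
    show "open (cimage M i)" by (rule smooth_manifoldD(5)[OF M i])
  qed (use assms i in \<open>auto simp: pseudo_riemannian_def\<close>)
  show "i \<in> charts M \<Longrightarrow> j \<in> charts M \<Longrightarrow> x \<in> overlap M i j \<Longrightarrow> g i x v w = g j (transition M i j x)
          (frechet_derivative (transition M i j) (at x) v)
          (frechet_derivative (transition M i j) (at x) w)"
    using assms unfolding pseudo_riemannian_def by blast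
qed

lemma pseudo_riemannianI:
  assumes "smooth_manifold M" "\<And>i. i \<in> charts M \<Longrightarrow> metric_chart (cimage M i) (g i)"
    "\<And>i j x v w. i \<in> charts M \<Longrightarrow> j \<in> charts M \<Longrightarrow> x \<in> overlap M i j \<Longrightarrow> g i x v w = g j (transition M i j x)
          (frechet_derivative (transition M i j) (at x) v)
          (frechet_derivative (transition M i j) (at x) w)"
  shows "pseudo_riemannian M g"
  unfolding pseudo_riemannian_def
proof (intro conjI ballI allI)
  fix i assume i: "i \<in> charts M"
  interpret metric_chart "cimage M i" "g i" by (rule assms(2)[OF i])
  show "smooth_on (cimage M i) (\<lambda>x. g i x v w)" for v w by (rule smooth_h)
  fix x assume x: "x \<in> cimage M i"
  show "bilinear (g i x)" by (rule bil[OF x])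
  show "g i x v w = g i x w v" for v w by (rule sym[OF x])
  show "(\<forall>w. g i x v w = 0) \<longrightarrow> v = 0" for v using nondeg[OF x] by blast
qed (use assms in blast)+

lemma cone_chartI: "pseudo_riemannian M g \<Longrightarrow> i \<in> charts M \<Longrightarrow> cone_chart (cimage M i) (g i)"
  unfolding cone_chart_def by (rule pseudo_riemannianD)

lemma pseudo_riemannian_cone:
  assumes g: "pseudo_riemannian M g"
  shows "pseudo_riemannian (metric_cone M) (cone_metric g)"
proof (rule pseudo_riemannianI)
  note M = pseudo_riemannianD(1)[OF g]
  show "smooth_manifold (metric_cone M)" by (rule smooth_manifold_cone[OF M])
  show "metric_chart (cimage (metric_cone M) i) (cone_metric g i)" if "i \<in> charts (metric_cone M)" for i
    using cone_chart.metric_chart_cone[OF cone_chartI[OF g]] that by (simp add: cimage_cone cone_metric_eq_cone_form)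
  fix i j p v w assume "i \<in> charts (metric_cone M)" "j \<in> charts (metric_cone M)" "p \<in> overlap (metric_cone M) i j"
  then obtain r x where i: "i \<in> charts M" and j: "j \<in> charts M" and p: "p = (r, x)" "r > 0" and x: "x \<in> overlap M i j"
    by (auto simp: overlap_cone)
  have x': "x \<in> cimage M i" by (rule subsetD[OF overlap_subset x])
  show "cone_metric g i p v w = cone_metric g j (transition (metric_cone M) i j p)
     (frechet_derivative (transition (metric_cone M) i j) (at p) v) (frechet_derivative (transition (metric_cone M) i j) (at p) w)"
    unfolding p transition_cone[OF M i x' p(2)] frechet_derivative_transition_cone[OF M i j x p(2)] cone_metric_eq_cone_form
    by (simp add: cone_form_apply pseudo_riemannianD(3)[OF g i j x])
qed

lemma chart_isometry_transition:
  assumes g: "pseudo_riemannian M g" and i: "i \<in> charts M" and j: "j \<in> charts M"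
  shows "chart_isometry (cimage M i) (g i) (cimage M j) (g j) (overlap M i j) (transition M i j)"
proof -
  note M = pseudo_riemannianD(1)[OF g]
  interpret A: metric_chart "cimage M i" "g i" by (rule pseudo_riemannianD(2)[OF g i])
  interpret B: metric_chart "cimage M j" "g j" by (rule pseudo_riemannianD(2)[OF g j])
  show ?thesis
    by unfold_locales
       (use open_overlap[OF M i j] subsetD[OF overlap_subset] transition_into[OF M i] smooth_manifoldD(7)[OF M i j]
          pseudo_riemannianD(3)[OF g i j] in auto)
qed

section \<open>Closed manifolds with a split cone\<close>

text \<open>The differential at \<open>(1, x)\<close> of a transition map of the cone.\<close>

definition lift :: "('m, 'i, 'a::euclidean_space) atlas \<Rightarrow> 'i \<Rightarrow> 'i \<Rightarrow> 'a \<Rightarrow> real \<times> 'a \<Rightarrow> real \<times> 'a" where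
  "lift M i j x a = (fst a, frechet_derivative (transition M i j) (at x) (snd a))"

text \<open>The local projections of \<open>split_cone_chart\<close> on all charts, compatible with the transition maps and nontrivial at
  every point.\<close>

locale split_cone =
  fixes M :: "('m, 'i, 'a::euclidean_space) atlas" and g :: "('i, 'a) metric"
    and P :: "'i \<Rightarrow> real \<times> 'a \<Rightarrow> real \<times> 'a \<Rightarrow> real \<times> 'a"
  assumes g: "pseudo_riemannian M g" and closed: "closed_connected M"
    and nonempty: "\<exists>i\<in>charts M. cimage M i \<noteq> {}"
    and split: "i \<in> charts M \<Longrightarrow> split_cone_chart (cimage M i) (g i) (P i)"
    and natural: "i \<in> charts M \<Longrightarrow> j \<in> charts M \<Longrightarrow> x \<in> overlap M i j \<Longrightarrow>
      P j (1, transition M i j x) (lift M i j x a) = lift M i j x (P i (1, x) a)"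
    and nonzero: "i \<in> charts M \<Longrightarrow> x \<in> cimage M i \<Longrightarrow> \<exists>a. P i (1, x) a \<noteq> 0"
    and nonidentity: "i \<in> charts M \<Longrightarrow> x \<in> cimage M i \<Longrightarrow> \<exists>a. P i (1, x) a \<noteq> a"
begin

abbreviation H where "H i x \<equiv> cone_form (g i) (1, x)"
abbreviation lam where "lam i \<equiv> split_cone_chart.lam (g i) (P i)"
abbreviation T where "T i \<equiv> split_cone_chart.T (g i) (P i)"
abbreviation R where "R i x \<equiv> metric_chart.Riem (cone_form (g i)) (1, x)"

lemmas M = pseudo_riemannianD(1)[OF g]

lemma lift_simps:
  assumes "i \<in> charts M" "j \<in> charts M" "x \<in> overlap M i j"
  shows "lift M i j x (a + b) = lift M i j x a + lift M i j x b"
    "lift M i j x (a - b) = lift M i j x a - lift M i j x b"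
    "lift M i j x (c *\<^sub>R a) = c *\<^sub>R lift M i j x a"
    "lift M i j x (s, 0) = (s, 0)"
proof -
  have lin: "linear (frechet_derivative (transition M i j) (at x))"
    using has_derivative_linear[OF transition_has_derivative[OF M assms]] .
  show "lift M i j x (a + b) = lift M i j x a + lift M i j x b"
    "lift M i j x (a - b) = lift M i j x a - lift M i j x b"
    "lift M i j x (c *\<^sub>R a) = c *\<^sub>R lift M i j x a" "lift M i j x (s, 0) = (s, 0)"
    by (simp_all add: lift_def linear_add[OF lin] linear_diff[OF lin] linear_scale[OF lin] linear_0[OF lin])
qed

lemma complement: "split_cone M g (\<lambda>i p a. a - P i p a)"
proof (rule split_cone.intro)
  show "split_cone_chart (cimage M i) (g i) (\<lambda>p a. a - P i p a)" if "i \<in> charts M" for i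
    by (rule split_cone_chart.complement[OF split[OF that]])
  show "lift M i j x a - P j (1, transition M i j x) (lift M i j x a) = lift M i j x (a - P i (1, x) a)"
    if "i \<in> charts M" "j \<in> charts M" "x \<in> overlap M i j" for i j x a
    by (simp add: natural[OF that] lift_simps[OF that])
  show "\<exists>a. a - P i (1, x) a \<noteq> 0" if "i \<in> charts M" "x \<in> cimage M i" for i x
    using nonidentity[OF that] by (metis eq_iff_diff_eq_0)
  show "\<exists>a. a - P i (1, x) a \<noteq> a" if "i \<in> charts M" "x \<in> cimage M i" for i x
    using nonzero[OF that] by auto
qed (use g closed nonempty in auto)

lemma H_natural:
  assumes "i \<in> charts M" "j \<in> charts M" "x \<in> overlap M i j"
  shows "H j (transition M i j x) (lift M i j x a) (lift M i j x b) = H i x a b"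
  by (simp add: cone_form_apply lift_def pseudo_riemannianD(3)[OF g assms])

lemma in_cimage: "x \<in> overlap M i j \<Longrightarrow> x \<in> cimage M i"
  by (rule subsetD[OF overlap_subset])

lemma lam_natural:
  assumes "i \<in> charts M" "j \<in> charts M" "x \<in> overlap M i j"
  shows "lam j (transition M i j x) = lam i x"
proof -
  have e: "split_cone_chart.\<zeta> (P k) (1, y) = P k (1, y) (1, 0)" if "k \<in> charts M" for k y
    unfolding split_cone_chart.\<zeta>_def[OF split[OF that]] cone_chart.euler_def[OF cone_chartI[OF g that]] by simp
  have "P j (1, transition M i j x) (1, 0) = lift M i j x (P i (1, x) (1, 0))"
    using natural[OF assms, of "(1, 0)"] unfolding lift_simps(4)[OF assms] .
  then show ?thesis
    unfolding split_cone_chart.lam_eq_fst[OF split[OF assms(1)] in_cimage[OF assms(3)]]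
      split_cone_chart.lam_eq_fst[OF split[OF assms(2)] transition_into[OF M assms(1,3)]]
      e[OF assms(1)] e[OF assms(2)]
    by (simp add: lift_def)
qed

text \<open>This follows from naturality on the base, because \<open>cone_Riem\<close> expresses the curvature of the cone by
  tensors of the base.\<close>

lemma R_natural:
  assumes i: "i \<in> charts M" and j: "j \<in> charts M" and x: "x \<in> overlap M i j"
  shows "R j (transition M i j x) (lift M i j x a) (lift M i j x b) (lift M i j x c) = lift M i j x (R i x a b c)"
proof -
  interpret iso: chart_isometry "cimage M i" "g i" "cimage M j" "g j" "overlap M i j" "transition M i j"
    by (rule chart_isometry_transition[OF g i j])
  have y: "transition M i j x \<in> cimage M j" by (rule transition_into[OF M i x])
  show ?thesis
    unfolding cone_chart.cone_Riem[OF cone_chartI[OF g i] zero_less_one in_cimage[OF x]]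
      cone_chart.cone_Riem[OF cone_chartI[OF g j] zero_less_one y]
    by (simp add: lift_def iso.Riem_transform[OF x] iso.isometry[OF x]
        linear_add[OF iso.d\<tau>_linear[OF x]] linear_diff[OF iso.d\<tau>_linear[OF x]] linear_scale[OF iso.d\<tau>_linear[OF x]])
qed

lemma T_natural:
  assumes ijx: "i \<in> charts M" "j \<in> charts M" "x \<in> overlap M i j"
  shows "T j (transition M i j x) (lift M i j x u) (lift M i j x v) (lift M i j x w) (lift M i j x z) = T i x u v w z"
  unfolding split_cone_chart.T_def[OF split[OF ijx(1)]] split_cone_chart.T_def[OF split[OF ijx(2)]]
    natural[OF ijx] R_natural[OF ijx] H_natural[OF ijx] ..

text \<open>The maximum is taken over finitely many products of a compact coordinate set with \<open>C\<close>. Since \<open>f\<close> need not be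
  invariant under transition maps, the bound at \<open>x\<close> is stated in the chart of the compact set into which \<open>x\<close> is
  moved.\<close>

lemma attains_max_on_cover:
  fixes f :: "'i \<Rightarrow> 'a \<times> 'c::euclidean_space \<Rightarrow> real"
  assumes C: "compact C" "C \<noteq> {}" and cont: "\<And>i. i \<in> charts M \<Longrightarrow> continuous_on (cimage M i \<times> C) (f i)"
    and F: "finite F" "\<And>k K. (k, K) \<in> F \<Longrightarrow> k \<in> charts M \<and> compact K \<and> K \<subseteq> cimage M k"
      "\<And>i x. i \<in> charts M \<Longrightarrow> x \<in> cimage M i \<Longrightarrow> \<exists>(k, K)\<in>F. x \<in> overlap M i k \<and> transition M i k x \<in> K"
  shows "\<exists>j\<in>charts M. \<exists>y\<in>cimage M j. \<exists>c\<in>C. \<forall>i\<in>charts M. \<forall>x\<in>cimage M i. \<exists>k\<in>charts M.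
    x \<in> overlap M i k \<and> (\<forall>c'\<in>C. f k (transition M i k x, c') \<le> f j (y, c))"
proof -
  define G where "G = {(k, K) \<in> F. K \<noteq> {}}"
  have finG: "finite G" unfolding G_def by (rule finite_subset[OF _ F(1)]) auto
  have "G \<noteq> {}"
  proof -
    obtain i x where "i \<in> charts M" "x \<in> cimage M i" using nonempty by auto
    from F(3)[OF this] show ?thesis by (auto simp: G_def)
  qed
  have "\<forall>q\<in>G. \<exists>s\<in>snd q \<times> C. \<forall>t\<in>snd q \<times> C. f (fst q) t \<le> f (fst q) s"
  proof
    fix q assume "q \<in> G"
    then obtain k K where q: "q = (k, K)" "(k, K) \<in> F" "K \<noteq> {}" by (auto simp: G_def)
    have "continuous_on (K \<times> C) (f k)"
      by (rule continuous_on_subset[OF cont[of k]]) (use F(2)[OF q(2)] in auto)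
    then have "\<exists>s\<in>K \<times> C. \<forall>t\<in>K \<times> C. f k t \<le> f k s"
      using F(2)[OF q(2)] q(3) C by (intro continuous_attains_sup compact_Times) auto
    then show "\<exists>s\<in>snd q \<times> C. \<forall>t\<in>snd q \<times> C. f (fst q) t \<le> f (fst q) s" by (simp add: q)
  qed
  then obtain s where s: "\<And>q. q \<in> G \<Longrightarrow> s q \<in> snd q \<times> C \<and> (\<forall>t\<in>snd q \<times> C. f (fst q) t \<le> f (fst q) (s q))"
    by metis
  have "Max ((\<lambda>q. f (fst q) (s q)) ` G) \<in> (\<lambda>q. f (fst q) (s q)) ` G"
    by (rule Max_in) (use finG \<open>G \<noteq> {}\<close> in auto)
  then obtain q0 where q0: "q0 \<in> G" "Max ((\<lambda>q. f (fst q) (s q)) ` G) = f (fst q0) (s q0)" by auto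
  have q0max: "f (fst q) (s q) \<le> f (fst q0) (s q0)" if "q \<in> G" for q
    unfolding q0(2)[symmetric] by (rule Max_ge) (use finG that in auto)
  have q0F: "(fst q0, snd q0) \<in> F" using q0(1) by (auto simp: G_def)
  have sq0: "s q0 \<in> snd q0 \<times> C" using s[OF q0(1)] by blast
  show ?thesis
  proof (rule bexI[where x = "fst q0", OF bexI[where x = "fst (s q0)", OF bexI[where x = "snd (s q0)", OF ballI[OF ballI]]]])
    show "fst q0 \<in> charts M" using F(2)[OF q0F] by blast
    show "fst (s q0) \<in> cimage M (fst q0)" using F(2)[OF q0F] sq0 by auto
    show "snd (s q0) \<in> C" using sq0 by auto
    fix i x assume "i \<in> charts M" "x \<in> cimage M i"
    from F(3)[OF this] obtain k K where k: "(k, K) \<in> F" "x \<in> overlap M i k" "transition M i k x \<in> K" by blast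
    then have kG: "(k, K) \<in> G" by (auto simp: G_def)
    have "f k (transition M i k x, c') \<le> f (fst q0) (fst (s q0), snd (s q0))" if "c' \<in> C" for c'
    proof -
      have "f k (transition M i k x, c') \<le> f k (s (k, K))"
        using s[OF kG] k(3) that by auto
      also have "\<dots> \<le> f (fst q0) (s q0)" using q0max[OF kG] by simp
      finally show ?thesis by simp
    qed
    then show "\<exists>k\<in>charts M. x \<in> overlap M i k \<and> (\<forall>c'\<in>C. f k (transition M i k x, c') \<le> f (fst q0) (fst (s q0), snd (s q0)))"
      using F(2)[OF k(1)] k(2) by blast
  qed
qed

lemma attains_max:
  fixes f :: "'i \<Rightarrow> 'a \<times> 'c::euclidean_space \<Rightarrow> real"
  assumes C: "compact C" "C \<noteq> {}" and cont: "\<And>i. i \<in> charts M \<Longrightarrow> continuous_on (cimage M i \<times> C) (f i)"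
  shows "\<exists>j\<in>charts M. \<exists>y\<in>cimage M j. \<exists>c\<in>C. \<forall>i\<in>charts M. \<forall>x\<in>cimage M i. \<exists>k\<in>charts M.
    x \<in> overlap M i k \<and> (\<forall>c'\<in>C. f k (transition M i k x, c') \<le> f j (y, c))"
proof -
  have comp: "compact_space (mtop M)" using closed by (simp add: closed_connected_def)
  show ?thesis
  proof (rule finite_compact_chart_cover[OF M comp])
    fix F assume F: "finite F"
      "\<And>k K. (k, K) \<in> F \<Longrightarrow> k \<in> charts M \<and> compact K \<and> K \<subseteq> cimage M k"
      "\<And>i x. i \<in> charts M \<Longrightarrow> x \<in> cimage M i \<Longrightarrow> \<exists>(k, K)\<in>F. x \<in> overlap M i k \<and> transition M i k x \<in> K"
    show ?thesis by (rule attains_max_on_cover[OF C cont F])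
  qed
qed

lemma lam_continuous:
  assumes "i \<in> charts M" shows "continuous_on (cimage M i) (lam i)"
  using has_derivative_continuous[OF split_cone_chart.lam_has_derivative[OF split[OF assms]]]
  by (auto intro: continuous_at_imp_continuous_on)

lemma lam_attains_min:
  "\<exists>j\<in>charts M. \<exists>y\<in>cimage M j. \<forall>i\<in>charts M. \<forall>x\<in>cimage M i. lam j y \<le> lam i x"
proof -
  have cont: "continuous_on (cimage M i \<times> {0::real}) (\<lambda>q. - lam i (fst q))" if "i \<in> charts M" for i
    by (intro continuous_on_minus continuous_on_compose2[OF lam_continuous[OF that]] continuous_on_fst continuous_on_id) auto
  have "\<exists>j\<in>charts M. \<exists>y\<in>cimage M j. \<forall>i\<in>charts M. \<forall>x\<in>cimage M i. \<exists>k\<in>charts M. x \<in> overlap M i k \<and>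
        - lam k (transition M i k x) \<le> - lam j y"
    using attains_max[where C = "{0::real}" and f = "\<lambda>i q. - lam i (fst q)", OF compact_sing _ cont] by simp
  then show ?thesis
  proof (elim bexE)
    fix j y assume j: "j \<in> charts M" "y \<in> cimage M j"
      and m: "\<forall>i\<in>charts M. \<forall>x\<in>cimage M i. \<exists>k\<in>charts M. x \<in> overlap M i k \<and>
        - lam k (transition M i k x) \<le> - lam j y"
    have "lam j y \<le> lam i x" if ix: "i \<in> charts M" "x \<in> cimage M i" for i x
    proof -
      from m[rule_format, OF ix] obtain k where k: "k \<in> charts M" "x \<in> overlap M i k"
        "- lam k (transition M i k x) \<le> - lam j y" by auto
      then show ?thesis using lam_natural[OF ix(1) k(1,2)] by simp
    qed
    then show ?thesis by (intro bexI[OF _ j(1)] bexI[OF _ j(2)] ballI)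
  qed
qed

lemma min_lam_0_or_1:
  assumes j: "j \<in> charts M" "y \<in> cimage M j"
    and min: "\<And>i x. i \<in> charts M \<Longrightarrow> x \<in> cimage M i \<Longrightarrow> lam j y \<le> lam i x"
  shows "lam j y = 0 \<or> lam j y = 1"
  by (rule split_cone_chart.critical_point(2)[OF split[OF j(1)] j(2)],
      rule split_cone_chart.minimum_critical[OF split[OF j(1)] j(2)], rule min[OF j(1)])

text \<open>If \<open>lam\<close> is constantly 0, then all points are minima, so \<open>\<zeta>\<close> vanishes on the whole slice.\<close>

lemma lam_not_identically_0:
  assumes 0: "\<And>i x. i \<in> charts M \<Longrightarrow> x \<in> cimage M i \<Longrightarrow> lam i x = 0"
  shows False
proof -
  obtain i x where i: "i \<in> charts M" and x: "x \<in> cimage M i" using nonempty by auto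
  interpret ch: split_cone_chart "cimage M i" "g i" "P i" by (rule split[OF i])
  have "ch.\<zeta> (1, y) = 0" if y: "y \<in> cimage M i" for y
  proof -
    have "ch.\<zeta> (1, y) = (lam i y, 0)"
      by (rule ch.critical_point(1)[OF y ch.minimum_critical[OF y]]) (simp add: 0[OF i] y)
    then show ?thesis using 0[OF i y] by (simp add: zero_prod_def)
  qed
  then have "P i (1, x) a = 0" for a
    using ch.\<zeta>_vanishes_locally[OF ch.base.S _ x] by blast
  then show False using nonzero[OF i x] by blast
qed

text \<open>If the minimum were 1, then \<open>1 - lam \<le> 0\<close>. But the minimum of \<open>1 - lam\<close>, which belongs to the
  complementary projection, is 0 or 1 as well. So \<open>1 - lam\<close> would be identically 0.\<close>

lemma lam_attains_0:
  "\<exists>j\<in>charts M. \<exists>y\<in>cimage M j. lam j y = 0 \<and> (\<forall>i\<in>charts M. \<forall>x\<in>cimage M i. lam j y \<le> lam i x)"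
proof -
  interpret comp: split_cone M g "\<lambda>i p a. a - P i p a" by (rule complement)
  have compl: "comp.lam i x = 1 - lam i x" if "i \<in> charts M" "x \<in> cimage M i" for i x
    by (rule split_cone_chart.lam_complement[OF split[OF that(1)] that(2)])
  obtain j y where j: "j \<in> charts M" "y \<in> cimage M j"
    and min: "\<And>i x. i \<in> charts M \<Longrightarrow> x \<in> cimage M i \<Longrightarrow> lam j y \<le> lam i x"
    using lam_attains_min by blast
  have "lam j y \<noteq> 1"
  proof
    assume 1: "lam j y = 1"
    obtain j' y' where j': "j' \<in> charts M" "y' \<in> cimage M j'"
      and min': "\<And>i x. i \<in> charts M \<Longrightarrow> x \<in> cimage M i \<Longrightarrow> comp.lam j' y' \<le> comp.lam i x"
      using comp.lam_attains_min by blast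
    have "comp.lam j' y' = 0 \<or> comp.lam j' y' = 1" by (rule comp.min_lam_0_or_1[OF j' min'])
    then have "comp.lam i x = 0" if "i \<in> charts M" "x \<in> cimage M i" for i x
      using min'[OF that] compl[OF that] min[OF that] 1 by linarith
    then show False by (rule comp.lam_not_identically_0)
  qed
  then have "lam j y = 0" using min_lam_0_or_1[OF j min] by blast
  then show ?thesis using j min by blast
qed

lemma H_P_natural:
  assumes "i \<in> charts M" "j \<in> charts M" "x \<in> overlap M i j"
  shows "H j (transition M i j x) (P j (1, transition M i j x) (lift M i j x a)) (lift M i j x a) = H i x (P i (1, x) a) a"
  unfolding natural[OF assms] H_natural[OF assms] ..

lemma lift_surj:
  assumes i: "i \<in> charts M" and j: "j \<in> charts M" and x: "x \<in> overlap M i j"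
  shows "\<exists>b. lift M i j x b = a" "lift M i j x b = 0 \<Longrightarrow> b = 0"
proof -
  interpret iso: chart_isometry "cimage M i" "g i" "cimage M j" "g j" "overlap M i j" "transition M i j"
    by (rule chart_isometry_transition[OF g i j])
  obtain v where "frechet_derivative (transition M i j) (at x) v = snd a" using iso.d\<tau>_surj[OF x] by blast
  then have "lift M i j x (fst a, v) = a" by (simp add: lift_def)
  then show "\<exists>b. lift M i j x b = a" ..
  assume "lift M i j x b = 0"
  then have "fst b = 0" "frechet_derivative (transition M i j) (at x) (snd b) = 0" by (simp_all add: lift_def prod_eq_iff)
  then show "b = 0"
    using linear_injective_0[OF iso.d\<tau>_linear[OF x]] iso.d\<tau>_inj[OF x] by (simp add: prod_eq_iff)
qed

lemma semidefinite:
  assumes i: "i \<in> charts M" "x \<in> cimage M i"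
  shows "H i x (P i (1, x) a) a \<ge> 0"
proof -
  obtain j y where j: "j \<in> charts M" "y \<in> cimage M j" "lam j y = 0"
    "\<And>i x. i \<in> charts M \<Longrightarrow> x \<in> cimage M i \<Longrightarrow> lam j y \<le> lam i x"
    using lam_attains_0 by blast
  have "\<forall>a. H i x (P i (1, x) a) a \<ge> 0"
  proof (rule connected_chart_induct[where Q = "\<lambda>i x. \<forall>a. H i x (P i (1, x) a) a \<ge> 0", OF M _ _ _ _ j(1,2) _ i])
    show "connected_space (mtop M)" using closed by (simp add: closed_connected_def)
    show "\<forall>a. H j y (P j (1, y) a) a \<ge> 0"
      using split_cone_chart.minimum_zero_semidefinite[OF split[OF j(1)] j(2) j(4)[OF j(1)] j(3)] by blast
    show "open {x \<in> cimage M i. \<forall>a. H i x (P i (1, x) a) a \<ge> 0}"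
      "open {x \<in> cimage M i. \<not> (\<forall>a. H i x (P i (1, x) a) a \<ge> 0)}" if "i \<in> charts M" for i
      using split_cone_chart.open_semidefinite[OF split[OF that]]
        split_cone_chart.open_not_semidefinite[OF split[OF that]] by blast+
    fix i j x assume ijx: "i \<in> charts M" "j \<in> charts M" "x \<in> overlap M i j"
    show "(\<forall>a. H i x (P i (1, x) a) a \<ge> 0) \<longleftrightarrow>
      (\<forall>a. H j (transition M i j x) (P j (1, transition M i j x) a) a \<ge> 0)"
      using H_P_natural[OF ijx] lift_surj(1)[OF ijx] by metis
  qed
  then show ?thesis by blast
qed

lemma positive_definite:
  assumes i: "i \<in> charts M" "x \<in> cimage M i" and a: "a \<noteq> 0"
  shows "H i x a a > 0"
proof -
  interpret ch: split_cone_chart "cimage M i" "g i" "P i" by (rule split[OF i(1)])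
  interpret comp: split_cone M g "\<lambda>i p a. a - P i p a" by (rule complement)
  note p = ch.slice[OF i(2)]
  have nn: "H i x a a \<ge> 0" for a
  proof -
    have "H i x a a = H i x (P i (1, x) a) a + H i x (a - P i (1, x) a) a"
      by (simp add: ch.cone.h_simps[OF p])
    then show ?thesis using semidefinite[OF i, of a] comp.semidefinite[OF i, of a] by simp
  qed
  moreover have "H i x a a \<noteq> 0"
  proof
    assume 0: "H i x a a = 0"
    have "H i x a w = 0" for w
      by (rule semidefinite_null_vector[where b = "H i x", OF ch.cone.h_linear(1)[OF p] ch.cone.h_linear(2)[OF p] ch.cone.sym[OF p] nn 0])
    then show False using ch.cone.nondeg[OF p] a by blast
  qed
  ultimately show ?thesis by (simp add: less_le)
qed

definition len where "len i x a = sqrt (H i x a a)"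

lemma len_pos: "i \<in> charts M \<Longrightarrow> x \<in> cimage M i \<Longrightarrow> a \<noteq> 0 \<Longrightarrow> len i x a > 0"
  unfolding len_def using positive_definite by simp

lemma H_simps:
  assumes "i \<in> charts M" "x \<in> cimage M i"
  shows "H i x (c *\<^sub>R a) b = c * H i x a b" "H i x a (c *\<^sub>R b) = c * H i x a b" "H i x 0 b = 0" "H i x b 0 = 0"
proof -
  interpret ch: split_cone_chart "cimage M i" "g i" "P i" by (rule split[OF assms(1)])
  show "H i x (c *\<^sub>R a) b = c * H i x a b" "H i x a (c *\<^sub>R b) = c * H i x a b" "H i x 0 b = 0" "H i x b 0 = 0"
    using ch.cone.h_simps[OF ch.slice[OF assms(2)]] by simp_all
qed

lemma len_scale: "i \<in> charts M \<Longrightarrow> x \<in> cimage M i \<Longrightarrow> c > 0 \<Longrightarrow> len i x (c *\<^sub>R a) = c * len i x a"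
  unfolding len_def by (simp add: H_simps real_sqrt_mult)

lemma len_natural:
  assumes "i \<in> charts M" "j \<in> charts M" "x \<in> overlap M i j"
  shows "len j (transition M i j x) (lift M i j x a) = len i x a"
  unfolding len_def H_natural[OF assms] ..

lemma T_simps:
  assumes "i \<in> charts M" "x \<in> cimage M i"
  shows "T i x (c *\<^sub>R u) v w z = c * T i x u v w z" "T i x u (c *\<^sub>R v) w z = c * T i x u v w z"
    "T i x u v (c *\<^sub>R w) z = c * T i x u v w z" "T i x u v w (c *\<^sub>R z) = c * T i x u v w z"
    "T i x u v w 0 = 0" "T i x u v 0 z = 0" "T i x u 0 w z = 0" "T i x 0 v w z = 0"
proof -
  interpret ch: split_cone_chart "cimage M i" "g i" "P i" by (rule split[OF assms(1)])
  note p = ch.slice[OF assms(2)]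
  show "T i x (c *\<^sub>R u) v w z = c * T i x u v w z" "T i x u (c *\<^sub>R v) w z = c * T i x u v w z"
    "T i x u v (c *\<^sub>R w) z = c * T i x u v w z" "T i x u v w (c *\<^sub>R z) = c * T i x u v w z"
    "T i x u v w 0 = 0" "T i x u v 0 z = 0" "T i x u 0 w z = 0" "T i x 0 v w z = 0"
    unfolding ch.T_def
    by (simp_all add: ch.P_simps[OF p] ch.cone.Riem_simps[OF p] ch.cone.h_simps[OF p])
qed

text \<open>The Euclidean unit sphere, over which the maximum is taken, depends on the chart. The quotient \<open>f\<close> is
  homogeneous of degree 0 in all four vectors, so that its maximum does bound it in every chart.\<close>

lemma curvature_block_vanishes_generically:
  assumes i: "i \<in> charts M" and x: "x \<in> cimage M i"
  shows "(1 - lam i x) * T i x u v w z = 0"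
proof -
  define f where "f i = (\<lambda>(x, (u, v, w, z)). (1 - lam i x) * T i x u v w z /
     (len i x u * len i x v * len i x w * len i x z))" for i
  define sph where "sph = sphere (0 :: real \<times> 'a) 1"
  have sph: "compact (sph \<times> sph \<times> sph \<times> sph)" "sph \<times> sph \<times> sph \<times> sph \<noteq> {}"
    unfolding sph_def by (intro compact_Times compact_sphere) simp
  have cont: "continuous_on (cimage M i \<times> (sph \<times> sph \<times> sph \<times> sph)) (f i)" if i: "i \<in> charts M" for i
  proof -
    interpret ch: split_cone_chart "cimage M i" "g i" "P i" by (rule split[OF i])
    have nz: "len i x a \<noteq> 0" if "x \<in> cimage M i" "a \<in> sph" for x a
      using len_pos[OF i that(1), of a] that(2) by (force simp: sph_def)
    have clen: "continuous_on (cimage M i \<times> sph \<times> sph \<times> sph \<times> sph) (\<lambda>q. len i (fst q) (t q))"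
      if "continuous_on (cimage M i \<times> sph \<times> sph \<times> sph \<times> sph) t" for t
      unfolding len_def
      by (intro continuous_on_real_sqrt ch.continuous_on_H_compose continuous_on_Pair continuous_on_const continuous_on_fst continuous_on_id that) auto
    have cT: "continuous_on (cimage M i \<times> sph \<times> sph \<times> sph \<times> sph)
       (\<lambda>q. T i (fst q) (fst (snd q)) (fst (snd (snd q))) (fst (snd (snd (snd q)))) (snd (snd (snd (snd q)))))"
      by (intro ch.continuous_on_T_compose continuous_intros) auto
    have cl: "continuous_on (cimage M i \<times> sph \<times> sph \<times> sph \<times> sph) (\<lambda>q. lam i (fst q))"
      by (rule continuous_on_compose2[OF lam_continuous[OF i]]) (auto intro!: continuous_intros)
    show ?thesis
      unfolding f_def case_prod_unfold
      by (intro continuous_on_divide continuous_on_mult continuous_on_diff continuous_on_const cT cl clen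
          continuous_on_fst continuous_on_snd continuous_on_id) (auto simp: nz)
  qed
  obtain j y c where j: "j \<in> charts M" "y \<in> cimage M j" and c: "c \<in> sph \<times> sph \<times> sph \<times> sph"
    and mx: "\<forall>i\<in>charts M. \<forall>x\<in>cimage M i. \<exists>k\<in>charts M. x \<in> overlap M i k \<and>
        (\<forall>c'\<in>sph \<times> sph \<times> sph \<times> sph. f k (transition M i k x, c') \<le> f j (y, c))"
    using attains_max[OF sph cont] by blast
  obtain u0 v0 w0 z0 where c0: "c = (u0, v0, w0, z0)" by (cases c)
  have nz0: "u0 \<noteq> 0" "v0 \<noteq> 0" "w0 \<noteq> 0" "z0 \<noteq> 0" using c by (auto simp: c0 sph_def)
  define K where "K = f j (y, c)"
  have bound: "(1 - lam i x) * T i x u v w z \<le> K * (len i x u * len i x v * len i x w * len i x z)"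
    if i: "i \<in> charts M" and x: "x \<in> cimage M i" for i x u v w z
  proof (cases "u = 0 \<or> v = 0 \<or> w = 0 \<or> z = 0")
    case True
    then show ?thesis by (auto simp: T_simps[OF i x] len_def H_simps[OF i x])
  next
    case False
    obtain k where k: "k \<in> charts M" and xk: "x \<in> overlap M i k"
      and m: "\<And>c'. c' \<in> sph \<times> sph \<times> sph \<times> sph \<Longrightarrow> f k (transition M i k x, c') \<le> K"
      using mx i x unfolding K_def by blast
    note ikx = i k xk
    note kx = k transition_into[OF M i xk]
    let ?l = "lift M i k x"
    define n where "n a = inverse (norm (?l a)) *\<^sub>R ?l a" for a
    have lp: "inverse (norm (?l a)) > 0" if "a \<noteq> 0" for a
      using lift_surj(2)[OF ikx, of a] that by auto
    have ns: "n a \<in> sph" if "a \<noteq> 0" for a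
      using lp[OF that] by (auto simp: n_def sph_def)
    have "f k (transition M i k x, (n u, n v, n w, n z)) \<le> K"
      by (rule m) (use False ns in auto)
    also have "f k (transition M i k x, (n u, n v, n w, n z)) =
       (1 - lam i x) * T i x u v w z / (len i x u * len i x v * len i x w * len i x z)"
    proof -
      define a b c d where "a = inverse (norm (?l u))" and "b = inverse (norm (?l v))"
        and "c = inverse (norm (?l w))" and "d = inverse (norm (?l z))"
      have pos: "a > 0" "b > 0" "c > 0" "d > 0"
        using lp False by (simp_all add: a_def b_def c_def d_def)
      have "f k (transition M i k x, (n u, n v, n w, n z)) = (1 - lam i x) * (a * (b * (c * (d * T i x u v w z)))) /
          ((a * len i x u) * (b * len i x v) * (c * len i x w) * (d * len i x z))"
        unfolding f_def n_def a_def[symmetric] b_def[symmetric] c_def[symmetric] d_def[symmetric]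
        by (simp add: T_simps[OF kx] len_scale[OF kx pos(1)] len_scale[OF kx pos(2)] len_scale[OF kx pos(3)] len_scale[OF kx pos(4)]
            len_natural[OF ikx] T_natural[OF ikx] lam_natural[OF ikx] algebra_simps)
      also have "\<dots> = ((a * b * c * d) * ((1 - lam i x) * T i x u v w z)) /
          ((a * b * c * d) * (len i x u * len i x v * len i x w * len i x z))"
        by (simp add: mult_ac)
      also have "\<dots> = (1 - lam i x) * T i x u v w z / (len i x u * len i x v * len i x w * len i x z)"
        by (rule mult_divide_mult_cancel_left) (use pos in simp)
      finally show ?thesis .
    qed
    finally show ?thesis
      using len_pos[OF i x] False by (simp add: pos_divide_le_eq)
  qed
  interpret ch: split_cone_chart "cimage M j" "g j" "P j" by (rule split[OF j(1)])
  define n where "n a = inverse (len j y a) *\<^sub>R a" for a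
  have unit: "H j y (n a) (n a) = 1" if "a \<noteq> 0" for a
  proof -
    have "len j y a * len j y a = H j y a a"
      unfolding len_def using positive_definite[OF j that] by simp
    then show ?thesis
      using len_pos[OF j that] positive_definite[OF j that] unfolding n_def by (simp add: H_simps[OF j] field_simps)
  qed
  have "K = 0"
  proof (rule ch.maximum_principle[OF j(2)])
    show "H j y (n u0) (n u0) = 1" "H j y (n v0) (n v0) = 1" "H j y (n w0) (n w0) = 1" "H j y (n z0) (n z0) = 1"
      using unit nz0 by blast+
    show "(1 - lam j y) * T j y (n u0) (n v0) (n w0) (n z0) = K"
      unfolding n_def T_simps[OF j] K_def c0 f_def by (simp add: field_simps)
    show "(1 - lam j x) * T j x u v w z \<le> K * sqrt (H j x u u * H j x v v * H j x w w * H j x z z)"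
      if "x \<in> cimage M j" for x u v w z
      using bound[OF j(1) that, of u v w z] by (simp add: len_def real_sqrt_mult)
  qed
  then have le: "(1 - lam i x) * T i x u v w z \<le> 0" for u
    using bound[OF i x, of u v w z] by simp
  \<comment> \<open>the bound also holds for \<open>- u\<close>, which changes the sign\<close>
  have "(1 - lam i x) * T i x ((- 1) *\<^sub>R u) v w z \<le> 0" by (rule le)
  then have "- ((1 - lam i x) * T i x u v w z) \<le> 0" unfolding T_simps(1)[OF i x] by simp
  then show ?thesis using le[of u] by simp
qed

lemma curvature_block_vanishes:
  assumes i: "i \<in> charts M" and x: "x \<in> cimage M i"
  shows "T i x u v w z = 0"
proof -
  interpret ch: split_cone_chart "cimage M i" "g i" "P i" by (rule split[OF i])
  obtain a where a: "P i (1, x) a \<noteq> a" using nonidentity[OF i x] by blast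
  have generic: "T i y u v w z = 0" if "y \<in> cimage M i" "lam i y \<noteq> 1" for y u v w z
    using curvature_block_vanishes_generically[OF i that(1), of u v w z] that(2) by simp
  show ?thesis
    by (rule ch.T_zero_of_generic[OF positive_definite[OF i] generic x a])
qed

lemma cone_curvature_vanishes:
  assumes i: "i \<in> charts M" and x: "x \<in> cimage M i"
  shows "R i x u v w = 0"
proof -
  interpret comp: split_cone M g "\<lambda>i p a. a - P i p a" by (rule complement)
  show ?thesis
    by (rule split_cone_chart.Riem_zero_of_blocks[OF split[OF i] x curvature_block_vanishes[OF i x] comp.curvature_block_vanishes[OF i x]])
qed

end

section \<open>Decomposable cones\<close>

lemma span_independent_full:
  fixes B :: "'a::euclidean_space set"
  assumes "independent B" "card B = DIM('a)"
  shows "span B = UNIV"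
  using card_eq_dim[of B UNIV] assms by (auto simp: dim_UNIV independent_imp_finite)

text \<open>The projection onto the distribution is compatible with the transition maps because the distribution
  and the metric are. The rank \<open>k\<close> is constant, so a distribution that is nontrivial somewhere is nontrivial at every
  point.\<close>

lemma split_cone_of_decomposable:
  fixes M :: "('m, 'i, 'a::euclidean_space) atlas" and g :: "('i, 'a) metric"
  assumes g: "pseudo_riemannian M g" and closed: "closed_connected M"
    and dec: "decomposable (metric_cone M) (cone_metric g)"
  shows "\<exists>P. split_cone M g P"
proof -
  note M = pseudo_riemannianD(1)[OF g]
  obtain D where dist: "distribution (metric_cone M) D" and nontriv: "nontrivial_distribution (metric_cone M) D"
    and par: "parallel_distribution (metric_cone M) (cone_metric g) D"
    and nondeg: "nondegenerate_distribution (metric_cone M) (cone_metric g) D"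
    using dec unfolding decomposable_def by blast
  define framed where "framed k i p \<longleftrightarrow> (\<exists>W E. open W \<and> p \<in> W \<and> W \<subseteq> {0<..} \<times> cimage M i \<and>
        (\<forall>a<k. smooth_on W (E a)) \<and>
        (\<forall>y\<in>W. inj_on (\<lambda>a::nat. E a y) {..<k} \<and> independent ((\<lambda>a. E a y) ` {..<k}) \<and>
           D i y = span ((\<lambda>a. E a y) ` {..<k})))" for k i p
  have "\<exists>k. \<forall>i\<in>charts M. \<forall>p\<in>{0<..} \<times> cimage M i. framed k i p"
    using dist unfolding distribution_def cimage_cone metric_cone_simps framed_def by (rule conjunct2)
  then obtain k where "\<forall>i\<in>charts M. \<forall>p\<in>{0<..} \<times> cimage M i. framed k i p" ..
  then have framed: "framed k i p" if "i \<in> charts M" "p \<in> {0<..} \<times> cimage M i" for i p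
    using that by blast
  have frame_at: "\<exists>f. inj_on f {..<k} \<and> independent (f ` {..<k}) \<and> D i p = span (f ` {..<k})"
    if ip: "i \<in> charts M" "p \<in> {0<..} \<times> cimage M i" for i p
    using framed[OF ip] unfolding framed_def
  proof (elim exE conjE)
    fix W E assume "p \<in> W" "\<forall>y\<in>W. inj_on (\<lambda>a::nat. E a y) {..<k} \<and> independent ((\<lambda>a. E a y) ` {..<k}) \<and>
           D i y = span ((\<lambda>a. E a y) ` {..<k})"
    then show ?thesis by (intro exI[of _ "\<lambda>a. E a p"]) blast
  qed
  have sub: "parallel_subbundle ({0<..} \<times> cimage M i) (cone_form (g i)) (D i) k" if i: "i \<in> charts M" for i
  proof -
    interpret cone_chart "cimage M i" "g i" by (rule cone_chartI[OF g i])
    show ?thesis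
    proof
      show "\<exists>W E. open W \<and> p \<in> W \<and> W \<subseteq> {0<..} \<times> cimage M i \<and> (\<forall>a<k. smooth_on W (E a)) \<and>
        (\<forall>y\<in>W. inj_on (\<lambda>a::nat. E a y) {..<k} \<and> independent ((\<lambda>a. E a y) ` {..<k}) \<and> D i y = span ((\<lambda>a. E a y) ` {..<k}))"
        if "p \<in> {0<..} \<times> cimage M i" for p using framed[OF i that] unfolding framed_def .
      show "v = 0" if "p \<in> {0<..} \<times> cimage M i" "v \<in> D i p" "\<And>w. w \<in> D i p \<Longrightarrow> cone_form (g i) p v w = 0" for p v
        using nondeg that i unfolding nondegenerate_distribution_def cimage_cone metric_cone_simps cone_metric_eq_cone_form by blast
      show "nabla (cone_form (g i)) X Y p \<in> D i p"
        if "open W" "W \<subseteq> {0<..} \<times> cimage M i" "smooth_on W X" "smooth_on W Y" "\<And>p. p \<in> W \<Longrightarrow> Y p \<in> D i p" "p \<in> W" for W X Y p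
        using par that i unfolding parallel_distribution_def cimage_cone metric_cone_simps cone_metric_eq_cone_form by metis
    qed
  qed
  define P where "P i = parallel_subbundle.proj (cone_form (g i)) (D i)" for i
  have k0: "k \<noteq> 0"
  proof
    assume "k = 0"
    then have "D i p = {0}" if "i \<in> charts M" "p \<in> {0<..} \<times> cimage M i" for i p
      using frame_at[OF that] by auto
    then show False using nontriv unfolding nontrivial_distribution_def cimage_cone metric_cone_simps by blast
  qed
  have kD: "k \<noteq> DIM(real \<times> 'a)"
  proof
    assume kD: "k = DIM(real \<times> 'a)"
    have "D i p = UNIV" if ip: "i \<in> charts M" "p \<in> {0<..} \<times> cimage M i" for i p
    proof -
      obtain f where "inj_on f {..<k}" "independent (f ` {..<k})" "D i p = span (f ` {..<k})"
        using frame_at[OF ip] by blast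
      then show ?thesis using span_independent_full[of "f ` {..<k}"] kD by (simp add: card_image)
    qed
    then show False using nontriv unfolding nontrivial_distribution_def cimage_cone metric_cone_simps by blast
  qed
  have "split_cone M g P"
  proof (rule split_cone.intro[OF g closed])
    show "\<exists>i\<in>charts M. cimage M i \<noteq> {}"
      using nontriv unfolding nontrivial_distribution_def cimage_cone metric_cone_simps by blast
    show "split_cone_chart (cimage M i) (g i) (P i)" if i: "i \<in> charts M" for i
    proof -
      interpret cone_chart "cimage M i" "g i" by (rule cone_chartI[OF g i])
      interpret sb: parallel_subbundle "{0<..} \<times> cimage M i" "cone_form (g i)" "D i" k by (rule sub[OF i])
      show ?thesis
        unfolding P_def
        by unfold_locales (rule sb.parallel_endo_proj sb.proj_idem sb.proj_selfadj; assumption)+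
    qed
    show "P j (1, transition M i j x) (lift M i j x a) = lift M i j x (P i (1, x) a)"
      if i: "i \<in> charts M" and j: "j \<in> charts M" and x: "x \<in> overlap M i j" for i j x a
    proof -
      interpret sbi: parallel_subbundle "{0<..} \<times> cimage M i" "cone_form (g i)" "D i" k by (rule sub[OF i])
      interpret sbj: parallel_subbundle "{0<..} \<times> cimage M j" "cone_form (g j)" "D j" k by (rule sub[OF j])
      have xi: "(1::real, x) \<in> {0<..} \<times> cimage M i" using subsetD[OF overlap_subset x] by simp
      have xj: "(1::real, transition M i j x) \<in> {0<..} \<times> cimage M j" using transition_into[OF M i x] by simp
      have "D j (transition (metric_cone M) i j (1, x)) =
          frechet_derivative (transition (metric_cone M) i j) (at (1, x)) ` D i (1, x)"
        using dist i j x unfolding distribution_def overlap_cone metric_cone_simps by auto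
      then have Dj: "D j (1, transition M i j x) = lift M i j x ` D i (1, x)"
        using transition_cone[OF M i subsetD[OF overlap_subset x] zero_less_one]
          frechet_derivative_transition_cone[OF M i j x zero_less_one]
        by (simp add: lift_def image_def)
      have Hn: "cone_form (g j) (1, transition M i j x) (lift M i j x a) (lift M i j x b) = cone_form (g i) (1, x) a b" for a b
        by (simp add: cone_form_apply lift_def pseudo_riemannianD(3)[OF g i j x])
      have lin: "linear (frechet_derivative (transition M i j) (at x))"
        using has_derivative_linear[OF transition_has_derivative[OF M i j x]] .
      show ?thesis
        unfolding P_def
      proof (rule sbj.proj_eqI[OF xj])
        show "lift M i j x (sbi.proj (1, x) a) \<in> D j (1, transition M i j x)"
          unfolding Dj using sbi.proj_in[OF xi] by blast
        fix d assume "d \<in> D j (1, transition M i j x)"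
        then obtain d' where d': "d' \<in> D i (1, x)" "d = lift M i j x d'" unfolding Dj by blast
        have "lift M i j x a - lift M i j x (sbi.proj (1, x) a) = lift M i j x (a - sbi.proj (1, x) a)"
          by (simp add: lift_def linear_diff[OF lin])
        then show "cone_form (g j) (1, transition M i j x) (lift M i j x a - lift M i j x (sbi.proj (1, x) a)) d = 0"
          unfolding d'(2) by (simp add: Hn sbi.proj_orth[OF xi d'(1)])
      qed
    qed
    fix i x assume i: "i \<in> charts M" and x: "x \<in> cimage M i"
    interpret sb: parallel_subbundle "{0<..} \<times> cimage M i" "cone_form (g i)" "D i" k by (rule sub[OF i])
    have p: "(1::real, x) \<in> {0<..} \<times> cimage M i" using x by simp
    obtain f where f: "inj_on f {..<k}" "independent (f ` {..<k})" "D i (1, x) = span (f ` {..<k})"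
      using frame_at[OF i p] by blast
    have card: "card (f ` {..<k}) = k" using f(1) by (simp add: card_image)
    show "\<exists>a. P i (1, x) a \<noteq> 0"
    proof -
      have "f 0 \<in> f ` {..<k}" using k0 by simp
      then have "f 0 \<in> D i (1, x)" "f 0 \<noteq> 0"
        using span_base[of "f 0" "f ` {..<k}"] dependent_zero[of "f ` {..<k}"] f(2,3) by metis+
      then show ?thesis unfolding P_def using sb.proj_fixes[OF p] by metis
    qed
    show "\<exists>a. P i (1, x) a \<noteq> a"
    proof (rule ccontr)
      assume "\<not> (\<exists>a. P i (1, x) a \<noteq> a)"
      then have "a \<in> D i (1, x)" for a using sb.proj_in[OF p, of a] unfolding P_def by metis
      then have "span (f ` {..<k}) = UNIV" using f(3) by blast
      then have "dim (f ` {..<k}) = DIM(real \<times> 'a)" by (metis dim_UNIV dim_span)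
      then show False using dim_eq_card_independent[OF f(2)] card kD by simp
    qed
  qed
  then show ?thesis by (rule exI[of "split_cone M g" P])
qed

theorem proposition4p1:
  fixes M :: "('m, 'i, 'a::euclidean_space) atlas" and g :: "('i, 'a) metric"
  assumes "pseudo_riemannian M g"
    and "closed_connected M"
    and "decomposable (metric_cone M) (cone_metric g)"
  shows "riemannian (metric_cone M) (cone_metric g) \<and> flat_metric (metric_cone M) (cone_metric g) \<and>
         riemannian M g \<and> constant_curvature M g 1"
proof -
  note g = assms(1)
  obtain P where "split_cone M g P" using split_cone_of_decomposable[OF assms] by (rule exE)
  then interpret split_cone M g P .
  have pos: "g i x v v > 0" if "i \<in> charts M" "x \<in> cimage M i" "v \<noteq> 0" for i x v
    using positive_definite[OF that(1,2), of "(0, v)"] that(3) by (simp add: cone_form_apply zero_prod_def)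
  have W: "metric_chart.Riem (g i) x u v w = g i x v w *\<^sub>R u - g i x u w *\<^sub>R v"
    if i: "i \<in> charts M" and x: "x \<in> cimage M i" for i x u v w
    using cone_curvature_vanishes[OF i x, of "(0, u)" "(0, v)" "(0, w)"]
      cone_chart.cone_Riem[OF cone_chartI[OF g i] zero_less_one x, of "(0, u)" "(0, v)" "(0, w)"]
    by (simp add: zero_prod_def algebra_simps)
  have "riemannian M g"
    unfolding riemannian_def using g pos by blast
  moreover have "riemannian (metric_cone M) (cone_metric g)"
    unfolding riemannian_def
  proof (intro conjI ballI allI impI)
    show "pseudo_riemannian (metric_cone M) (cone_metric g)" by (rule pseudo_riemannian_cone[OF g])
    fix i and p v :: "real \<times> 'a" assume "i \<in> charts (metric_cone M)" "p \<in> cimage (metric_cone M) i" and v: "v \<noteq> 0"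
    then have i: "i \<in> charts M" and p: "fst p > 0" "snd p \<in> cimage M i" by (auto simp: cimage_cone)
    have z: "g i (snd p) 0 0 = 0"
      using metric_chart.h_linear(1)[OF pseudo_riemannianD(2)[OF g i] p(2)] linear_0 by blast
    show "cone_metric g i p v v > 0"
    proof (cases "snd v = 0")
      case True
      then have "fst v \<noteq> 0" using v by (simp add: prod_eq_iff)
      then show ?thesis unfolding cone_metric_eq_cone_form cone_form_apply True z
        by (simp add: zero_less_mult_iff linorder_neq_iff disj_commute)
    next
      case False
      have "(fst p)\<^sup>2 * g i (snd p) (snd v) (snd v) > 0" using pos[OF i p(2) False] p(1) by simp
      then show ?thesis unfolding cone_metric_eq_cone_form cone_form_apply by (simp add: add_nonneg_pos)
    qed
  qed
  moreover have "flat_metric (metric_cone M) (cone_metric g)"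
    unfolding flat_metric_def
  proof (intro ballI allI)
    fix i and p u v w :: "real \<times> 'a" assume "i \<in> charts (metric_cone M)" "p \<in> cimage (metric_cone M) i"
    then obtain r x where i: "i \<in> charts M" and p: "p = (r, x)" "r > 0" "x \<in> cimage M i" by (auto simp: cimage_cone)
    interpret ch: cone_chart "cimage M i" "g i" by (rule cone_chartI[OF g i])
    show "curvature_at (cone_metric g i) p u v w = 0"
      using ch.cone.curvature_at_eq_Riem[of p u v w] p
      by (simp add: cone_metric_eq_cone_form ch.cone_Riem W[OF i p(3)] zero_prod_def)
  qed
  moreover have "constant_curvature M g 1"
    unfolding constant_curvature_def
  proof (intro ballI allI impI)
    fix i x u v assume i: "i \<in> charts M" and x: "x \<in> cimage M i"
      and nd: "g i x u u * g i x v v - (g i x u v)\<^sup>2 \<noteq> 0"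
    interpret metric_chart "cimage M i" "g i" by (rule pseudo_riemannianD(2)[OF g i])
    show "sectional_curvature (g i) x u v = 1"
      using nd unfolding sectional_curvature_def curvature_at_eq_Riem[OF x] W[OF i x]
      by (simp add: h_simps[OF x] sym[OF x, of v u] power2_eq_square mult.commute)
  qed
  ultimately show ?thesis by blast
qed

end
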